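(* Let $\mathbf{k}$ be an algebraically closed field, let $Q$ be a quiver of Dynkin type $A_l$ (arbitrary orientation) with vertices $1,\dots,l$, let $n$ be a positive integer, let $M$ be a finite-dimensional representation of $Q$ over $\mathbf{k}$, and write $$M\cong\bigoplus_{\mathbf{d}\in\Phi^+}a_{\mathbf{d}}M(\mathbf{d}),\qquad M^{\otimes n}\cong\bigoplus_{\mathbf{d}\in\Phi^+}a^{(n)}_{\mathbf{d}}M(\mathbf{d}).$$ Then $$b_n(M)=\sum_{i=1}^{l}(\dim M_i)^n-\sum_{\substack{\mathbf{d}\in\Phi^+\\ \ell(\mathbf{d})=2}}\Bigl(\sum_{\substack{\mathbf{d}'\in\Phi^+\\ \mathbf{d}'\ge\mathbf{d}}}a_{\mathbf{d}'}\Bigr)^{n}.$$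
   Context: $\Phi^+\subset\mathbb{N}^{l}$ is the set of positive roots of $Q$; by Gabriel's theorem, for each $\mathbf{d}\in\Phi^+$ there is, up to isomorphism, a unique indecomposable representation $M(\mathbf{d})$ with dimension vector $\mathbf{d}$, and these are all the indecomposables. $aM(\mathbf{d})$ denotes the $a$-fold direct sum. The pointwise tensor product is $(M\otimes N)_i=M_i\otimes_{\mathbf{k}}N_i$, $(M\otimes N)_\alpha=M_\alpha\otimes N_\alpha$, and $M^{\otimes n}$ is the $n$-fold power. $b_n(M)$ is the number of indecomposable direct summands of $M^{\otimes n}$ counted with multiplicities. For $\mathbf{d}=(d_i)$, $\ell(\mathbf{d})=\sum_i d_i$, and $\mathbf{d}'\ge\mathbf{d}$ means $d'_i\ge d_i$ for all $i$. *)

theory Defs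
  imports
    "HOL-Algebra.Algebraic_Closure"
    "Jordan_Normal_Form.Missing_VectorSpace"
    "Graph_Theory.Digraph"
begin

section \<open>Quivers and positive roots\<close>

text \<open>
  A quiver is a (multi-)digraph \<open>Q\<close>. It is of Dynkin type \<open>A\<^sub>l\<close> if its vertices are \<open>1, \<dots>, l\<close>
  and its underlying graph is a path \<open>p 1 \<midarrow> p 2 \<midarrow> \<dots> \<midarrow> p l\<close> with \<open>l - 1\<close> edges, for some
  numbering \<open>p\<close> of the vertices; the edge \<open>e i\<close> may be oriented either way.
\<close>

definition dynkin_type_A :: "nat \<Rightarrow> (nat, 'e) pre_digraph \<Rightarrow> bool" where
  "dynkin_type_A l Q \<longleftrightarrow>
     l \<ge> 1 \<and> verts Q = {1..l} \<and>
     (\<exists>p e. bij_betw p {1..l} {1..l} \<and> bij_betw e {1..<l} (arcs Q) \<and>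
        (\<forall>i\<in>{1..<l}. {tail Q (e i), head Q (e i)} = {p i, p (Suc i)}))"

definition tits_form :: "('q, 'e) pre_digraph \<Rightarrow> ('q \<Rightarrow> nat) \<Rightarrow> int" where
  "tits_form Q d =
     (\<Sum>i\<in>verts Q. (int (d i))\<^sup>2) - (\<Sum>\<alpha>\<in>arcs Q. int (d (tail Q \<alpha>)) * int (d (head Q \<alpha>)))"

text \<open>
  Dimension vectors are functions on the vertex type that vanish off \<^term>\<open>verts Q\<close>. For a Dynkin
  quiver the roots are the integer vectors at which the Tits form takes the value 1
  (so that 0 is excluded automatically).
\<close>

definition pos_roots :: "('q, 'e) pre_digraph \<Rightarrow> ('q \<Rightarrow> nat) set" where
  "pos_roots Q = {d. (\<forall>i. i \<notin> verts Q \<longrightarrow> d i = 0) \<and> tits_form Q d = 1}"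

definition dimvec_length :: "('q, 'e) pre_digraph \<Rightarrow> ('q \<Rightarrow> nat) \<Rightarrow> nat" where
  "dimvec_length Q d = (\<Sum>i\<in>verts Q. d i)"

definition dimvec_le :: "('q, 'e) pre_digraph \<Rightarrow> ('q \<Rightarrow> nat) \<Rightarrow> ('q \<Rightarrow> nat) \<Rightarrow> bool" where
  "dimvec_le Q d d' \<longleftrightarrow> (\<forall>i\<in>verts Q. d i \<le> d' i)"


section \<open>Representations\<close>

record ('k, 'v, 'q, 'e) qrep =
  space_at :: "'q \<Rightarrow> ('k, 'v) module"
  map_at :: "'e \<Rightarrow> 'v \<Rightarrow> 'v"

definition is_rep ::
  "('k, 'z) ring_scheme \<Rightarrow> ('q, 'e) pre_digraph \<Rightarrow> ('k, 'v, 'q, 'e) qrep \<Rightarrow> bool" where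
  "is_rep K Q M \<longleftrightarrow>
     (\<forall>i\<in>verts Q. vectorspace K (space_at M i) \<and> vectorspace.fin_dim K (space_at M i)) \<and>
     (\<forall>\<alpha>\<in>arcs Q. linear_map K (space_at M (tail Q \<alpha>)) (space_at M (head Q \<alpha>)) (map_at M \<alpha>))"

definition dimvec ::
  "('k, 'z) ring_scheme \<Rightarrow> ('q, 'e) pre_digraph \<Rightarrow> ('k, 'v, 'q, 'e) qrep \<Rightarrow> 'q \<Rightarrow> nat" where
  "dimvec K Q M i = (if i \<in> verts Q then vectorspace.dim K (space_at M i) else 0)"

definition rep_iso ::
  "('k, 'z) ring_scheme \<Rightarrow> ('q, 'e) pre_digraph \<Rightarrow>
   ('k, 'v, 'q, 'e) qrep \<Rightarrow> ('k, 'w, 'q, 'e) qrep \<Rightarrow> bool" where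
  "rep_iso K Q M N \<longleftrightarrow>
     (\<exists>\<phi>. (\<forall>i\<in>verts Q. linear_map K (space_at M i) (space_at N i) (\<phi> i) \<and>
                      bij_betw (\<phi> i) (carrier (space_at M i)) (carrier (space_at N i))) \<and>
          (\<forall>\<alpha>\<in>arcs Q. \<forall>x\<in>carrier (space_at M (tail Q \<alpha>)).
             \<phi> (head Q \<alpha>) (map_at M \<alpha> x) = map_at N \<alpha> (\<phi> (tail Q \<alpha>) x)))"

definition is_subrep ::
  "('k, 'z) ring_scheme \<Rightarrow> ('q, 'e) pre_digraph \<Rightarrow> ('k, 'v, 'q, 'e) qrep \<Rightarrow> ('q \<Rightarrow> 'v set) \<Rightarrow> bool"
  where
  "is_subrep K Q M U \<longleftrightarrow>
     (\<forall>i\<in>verts Q. subspace K (U i) (space_at M i)) \<and>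
     (\<forall>\<alpha>\<in>arcs Q. map_at M \<alpha> ` U (tail Q \<alpha>) \<subseteq> U (head Q \<alpha>))"

definition indecomposable ::
  "('k, 'z) ring_scheme \<Rightarrow> ('q, 'e) pre_digraph \<Rightarrow> ('k, 'v, 'q, 'e) qrep \<Rightarrow> bool" where
  "indecomposable K Q M \<longleftrightarrow>
     (\<exists>i\<in>verts Q. carrier (space_at M i) \<noteq> {\<zero>\<^bsub>space_at M i\<^esub>}) \<and>
     (\<forall>U W. is_subrep K Q M U \<and> is_subrep K Q M W \<and>
            (\<forall>i\<in>verts Q. U i \<inter> W i = {\<zero>\<^bsub>space_at M i\<^esub>} \<and>
                         U i <+>\<^bsub>space_at M i\<^esub> W i = carrier (space_at M i))
        \<longrightarrow> (\<forall>i\<in>verts Q. U i = {\<zero>\<^bsub>space_at M i\<^esub>}) \<or> (\<forall>i\<in>verts Q. W i = {\<zero>\<^bsub>space_at M i\<^esub>}))"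


subsection \<open>Direct sums\<close>

text \<open>
  External direct sum of a family indexed by a \<^emph>\<open>finite\<close> set \<open>I\<close>, realised on extensional functions.
  Here and below, the fields \<open>mult\<close> and \<open>one\<close> that the record type \<^type>\<open>module\<close> inherits
  from rings carry no information.
\<close>

definition dsum_space :: "'j set \<Rightarrow> ('j \<Rightarrow> ('k, 'v) module) \<Rightarrow> ('k, 'j \<Rightarrow> 'v) module" where
  "dsum_space I V =
     \<lparr>carrier = (\<Pi>\<^sub>E j\<in>I. carrier (V j)),
      monoid.mult = (\<lambda>f g. \<lambda>j\<in>I. \<zero>\<^bsub>V j\<^esub>),
      one = (\<lambda>j\<in>I. \<zero>\<^bsub>V j\<^esub>),
      zero = (\<lambda>j\<in>I. \<zero>\<^bsub>V j\<^esub>),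
      add = (\<lambda>f g. \<lambda>j\<in>I. f j \<oplus>\<^bsub>V j\<^esub> g j),
      smult = (\<lambda>c f. \<lambda>j\<in>I. c \<odot>\<^bsub>V j\<^esub> f j)\<rparr>"

definition dsum_rep ::
  "'j set \<Rightarrow> ('j \<Rightarrow> ('k, 'v, 'q, 'e) qrep) \<Rightarrow> ('k, 'j \<Rightarrow> 'v, 'q, 'e) qrep" where
  "dsum_rep I N =
     \<lparr>space_at = (\<lambda>i. dsum_space I (\<lambda>j. space_at (N j) i)),
      map_at = (\<lambda>\<alpha> f. \<lambda>j\<in>I. map_at (N j) \<alpha> (f j))\<rparr>"

text \<open>\<open>dsum_mult D a N\<close> is \<open>\<Oplus>\<^bsub>d \<in> D\<^esub> a\<^sub>d N(d)\<close>; its index set contains \<open>a d\<close> copies of each \<open>d \<in> D\<close>.\<close>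

definition dsum_mult ::
  "'d set \<Rightarrow> ('d \<Rightarrow> nat) \<Rightarrow> ('d \<Rightarrow> ('k, 'v, 'q, 'e) qrep) \<Rightarrow> ('k, 'd \<times> nat \<Rightarrow> 'v, 'q, 'e) qrep" where
  "dsum_mult D a N = dsum_rep (SIGMA d:D. {..<a d}) (\<lambda>(d, _). N d)"


subsection \<open>The number of indecomposable summands\<close>

text \<open>
  The summands may be taken on the carrier type of \<open>N\<close> itself, since every direct summand of \<open>N\<close>
  is isomorphic to a subrepresentation of \<open>N\<close>. Uniqueness of the number is Krull--Schmidt.
\<close>

definition num_indec_summands ::
  "('k, 'z) ring_scheme \<Rightarrow> ('q, 'e) pre_digraph \<Rightarrow> ('k, 'v, 'q, 'e) qrep \<Rightarrow> nat" where
  "num_indec_summands K Q N =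
     (THE m. \<exists>Y :: nat \<Rightarrow> ('k, 'v, 'q, 'e) qrep.
        (\<forall>j<m. is_rep K Q (Y j) \<and> indecomposable K Q (Y j)) \<and>
        rep_iso K Q N (dsum_rep {..<m} Y))"


section \<open>Tensor products\<close>

text \<open>
  \<open>V\<^sub>1 \<otimes> \<dots> \<otimes> V\<^sub>n\<close> is the quotient of the free module on \<open>V\<^sub>1 \<times> \<dots> \<times> V\<^sub>n\<close> by the multilinearity
  relations. Finite lists of factors, instead of an iterated binary product, keep the carrier
  type of \<open>M\<^sup>\<otimes>\<^sup>n\<close> independent of \<open>n\<close>.
\<close>

definition free_mod :: "('k, 'z) ring_scheme \<Rightarrow> 's set \<Rightarrow> ('k, 's \<Rightarrow> 'k) module" where
  "free_mod K S =
     \<lparr>carrier = {f. finite {s. f s \<noteq> \<zero>\<^bsub>K\<^esub>} \<and> (\<forall>s\<in>S. f s \<in> carrier K) \<and> (\<forall>s. s \<notin> S \<longrightarrow> f s = \<zero>\<^bsub>K\<^esub>)},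
      monoid.mult = (\<lambda>f g s. \<zero>\<^bsub>K\<^esub>),
      one = (\<lambda>s. \<zero>\<^bsub>K\<^esub>),
      zero = (\<lambda>s. \<zero>\<^bsub>K\<^esub>),
      add = (\<lambda>f g s. f s \<oplus>\<^bsub>K\<^esub> g s),
      smult = (\<lambda>c f s. c \<otimes>\<^bsub>K\<^esub> f s)\<rparr>"

definition free_gen :: "('k, 'z) ring_scheme \<Rightarrow> 's \<Rightarrow> 's \<Rightarrow> 'k" where
  "free_gen K s = (\<lambda>t. if t = s then \<one>\<^bsub>K\<^esub> else \<zero>\<^bsub>K\<^esub>)"

definition quot_mod :: "('k, 'v) module \<Rightarrow> 'v set \<Rightarrow> ('k, 'v set) module" where
  "quot_mod V N =
     \<lparr>carrier = a_rcosets\<^bsub>V\<^esub> N,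
      monoid.mult = (\<lambda>Y Z. N),
      one = N,
      zero = N,
      add = set_add V,
      smult = (\<lambda>c Y. \<Union>x\<in>Y. N +>\<^bsub>V\<^esub> (c \<odot>\<^bsub>V\<^esub> x))\<rparr>"

definition tuples :: "('k, 'v) module list \<Rightarrow> 'v list set" where
  "tuples Vs = {xs. length xs = length Vs \<and> (\<forall>j<length Vs. xs ! j \<in> carrier (Vs ! j))}"

definition multilinear_rels ::
  "('k, 'z) ring_scheme \<Rightarrow> ('k, 'v) module list \<Rightarrow> ('v list \<Rightarrow> 'k) set" where
  "multilinear_rels K Vs =
     (let F = free_mod K (tuples Vs) in
       {free_gen K (xs[j := x \<oplus>\<^bsub>Vs ! j\<^esub> y])
          \<ominus>\<^bsub>F\<^esub> (free_gen K (xs[j := x]) \<oplus>\<^bsub>F\<^esub> free_gen K (xs[j := y])) | xs j x y.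
          xs \<in> tuples Vs \<and> j < length Vs \<and> x \<in> carrier (Vs ! j) \<and> y \<in> carrier (Vs ! j)} \<union>
       {free_gen K (xs[j := c \<odot>\<^bsub>Vs ! j\<^esub> x]) \<ominus>\<^bsub>F\<^esub> c \<odot>\<^bsub>F\<^esub> free_gen K (xs[j := x]) | xs j c x.
          xs \<in> tuples Vs \<and> j < length Vs \<and> c \<in> carrier K \<and> x \<in> carrier (Vs ! j)})"

definition tensor_null ::
  "('k, 'z) ring_scheme \<Rightarrow> ('k, 'v) module list \<Rightarrow> ('v list \<Rightarrow> 'k) set" where
  "tensor_null K Vs = module.span K (free_mod K (tuples Vs)) (multilinear_rels K Vs)"

definition tensor_space ::
  "('k, 'z) ring_scheme \<Rightarrow> ('k, 'v) module list \<Rightarrow> ('k, ('v list \<Rightarrow> 'k) set) module" where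
  "tensor_space K Vs = quot_mod (free_mod K (tuples Vs)) (tensor_null K Vs)"

text \<open>
  \<open>tensor_map K Ws fs\<close> is \<open>f\<^sub>1 \<otimes> \<dots> \<otimes> f\<^sub>n\<close> with codomain \<^term>\<open>tensor_space K Ws\<close>: the coset of
  \<open>\<Sum> u\<^sub>s s\<close> is sent to the coset of \<open>\<Sum> u\<^sub>s (f\<^sub>1 s\<^sub>1, \<dots>, f\<^sub>n s\<^sub>n)\<close>.
\<close>

definition tensor_map ::
  "('k, 'z) ring_scheme \<Rightarrow> ('k, 'v) module list \<Rightarrow> ('v \<Rightarrow> 'v) list \<Rightarrow>
   ('v list \<Rightarrow> 'k) set \<Rightarrow> ('v list \<Rightarrow> 'k) set" where
  "tensor_map K Ws fs Y =
     (let F = free_mod K (tuples Ws) in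
       \<Union>u\<in>Y. tensor_null K Ws +>\<^bsub>F\<^esub>
         (\<Oplus>\<^bsub>F\<^esub> s\<in>{s. u s \<noteq> \<zero>\<^bsub>K\<^esub>}. u s \<odot>\<^bsub>F\<^esub> free_gen K (map2 (\<lambda>f x. f x) fs s)))"

definition tensor_rep ::
  "('k, 'z) ring_scheme \<Rightarrow> ('q, 'e) pre_digraph \<Rightarrow> ('k, 'v, 'q, 'e) qrep list \<Rightarrow>
   ('k, ('v list \<Rightarrow> 'k) set, 'q, 'e) qrep" where
  "tensor_rep K Q Ms =
     \<lparr>space_at = (\<lambda>i. tensor_space K (map (\<lambda>M. space_at M i) Ms)),
      map_at = (\<lambda>\<alpha>. tensor_map K (map (\<lambda>M. space_at M (head Q \<alpha>)) Ms) (map (\<lambda>M. map_at M \<alpha>) Ms))\<rparr>"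

definition tensor_power_rep ::
  "('k, 'z) ring_scheme \<Rightarrow> ('q, 'e) pre_digraph \<Rightarrow> nat \<Rightarrow> ('k, 'v, 'q, 'e) qrep \<Rightarrow>
   ('k, ('v list \<Rightarrow> 'k) set, 'q, 'e) qrep" where
  "tensor_power_rep K Q n M = tensor_rep K Q (replicate n M)"

definition b_num ::
  "('k, 'z) ring_scheme \<Rightarrow> ('q, 'e) pre_digraph \<Rightarrow> nat \<Rightarrow> ('k, 'v, 'q, 'e) qrep \<Rightarrow> nat" where
  "b_num K Q n M = num_indec_summands K Q (tensor_power_rep K Q n M)"

end

theory Submission
  imports Defs
begin

text \<open>
  For a representation \<open>N\<close> let \<open>\<chi>(N)\<close> be the sum of the dimensions of all \<open>N\<^sub>i\<close> minus the sum of the ranks of all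
  \<open>N\<^sub>\<alpha>\<close> (\<open>dim_minus_rank\<close> below). It is invariant under isomorphism and additive on direct sums, and
  over a quiver of type \<open>A\<close> it equals 1 on every indecomposable (\<open>indecomposable_type_A\<close>). So \<open>\<chi>(N)\<close>
  is the number of summands in every decomposition of \<open>N\<close> into indecomposables
  (\<open>num_indec_summands_eq_dim_minus_rank\<close>), and in particular this number is unique.

  Dimension and rank are multiplicative under tensor powers (\<open>tensor_power_dim\<close>,
  \<open>tensor_map_linear_rank\<close>), hence \<open>\<chi>\<close> of the \<open>n\<close>-th tensor power of \<open>M\<close> is the sum of the
  \<open>(dim M\<^sub>i)\<^sup>n\<close> minus the sum of the \<open>(rank M\<^sub>\<alpha>)\<^sup>n\<close>. It remains to translate ranks into multiplicities.
  An indecomposable over type \<open>A\<close> has spaces of dimension at most 1, and the map along an arrow has rank 1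
  exactly if the spaces at both ends are nonzero. So the rank of \<open>M\<^sub>\<alpha>\<close> counts the summands \<open>M(d')\<close> of \<open>M\<close> with
  \<open>d'\<close> at least 1 at both ends of \<open>\<alpha>\<close> (\<open>arrow_rank_dsum_mult\<close>), and the vectors that are 1 at the two
  ends of an arrow and 0 elsewhere are exactly the roots of length 2 (\<open>roots_of_length_two\<close>).

  The core is that \<open>\<chi>\<close> equals 1 on indecomposables. Follow the underlying path \<open>V\<^sub>1, \<dots>, V\<^sub>l\<close>, whose edges
  point in either direction. The part of the representation left of vertex \<open>k\<close> induces a finite chain of
  subspaces of \<open>V\<^sub>k\<close>, its flag: images and preimages of the flag at the previous vertex. Every
  splitting of \<open>V\<^sub>k\<close> into two subspaces that also splits each member of the flag extends to a splitting
  \<open>U \<oplus> W\<close> of the whole left part, and \<open>U\<close> can be chosen such that its maps are injective on edges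
  pointing right and surjective on edges pointing left (\<open>flag_of_extendable_splittings\<close>). At the last
  vertex with \<open>V\<^sub>k \<noteq> 0\<close>, take a line as the first of the two subspaces. For an indecomposable the
  other part \<open>W\<close> vanishes, so \<open>V\<^sub>k\<close> is a line and the rank on each edge to its left is the dimension
  at the left end of that edge; everything cancels in \<open>\<chi>\<close> except \<open>dim V\<^sub>k = 1\<close>.
\<close>

section \<open>Subspaces and complements\<close>

lemma linear_mapI:
  assumes "vectorspace K V" "vectorspace K W"
    and "\<And>x. x \<in> carrier V \<Longrightarrow> f x \<in> carrier W"
    and "\<And>x y. x \<in> carrier V \<Longrightarrow> y \<in> carrier V \<Longrightarrow> f (x \<oplus>\<^bsub>V\<^esub> y) = f x \<oplus>\<^bsub>W\<^esub> f y"
    and "\<And>c x. c \<in> carrier K \<Longrightarrow> x \<in> carrier V \<Longrightarrow> f (c \<odot>\<^bsub>V\<^esub> x) = c \<odot>\<^bsub>W\<^esub> f x"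
  shows "linear_map K V W f"
proof -
  interpret V: vectorspace K V by fact
  interpret W: vectorspace K W by fact
  show ?thesis
    by unfold_locales (use assms in \<open>auto simp: module_hom_def\<close>)
qed

lemma linear_mapD:
  assumes "linear_map K V W f"
  shows "x \<in> carrier V \<Longrightarrow> f x \<in> carrier W"
    and "x \<in> carrier V \<Longrightarrow> y \<in> carrier V \<Longrightarrow> f (x \<oplus>\<^bsub>V\<^esub> y) = f x \<oplus>\<^bsub>W\<^esub> f y"
    and "c \<in> carrier K \<Longrightarrow> x \<in> carrier V \<Longrightarrow> f (c \<odot>\<^bsub>V\<^esub> x) = c \<odot>\<^bsub>W\<^esub> f x"
    and "f \<zero>\<^bsub>V\<^esub> = \<zero>\<^bsub>W\<^esub>" "vectorspace K V" "vectorspace K W"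
proof -
  interpret f: linear_map K V W f by fact
  show "x \<in> carrier V \<Longrightarrow> f x \<in> carrier W"
    and "x \<in> carrier V \<Longrightarrow> y \<in> carrier V \<Longrightarrow> f (x \<oplus>\<^bsub>V\<^esub> y) = f x \<oplus>\<^bsub>W\<^esub> f y"
    and "c \<in> carrier K \<Longrightarrow> x \<in> carrier V \<Longrightarrow> f (c \<odot>\<^bsub>V\<^esub> x) = c \<odot>\<^bsub>W\<^esub> f x"
    and "f \<zero>\<^bsub>V\<^esub> = \<zero>\<^bsub>W\<^esub>" by auto
  show "vectorspace K V" "vectorspace K W" using assms by (auto simp: linear_map_def)
qed

lemma subspaceI:
  assumes "vectorspace K V" "N \<subseteq> carrier V" "\<zero>\<^bsub>V\<^esub> \<in> N"
    and "\<And>x y. x \<in> N \<Longrightarrow> y \<in> N \<Longrightarrow> x \<oplus>\<^bsub>V\<^esub> y \<in> N"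
    and "\<And>c x. c \<in> carrier K \<Longrightarrow> x \<in> N \<Longrightarrow> c \<odot>\<^bsub>V\<^esub> x \<in> N"
  shows "subspace K N V"
  using assms by (auto simp: subspace_def submodule_def vectorspace_def)

lemma subspaceD:
  assumes "subspace K N V"
  shows "N \<subseteq> carrier V" "\<zero>\<^bsub>V\<^esub> \<in> N"
    and "\<And>x y. x \<in> N \<Longrightarrow> y \<in> N \<Longrightarrow> x \<oplus>\<^bsub>V\<^esub> y \<in> N"
    and "\<And>c x. c \<in> carrier K \<Longrightarrow> x \<in> N \<Longrightarrow> c \<odot>\<^bsub>V\<^esub> x \<in> N"
    and "\<And>x. x \<in> N \<Longrightarrow> \<ominus>\<^bsub>V\<^esub> x \<in> N"
    and "\<And>x y. x \<in> N \<Longrightarrow> y \<in> N \<Longrightarrow> x \<ominus>\<^bsub>V\<^esub> y \<in> N"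
    and "vectorspace K V" "vectorspace K (V\<lparr>carrier := N\<rparr>)"
proof -
  interpret V: vectorspace K V using assms by (simp add: subspace_def)
  show vs: "vectorspace K V" ..
  show sub: "N \<subseteq> carrier V" and "\<zero>\<^bsub>V\<^esub> \<in> N"
    and add: "\<And>x y. x \<in> N \<Longrightarrow> y \<in> N \<Longrightarrow> x \<oplus>\<^bsub>V\<^esub> y \<in> N"
    and sm: "\<And>c x. c \<in> carrier K \<Longrightarrow> x \<in> N \<Longrightarrow> c \<odot>\<^bsub>V\<^esub> x \<in> N"
    using assms by (auto simp: subspace_def submodule_def)
  show neg: "\<ominus>\<^bsub>V\<^esub> x \<in> N" if "x \<in> N" for x
    using sm[of "\<ominus>\<^bsub>K\<^esub> \<one>\<^bsub>K\<^esub>" x] that sub V.smult_minus_1[of x] by auto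
  show "x \<ominus>\<^bsub>V\<^esub> y \<in> N" if "x \<in> N" "y \<in> N" for x y
    using add[OF that(1) neg[OF that(2)]] by (simp add: a_minus_def)
  show "vectorspace K (V\<lparr>carrier := N\<rparr>)"
    using assms by (rule V.subspace_is_vs)
qed

lemma subspace_zero: "vectorspace K V \<Longrightarrow> subspace K {\<zero>\<^bsub>V\<^esub>} V"
proof -
  assume "vectorspace K V"
  then interpret V: vectorspace K V .
  show ?thesis by (rule subspaceI) (auto intro: V.vectorspace_axioms)
qed

lemma subspace_carrier: "vectorspace K V \<Longrightarrow> subspace K (carrier V) V"
proof -
  assume "vectorspace K V"
  then interpret V: vectorspace K V .
  show ?thesis by (rule subspaceI) (auto intro: V.vectorspace_axioms)
qed

lemma subspace_Int: "subspace K A V \<Longrightarrow> subspace K B V \<Longrightarrow> subspace K (A \<inter> B) V"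
  by (rule subspaceI) (use subspaceD[of K A V] subspaceD[of K B V] in auto)

lemma subspace_image:
  assumes "linear_map K V W f" "subspace K A V"
  shows "subspace K (f ` A) W"
proof -
  interpret f: linear_map K V W f by fact
  note A = subspaceD[OF assms(2)]
  have sub: "x \<in> A \<Longrightarrow> x \<in> carrier V" for x using A by auto
  show ?thesis
  proof (rule subspaceI)
    show "\<zero>\<^bsub>W\<^esub> \<in> f ` A" using A(2) f.f0_is_0 by (metis image_eqI)
    show "x \<oplus>\<^bsub>W\<^esub> y \<in> f ` A" if "x \<in> f ` A" "y \<in> f ` A" for x y
      using that A(3) sub by (auto simp flip: f.f_add)
    show "c \<odot>\<^bsub>W\<^esub> x \<in> f ` A" if "c \<in> carrier K" "x \<in> f ` A" for c x
      using that A(4) sub by (auto simp flip: f.f_smult)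
  qed (use sub in \<open>auto intro: f.W.vectorspace_axioms\<close>)
qed

lemma subspace_vimage:
  assumes "linear_map K V W f" "subspace K B W"
  shows "subspace K {x \<in> carrier V. f x \<in> B} V"
proof -
  interpret f: linear_map K V W f by fact
  note B = subspaceD[OF assms(2)]
  show ?thesis
    by (rule subspaceI) (use B in \<open>auto intro: f.V.vectorspace_axioms\<close>)
qed

lemma set_addI: "a \<in> A \<Longrightarrow> b \<in> B \<Longrightarrow> a \<oplus>\<^bsub>V\<^esub> b \<in> A <+>\<^bsub>V\<^esub> B"
  by (auto simp: set_add_def')

lemma set_addE: "x \<in> A <+>\<^bsub>V\<^esub> B \<Longrightarrow> (\<And>a b. a \<in> A \<Longrightarrow> b \<in> B \<Longrightarrow> x = a \<oplus>\<^bsub>V\<^esub> b \<Longrightarrow> P) \<Longrightarrow> P"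
  by (auto simp: set_add_def')

lemma subspace_sum:
  assumes "subspace K A V" "subspace K B V"
  shows "subspace K (A <+>\<^bsub>V\<^esub> B) V"
proof -
  interpret V: vectorspace K V by (rule subspaceD(7)[OF assms(1)])
  note A = subspaceD[OF assms(1)] and B = subspaceD[OF assms(2)]
  have sA: "x \<in> A \<Longrightarrow> x \<in> carrier V" for x using A by auto
  have sB: "x \<in> B \<Longrightarrow> x \<in> carrier V" for x using B by auto
  show ?thesis
  proof (rule subspaceI)
    show "A <+>\<^bsub>V\<^esub> B \<subseteq> carrier V" by (auto simp: set_add_def' sA sB)
    show "\<zero>\<^bsub>V\<^esub> \<in> A <+>\<^bsub>V\<^esub> B" using A(2) B(2) V.l_zero[OF V.M.zero_closed] by (force simp: set_add_def')
    show "x \<oplus>\<^bsub>V\<^esub> y \<in> A <+>\<^bsub>V\<^esub> B" if "x \<in> A <+>\<^bsub>V\<^esub> B" "y \<in> A <+>\<^bsub>V\<^esub> B" for x y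
    proof -
      from that obtain a b a' b' where *: "a \<in> A" "b \<in> B" "a' \<in> A" "b' \<in> B" "x = a \<oplus>\<^bsub>V\<^esub> b" "y = a' \<oplus>\<^bsub>V\<^esub> b'"
        by (auto simp: set_add_def')
      then have "x \<oplus>\<^bsub>V\<^esub> y = (a \<oplus>\<^bsub>V\<^esub> a') \<oplus>\<^bsub>V\<^esub> (b \<oplus>\<^bsub>V\<^esub> b')"
        using sA sB by (simp add: V.a_ac)
      then show ?thesis using * A(3) B(3) by (metis set_addI)
    qed
    show "c \<odot>\<^bsub>V\<^esub> x \<in> A <+>\<^bsub>V\<^esub> B" if "c \<in> carrier K" "x \<in> A <+>\<^bsub>V\<^esub> B" for c x
    proof -
      from that obtain a b where *: "a \<in> A" "b \<in> B" "x = a \<oplus>\<^bsub>V\<^esub> b"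
        by (auto simp: set_add_def')
      then have "c \<odot>\<^bsub>V\<^esub> x = (c \<odot>\<^bsub>V\<^esub> a) \<oplus>\<^bsub>V\<^esub> (c \<odot>\<^bsub>V\<^esub> b)"
        using sA sB that by (simp add: V.smult_r_distr)
      then show ?thesis using * that A(4) B(4) by (metis set_addI)
    qed
  qed (rule V.vectorspace_axioms)
qed

lemma set_add_upper:
  assumes "subspace K A V" "subspace K B V"
  shows "A \<subseteq> A <+>\<^bsub>V\<^esub> B" "B \<subseteq> A <+>\<^bsub>V\<^esub> B"
proof -
  interpret V: vectorspace K V by (rule subspaceD(7)[OF assms(1)])
  note A = subspaceD[OF assms(1)] and B = subspaceD[OF assms(2)]
  show "A \<subseteq> A <+>\<^bsub>V\<^esub> B"
  proof
    fix x assume x: "x \<in> A"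
    then have "x = x \<oplus>\<^bsub>V\<^esub> \<zero>\<^bsub>V\<^esub>" using A by auto
    then show "x \<in> A <+>\<^bsub>V\<^esub> B" using x B(2) set_addI by metis
  qed
  show "B \<subseteq> A <+>\<^bsub>V\<^esub> B"
  proof
    fix x assume x: "x \<in> B"
    then have "x = \<zero>\<^bsub>V\<^esub> \<oplus>\<^bsub>V\<^esub> x" using B by auto
    then show "x \<in> A <+>\<^bsub>V\<^esub> B" using x A(2) set_addI by metis
  qed
qed

text \<open>
  Zorn's lemma yields a subspace \<open>Z\<close> that contains \<open>A\<close>, meets \<open>N\<close> trivially and is maximal with this
  property inside \<open>M\<close>. If some \<open>x\<close> in \<open>M\<close> lay outside \<open>Z + N\<close>, then adding the line through \<open>x\<close> to \<open>Z\<close>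
  would keep the intersection with \<open>N\<close> trivial.
\<close>

lemma complement_exists:
  assumes A: "subspace K A V" and N: "subspace K N V" and M: "subspace K M V"
    and "A \<subseteq> M" and AN: "A \<inter> N = {\<zero>\<^bsub>V\<^esub>}"
  obtains Z where "subspace K Z V" "A \<subseteq> Z" "Z \<subseteq> M" "Z \<inter> N = {\<zero>\<^bsub>V\<^esub>}" "M \<subseteq> Z <+>\<^bsub>V\<^esub> N"
proof -
  interpret V: vectorspace K V by (rule subspaceD(7)[OF A])
  define S where "S = {Z. subspace K Z V \<and> A \<subseteq> Z \<and> Z \<subseteq> M \<and> Z \<inter> N = {\<zero>\<^bsub>V\<^esub>}}"
  have "\<exists>Z\<in>S. \<forall>Y\<in>S. Z \<subseteq> Y \<longrightarrow> Y = Z"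
  proof (rule subset_Zorn_nonempty)
    show "S \<noteq> {}" using assms by (auto simp: S_def)
    fix \<Z> assume ne: "\<Z> \<noteq> {}" and ch: "subset.chain S \<Z>"
    have inS: "Z \<in> S" if "Z \<in> \<Z>" for Z using ch that by (auto simp: subset.chain_def)
    have cmp: "Z \<subseteq> D \<or> D \<subseteq> Z" if "Z \<in> \<Z>" "D \<in> \<Z>" for Z D
      using ch that by (auto simp: subset.chain_def)
    have sub: "subspace K Z V" if "Z \<in> \<Z>" for Z using inS[OF that] by (simp add: S_def)
    have "subspace K (\<Union>\<Z>) V"
    proof (rule subspaceI)
      show "\<Union>\<Z> \<subseteq> carrier V" using subspaceD(1)[OF sub] by blast
      show "\<zero>\<^bsub>V\<^esub> \<in> \<Union>\<Z>" using subspaceD(2)[OF sub] ne by blast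
      show "x \<oplus>\<^bsub>V\<^esub> y \<in> \<Union>\<Z>" if "x \<in> \<Union>\<Z>" "y \<in> \<Union>\<Z>" for x y
      proof -
        from that obtain Z D where CD: "Z \<in> \<Z>" "D \<in> \<Z>" "x \<in> Z" "y \<in> D" by auto
        then have "(x \<in> D \<and> y \<in> D) \<or> (x \<in> Z \<and> y \<in> Z)" using cmp by blast
        then show ?thesis using CD subspaceD(3)[OF sub[OF CD(1)]] subspaceD(3)[OF sub[OF CD(2)]] by blast
      qed
      show "c \<odot>\<^bsub>V\<^esub> x \<in> \<Union>\<Z>" if "c \<in> carrier K" "x \<in> \<Union>\<Z>" for c x
        using that subspaceD(4)[OF sub] by blast
    qed (rule V.vectorspace_axioms)
    moreover have "A \<subseteq> \<Union>\<Z>" "\<Union>\<Z> \<subseteq> M" "\<Union>\<Z> \<inter> N = {\<zero>\<^bsub>V\<^esub>}"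
      using inS ne by (fastforce simp: S_def)+
    ultimately show "\<Union>\<Z> \<in> S" by (simp add: S_def)
  qed
  then obtain Z where CS: "Z \<in> S" and max: "\<And>Y. Y \<in> S \<Longrightarrow> Z \<subseteq> Y \<Longrightarrow> Y = Z" by auto
  have Z: "subspace K Z V" "A \<subseteq> Z" "Z \<subseteq> M" "Z \<inter> N = {\<zero>\<^bsub>V\<^esub>}" using CS by (auto simp: S_def)
  have "M \<subseteq> Z <+>\<^bsub>V\<^esub> N"
  proof
    fix x assume xM: "x \<in> M"
    note Cd = subspaceD[OF Z(1)] and Nd = subspaceD[OF N] and Md = subspaceD[OF M]
    have x: "x \<in> carrier V" using xM Md by auto
    show "x \<in> Z <+>\<^bsub>V\<^esub> N"
    proof (rule ccontr)
      assume nx: "x \<notin> Z <+>\<^bsub>V\<^esub> N"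
      define L where "L = {c \<odot>\<^bsub>V\<^esub> x | c. c \<in> carrier K}"
      have L: "subspace K L V"
      proof (rule subspaceI)
        show "\<zero>\<^bsub>V\<^esub> \<in> L" unfolding L_def using x V.lmult_0[OF x] by (metis (mono_tags, lifting) V.R.zero_closed mem_Collect_eq)
        show "y \<oplus>\<^bsub>V\<^esub> z \<in> L" if "y \<in> L" "z \<in> L" for y z
          using that x unfolding L_def by (auto simp flip: V.smult_l_distr)
        show "c \<odot>\<^bsub>V\<^esub> y \<in> L" if "c \<in> carrier K" "y \<in> L" for c y
          using that x unfolding L_def by (auto simp flip: V.smult_assoc1)
      qed (use x in \<open>auto simp: L_def intro: V.vectorspace_axioms\<close>)
      have xL: "x \<in> L" unfolding L_def using x V.smult_one[OF x] by (metis (mono_tags, lifting) V.R.one_closed mem_Collect_eq)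
      have "Z <+>\<^bsub>V\<^esub> L \<in> S"
      proof -
        have "Z <+>\<^bsub>V\<^esub> L \<subseteq> M"
        proof
          fix y assume "y \<in> Z <+>\<^bsub>V\<^esub> L"
          then obtain c l where "c \<in> Z" "l \<in> L" "y = c \<oplus>\<^bsub>V\<^esub> l" by (auto simp: set_add_def')
          then show "y \<in> M" using Z(3) Md(3,4) xM by (auto simp: L_def)
        qed
        moreover have "A \<subseteq> Z <+>\<^bsub>V\<^esub> L" using Z(2) set_add_upper[OF Z(1) L] by auto
        moreover have "(Z <+>\<^bsub>V\<^esub> L) \<inter> N = {\<zero>\<^bsub>V\<^esub>}"
        proof -
          have "y = \<zero>\<^bsub>V\<^esub>" if y: "y \<in> Z <+>\<^bsub>V\<^esub> L" "y \<in> N" for y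
          proof -
            from y obtain c k where ck: "c \<in> Z" "k \<in> carrier K" "y = c \<oplus>\<^bsub>V\<^esub> k \<odot>\<^bsub>V\<^esub> x" by (auto simp: set_add_def' L_def)
            have cV: "c \<in> carrier V" "y \<in> carrier V" using ck Cd y Nd by auto
            show ?thesis
            proof (cases "k = \<zero>\<^bsub>K\<^esub>")
              case True
              then have "y = c" using ck x cV by auto
              then show ?thesis using Z(4) ck y by auto
            next
              case False
              then have ik: "inv\<^bsub>K\<^esub> k \<in> carrier K" "inv\<^bsub>K\<^esub> k \<otimes>\<^bsub>K\<^esub> k = \<one>\<^bsub>K\<^esub>"
                using ck(2) V.field.field_Units V.R.Units_l_inv by auto
              have "k \<odot>\<^bsub>V\<^esub> x = \<ominus>\<^bsub>V\<^esub> c \<oplus>\<^bsub>V\<^esub> y" 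
                unfolding ck(3) using cV ck(2) x by (simp add: V.r_neg1)
              then have "x = inv\<^bsub>K\<^esub> k \<odot>\<^bsub>V\<^esub> (\<ominus>\<^bsub>V\<^esub> c \<oplus>\<^bsub>V\<^esub> y)"
                using V.smult_assoc1[of "inv\<^bsub>K\<^esub> k" k x] ik ck(2) x by simp
              also have "\<dots> = inv\<^bsub>K\<^esub> k \<odot>\<^bsub>V\<^esub> (\<ominus>\<^bsub>V\<^esub> c) \<oplus>\<^bsub>V\<^esub> inv\<^bsub>K\<^esub> k \<odot>\<^bsub>V\<^esub> y"
                using cV ik by (simp add: V.smult_r_distr)
              finally have "x \<in> Z <+>\<^bsub>V\<^esub> N"
                using Cd(4,5) Nd(4) ck y ik by (metis set_addI)
              with nx show ?thesis by simp
            qed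
          qed
          moreover have "\<zero>\<^bsub>V\<^esub> \<in> Z <+>\<^bsub>V\<^esub> L" "\<zero>\<^bsub>V\<^esub> \<in> N" using subspaceD(2)[OF subspace_sum[OF Z(1) L]] Nd(2) by blast+
          ultimately show ?thesis by blast
        qed
        ultimately show ?thesis using subspace_sum[OF Z(1) L] by (simp add: S_def)
      qed
      then have "Z <+>\<^bsub>V\<^esub> L = Z" using max set_add_upper[OF Z(1) L] by blast
      then have "x \<in> Z" using xL set_add_upper[OF Z(1) L] by blast
      then show False using nx set_add_upper[OF Z(1) N] by blast
    qed
  qed
  with Z that show ?thesis by blast
qed

text \<open>
  One complement of \<open>N\<close> can serve all members of a finite chain at once: build it from the bottom of the
  chain upwards, extending at each member what has been found for the smaller ones.
\<close>

lemma chain_complement_exists: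
  assumes N: "subspace K N V"
    and "finite \<F>" and "\<And>F. F \<in> \<F> \<Longrightarrow> subspace K F V"
    and "\<And>F G. F \<in> \<F> \<Longrightarrow> G \<in> \<F> \<Longrightarrow> F \<subseteq> G \<or> G \<subseteq> F"
  obtains A where "subspace K A V" "A \<inter> N = {\<zero>\<^bsub>V\<^esub>}" "A \<subseteq> insert \<zero>\<^bsub>V\<^esub> (\<Union>\<F>)"
    "\<And>F. F \<in> \<F> \<Longrightarrow> F \<subseteq> (F \<inter> A) <+>\<^bsub>V\<^esub> (F \<inter> N)"
proof -
  interpret V: vectorspace K V by (rule subspaceD(7)[OF N])
  have "\<exists>A. subspace K A V \<and> A \<inter> N = {\<zero>\<^bsub>V\<^esub>} \<and> A \<subseteq> insert \<zero>\<^bsub>V\<^esub> (\<Union>\<F>)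
      \<and> (\<forall>F\<in>\<F>. F \<subseteq> (F \<inter> A) <+>\<^bsub>V\<^esub> (F \<inter> N))"
    using assms(2-4)
  proof (induction "card \<F>" arbitrary: \<F>)
    case 0
    then have "\<F> = {}" by simp
    moreover have "{\<zero>\<^bsub>V\<^esub>} \<inter> N = {\<zero>\<^bsub>V\<^esub>}" using subspaceD(2)[OF N] by auto
    ultimately show ?case
      using subspace_zero[OF V.vectorspace_axioms] by (intro exI[of _ "{\<zero>\<^bsub>V\<^esub>}"]) auto
  next
    case (Suc n)
    then have "\<F> \<noteq> {}" by auto
    then obtain M where M: "M \<in> \<F>" "\<And>F. F \<in> \<F> \<Longrightarrow> M \<subseteq> F \<Longrightarrow> M = F"
      using finite_has_maximal[OF Suc.prems(1)] by blast
    then have top: "F \<subseteq> M" if "F \<in> \<F>" for F using Suc.prems(3)[OF that M(1)] that by blast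
    have "n = card (\<F> - {M})" using Suc.hyps(2) Suc.prems(1) M(1) by simp
    from Suc.hyps(1)[OF this] Suc.prems obtain A where A: "subspace K A V" "A \<inter> N = {\<zero>\<^bsub>V\<^esub>}"
      "A \<subseteq> insert \<zero>\<^bsub>V\<^esub> (\<Union>(\<F> - {M}))" "\<And>F. F \<in> \<F> - {M} \<Longrightarrow> F \<subseteq> (F \<inter> A) <+>\<^bsub>V\<^esub> (F \<inter> N)"
      by (metis (no_types, lifting) Diff_iff finite_Diff)
    have Ms: "subspace K M V" using Suc.prems(2) M(1) by simp
    have AM: "A \<subseteq> M" using A(3) top subspaceD(2)[OF Ms] by blast
    have MN: "subspace K (M \<inter> N) V" by (rule subspace_Int[OF Ms N])
    have "A \<inter> (M \<inter> N) = {\<zero>\<^bsub>V\<^esub>}" using A(2) AM by blast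
    from complement_exists[OF A(1) MN Ms AM this] obtain Z where Z: "subspace K Z V" "A \<subseteq> Z" "Z \<subseteq> M"
      "Z \<inter> (M \<inter> N) = {\<zero>\<^bsub>V\<^esub>}" "M \<subseteq> Z <+>\<^bsub>V\<^esub> (M \<inter> N)" by blast
    have "Z \<inter> N = {\<zero>\<^bsub>V\<^esub>}" using Z(3,4) by blast
    moreover have "F \<subseteq> (F \<inter> Z) <+>\<^bsub>V\<^esub> (F \<inter> N)" if "F \<in> \<F>" for F
    proof (cases "F = M")
      case True
      moreover have "F \<inter> Z = Z" using True Z(3) by blast
      ultimately show ?thesis using Z(5) by simp
    next
      case False
      show ?thesis
      proof
        fix x assume "x \<in> F"
        then have "x \<in> (F \<inter> A) <+>\<^bsub>V\<^esub> (F \<inter> N)" using A(4) False that by blast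
        then obtain a b where "a \<in> F \<inter> A" "b \<in> F \<inter> N" "x = a \<oplus>\<^bsub>V\<^esub> b" by (rule set_addE)
        then show "x \<in> (F \<inter> Z) <+>\<^bsub>V\<^esub> (F \<inter> N)" using Z(2) set_addI[of a "F \<inter> Z" b "F \<inter> N" V] by blast
      qed
    qed
    moreover have "Z \<subseteq> insert \<zero>\<^bsub>V\<^esub> (\<Union>\<F>)" using Z(3) M(1) by blast
    ultimately show ?case using Z(1) by blast
  qed
  then show ?thesis by (elim exE conjE) (rule that, auto)
qed

lemma complement_decomposition_unique:
  assumes "subspace K A V" "subspace K B V" "A \<inter> B = {\<zero>\<^bsub>V\<^esub>}"
    and "a \<in> A" "a' \<in> A" "b \<in> B" "b' \<in> B" "a \<oplus>\<^bsub>V\<^esub> b = a' \<oplus>\<^bsub>V\<^esub> b'"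
  shows "a = a'" "b = b'"
proof -
  interpret V: vectorspace K V by (rule subspaceD(7)[OF assms(1)])
  have c: "a \<in> carrier V" "a' \<in> carrier V" "b \<in> carrier V" "b' \<in> carrier V"
    using assms subspaceD(1)[OF assms(1)] subspaceD(1)[OF assms(2)] by auto
  have "\<ominus>\<^bsub>V\<^esub> a' \<oplus>\<^bsub>V\<^esub> ((a \<oplus>\<^bsub>V\<^esub> b) \<oplus>\<^bsub>V\<^esub> \<ominus>\<^bsub>V\<^esub> b) = b' \<ominus>\<^bsub>V\<^esub> b"
    unfolding assms(8) using c by (simp add: a_minus_def V.M.a_assoc V.M.r_neg1)
  moreover have "\<ominus>\<^bsub>V\<^esub> a' \<oplus>\<^bsub>V\<^esub> ((a \<oplus>\<^bsub>V\<^esub> b) \<oplus>\<^bsub>V\<^esub> \<ominus>\<^bsub>V\<^esub> b) = a \<ominus>\<^bsub>V\<^esub> a'"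
    using c by (simp add: a_minus_def V.M.a_assoc V.M.r_neg V.M.a_comm[of "\<ominus>\<^bsub>V\<^esub> a'" a])
  ultimately have "a \<ominus>\<^bsub>V\<^esub> a' = b' \<ominus>\<^bsub>V\<^esub> b" by simp
  moreover have "a \<ominus>\<^bsub>V\<^esub> a' \<in> A" "b' \<ominus>\<^bsub>V\<^esub> b \<in> B" using subspaceD(6)[OF assms(1)] subspaceD(6)[OF assms(2)] assms(4-7) by simp_all
  ultimately have "a \<ominus>\<^bsub>V\<^esub> a' = \<zero>\<^bsub>V\<^esub>" using assms(3) by auto
  then have "a \<oplus>\<^bsub>V\<^esub> \<ominus>\<^bsub>V\<^esub> a' = a' \<oplus>\<^bsub>V\<^esub> \<ominus>\<^bsub>V\<^esub> a'" using c by (simp add: a_minus_def V.M.r_neg)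
  then show "a = a'" using c by (simp add: V.M.add.right_cancel)
  then show "b = b'" using assms(8) c by simp
qed

lemma projection_exists:
  assumes "subspace K U V"
  obtains \<pi> where "linear_map K V V \<pi>" "\<And>x. x \<in> carrier V \<Longrightarrow> \<pi> x \<in> U" "\<And>x. x \<in> U \<Longrightarrow> \<pi> x = x"
    "\<pi> ` carrier V = U"
proof -
  interpret V: vectorspace K V by (rule subspaceD(7)[OF assms])
  note U = subspaceD[OF assms]
  obtain Z where Z: "subspace K Z V" "Z \<inter> U = {\<zero>\<^bsub>V\<^esub>}" "carrier V \<subseteq> Z <+>\<^bsub>V\<^esub> U"
    using complement_exists[OF subspace_zero assms subspace_carrier] V.vectorspace_axioms U(2)
    by (metis (no_types, lifting) Int_insert_left_if1 V.M.zero_closed empty_subsetI inf_bot_left insert_subset)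
  note Zd = subspaceD[OF Z(1)]
  have zc: "z \<in> Z \<Longrightarrow> z \<in> carrier V" and uc: "u \<in> U \<Longrightarrow> u \<in> carrier V" for z u using Zd(1) U(1) by auto
  define \<pi> where "\<pi> x = (THE u. u \<in> U \<and> (\<exists>z\<in>Z. x = z \<oplus>\<^bsub>V\<^esub> u))" for x
  have pi: "\<pi> (z \<oplus>\<^bsub>V\<^esub> u) = u" if "z \<in> Z" "u \<in> U" for z u
    unfolding \<pi>_def
  proof (rule the_equality)
    show "u \<in> U \<and> (\<exists>z'\<in>Z. z \<oplus>\<^bsub>V\<^esub> u = z' \<oplus>\<^bsub>V\<^esub> u)" using that by auto
    show "u' = u" if u': "u' \<in> U \<and> (\<exists>z'\<in>Z. z \<oplus>\<^bsub>V\<^esub> u = z' \<oplus>\<^bsub>V\<^esub> u')" for u'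
    proof -
      from u' obtain z' where "z' \<in> Z" "z \<oplus>\<^bsub>V\<^esub> u = z' \<oplus>\<^bsub>V\<^esub> u'" by auto
      then show ?thesis
        using complement_decomposition_unique(2)[OF Z(1) assms Z(2), of z z' u u'] u' \<open>z \<in> Z\<close> \<open>u \<in> U\<close> by auto
    qed
  qed
  have dec: "\<exists>z u. z \<in> Z \<and> u \<in> U \<and> x = z \<oplus>\<^bsub>V\<^esub> u" if "x \<in> carrier V" for x
    using Z(3) that by (auto elim!: set_addE)
  have "linear_map K V V \<pi>"
  proof (rule linear_mapI)
    show "\<pi> x \<in> carrier V" if "x \<in> carrier V" for x using dec[OF that] pi uc by auto
    show "\<pi> (x \<oplus>\<^bsub>V\<^esub> y) = \<pi> x \<oplus>\<^bsub>V\<^esub> \<pi> y" if "x \<in> carrier V" "y \<in> carrier V" for x y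
    proof -
      obtain z u where zu: "z \<in> Z" "u \<in> U" "x = z \<oplus>\<^bsub>V\<^esub> u" using dec[OF \<open>x \<in> carrier V\<close>] by blast
      obtain z' u' where zu': "z' \<in> Z" "u' \<in> U" "y = z' \<oplus>\<^bsub>V\<^esub> u'" using dec[OF \<open>y \<in> carrier V\<close>] by blast
      have "x \<oplus>\<^bsub>V\<^esub> y = (z \<oplus>\<^bsub>V\<^esub> z') \<oplus>\<^bsub>V\<^esub> (u \<oplus>\<^bsub>V\<^esub> u')" using zc uc zu zu' by (simp add: V.M.a_ac)
      then show ?thesis using pi[OF Zd(3) U(3)] pi zu zu' by simp
    qed
    show "\<pi> (c \<odot>\<^bsub>V\<^esub> x) = c \<odot>\<^bsub>V\<^esub> \<pi> x" if "c \<in> carrier K" "x \<in> carrier V" for c x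
    proof -
      obtain z u where *: "z \<in> Z" "u \<in> U" "x = z \<oplus>\<^bsub>V\<^esub> u" using dec[OF \<open>x \<in> carrier V\<close>] by blast
      then have "c \<odot>\<^bsub>V\<^esub> x = (c \<odot>\<^bsub>V\<^esub> z) \<oplus>\<^bsub>V\<^esub> (c \<odot>\<^bsub>V\<^esub> u)" using zc uc that by (simp add: V.smult_r_distr)
      then show ?thesis using pi[OF Zd(4)[OF that(1) *(1)] U(4)[OF that(1) *(2)]] pi * by simp
    qed
  qed (rule V.vectorspace_axioms)+
  moreover have mem: "\<pi> x \<in> U" if "x \<in> carrier V" for x using dec[OF that] pi by auto
  moreover have id: "\<pi> x = x" if "x \<in> U" for x using pi[OF Zd(2) that] uc[OF that] by simp
  moreover have "\<pi> ` carrier V = U" using mem id uc by force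
  ultimately show ?thesis using that by blast
qed

section \<open>Linear isomorphisms and coordinates\<close>

definition linear_iso where
  "linear_iso K V W f \<longleftrightarrow> linear_map K V W f \<and> bij_betw f (carrier V) (carrier W)"

lemma linear_isoI:
  assumes "vectorspace K V" "vectorspace K W"
    and "bij_betw f (carrier V) (carrier W)"
    and "\<And>x y. x \<in> carrier V \<Longrightarrow> y \<in> carrier V \<Longrightarrow> f (x \<oplus>\<^bsub>V\<^esub> y) = f x \<oplus>\<^bsub>W\<^esub> f y"
    and "\<And>c x. c \<in> carrier K \<Longrightarrow> x \<in> carrier V \<Longrightarrow> f (c \<odot>\<^bsub>V\<^esub> x) = c \<odot>\<^bsub>W\<^esub> f x"
  shows "linear_iso K V W f"
  unfolding linear_iso_def using assms bij_betwE[OF assms(3)]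
  by (auto intro!: linear_mapI)

text \<open>
  A bijection that respects the operations carries the vector space axioms over to its target. This is
  how tensor powers, which are quotients, become vector spaces below.
\<close>

lemma linear_iso_transport:
  assumes V: "vectorspace K V" and bij: "bij_betw f (carrier V) (carrier W)"
    and add: "\<And>x y. x \<in> carrier V \<Longrightarrow> y \<in> carrier V \<Longrightarrow> f (x \<oplus>\<^bsub>V\<^esub> y) = f x \<oplus>\<^bsub>W\<^esub> f y"
    and sm: "\<And>c x. c \<in> carrier K \<Longrightarrow> x \<in> carrier V \<Longrightarrow> f (c \<odot>\<^bsub>V\<^esub> x) = c \<odot>\<^bsub>W\<^esub> f x"
    and zero: "f \<zero>\<^bsub>V\<^esub> = \<zero>\<^bsub>W\<^esub>"
  shows "linear_iso K V W f"
proof (rule linear_isoI[OF V _ bij add sm])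
  interpret V: vectorspace K V by fact
  have ex: "\<exists>x\<in>carrier V. w = f x" if "w \<in> carrier W" for w
    using that bij_betw_imp_surj_on[OF bij] by blast
  have mem: "x \<in> carrier V \<Longrightarrow> f x \<in> carrier W" for x using bij bij_betwE by blast
  show "vectorspace K W"
  proof (rule vs_criteria)
    show "field K" ..
    show "\<zero>\<^bsub>W\<^esub> \<in> carrier W" using mem[of "\<zero>\<^bsub>V\<^esub>"] zero by simp
    show "\<forall>v w. v \<in> carrier W \<and> w \<in> carrier W \<longrightarrow> v \<oplus>\<^bsub>W\<^esub> w \<in> carrier W"
      using ex by (metis V.M.add.m_closed add mem)
    show "\<forall>v\<in>carrier W. \<exists>neg_v\<in>carrier W. v \<oplus>\<^bsub>W\<^esub> neg_v = \<zero>\<^bsub>W\<^esub>"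
      using ex by (metis V.M.a_inv_closed V.M.r_neg add mem zero)
    show "\<forall>c v. c \<in> carrier K \<and> v \<in> carrier W \<longrightarrow> c \<odot>\<^bsub>W\<^esub> v \<in> carrier W"
      using ex by (metis V.smult_closed sm mem)
    show "\<forall>v w. v \<in> carrier W \<and> w \<in> carrier W \<longrightarrow> v \<oplus>\<^bsub>W\<^esub> w = w \<oplus>\<^bsub>W\<^esub> v"
      using ex by (metis V.M.a_comm add)
    show "\<forall>v w x. v \<in> carrier W \<and> w \<in> carrier W \<and> x \<in> carrier W \<longrightarrow> v \<oplus>\<^bsub>W\<^esub> w \<oplus>\<^bsub>W\<^esub> x = v \<oplus>\<^bsub>W\<^esub> (w \<oplus>\<^bsub>W\<^esub> x)"
    proof (intro allI impI)
      fix v w x assume "v \<in> carrier W \<and> w \<in> carrier W \<and> x \<in> carrier W"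
      then obtain a b c where "a \<in> carrier V" "b \<in> carrier V" "c \<in> carrier V" "v = f a" "w = f b" "x = f c"
        using ex by metis
      then show "v \<oplus>\<^bsub>W\<^esub> w \<oplus>\<^bsub>W\<^esub> x = v \<oplus>\<^bsub>W\<^esub> (w \<oplus>\<^bsub>W\<^esub> x)"
        by (simp add: V.M.a_assoc flip: add)
    qed
    show "\<forall>v\<in>carrier W. v \<oplus>\<^bsub>W\<^esub> \<zero>\<^bsub>W\<^esub> = v"
      using ex by (metis V.M.r_zero V.M.zero_closed add zero)
    show "\<forall>a b v. a \<in> carrier K \<and> b \<in> carrier K \<and> v \<in> carrier W \<longrightarrow> (a \<otimes>\<^bsub>K\<^esub> b) \<odot>\<^bsub>W\<^esub> v = a \<odot>\<^bsub>W\<^esub> (b \<odot>\<^bsub>W\<^esub> v)"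
      using ex by (metis V.R.m_closed V.smult_assoc1 V.smult_closed sm)
    show "\<forall>v\<in>carrier W. \<one>\<^bsub>K\<^esub> \<odot>\<^bsub>W\<^esub> v = v"
      using ex by (metis V.R.one_closed V.smult_one sm)
    show "\<forall>a b v. a \<in> carrier K \<and> b \<in> carrier K \<and> v \<in> carrier W \<longrightarrow> (a \<oplus>\<^bsub>K\<^esub> b) \<odot>\<^bsub>W\<^esub> v = a \<odot>\<^bsub>W\<^esub> v \<oplus>\<^bsub>W\<^esub> b \<odot>\<^bsub>W\<^esub> v"
      using ex by (metis V.R.a_closed V.smult_l_distr V.smult_closed add sm)
    show "\<forall>a v w. a \<in> carrier K \<and> v \<in> carrier W \<and> w \<in> carrier W \<longrightarrow> a \<odot>\<^bsub>W\<^esub> (v \<oplus>\<^bsub>W\<^esub> w) = a \<odot>\<^bsub>W\<^esub> v \<oplus>\<^bsub>W\<^esub> a \<odot>\<^bsub>W\<^esub> w"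
    proof (intro allI impI)
      fix a v w assume *: "a \<in> carrier K \<and> v \<in> carrier W \<and> w \<in> carrier W"
      then obtain x y where "x \<in> carrier V" "y \<in> carrier V" "v = f x" "w = f y"
        using ex by metis
      then show "a \<odot>\<^bsub>W\<^esub> (v \<oplus>\<^bsub>W\<^esub> w) = a \<odot>\<^bsub>W\<^esub> v \<oplus>\<^bsub>W\<^esub> a \<odot>\<^bsub>W\<^esub> w"
        using * by (simp add: V.smult_r_distr flip: add sm)
    qed
  qed
qed

lemma linear_iso_inv:
  assumes "linear_iso K V W f"
  shows "linear_iso K W V (inv_into (carrier V) f)"
proof -
  have bij: "bij_betw f (carrier V) (carrier W)" and "linear_map K V W f" using assms by (auto simp: linear_iso_def)
  then interpret f: linear_map K V W f by simp
  let ?g = "inv_into (carrier V) f"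
  note gf = bij_betw_inv_into_left[OF bij] and fg = bij_betw_inv_into_right[OF bij]
  have g: "w \<in> carrier W \<Longrightarrow> ?g w \<in> carrier V" for w
    using bij_betw_inv_into[OF bij] bij_betwE by blast
  show ?thesis
  proof (rule linear_isoI)
    show "?g (x \<oplus>\<^bsub>W\<^esub> y) = ?g x \<oplus>\<^bsub>V\<^esub> ?g y" if "x \<in> carrier W" "y \<in> carrier W" for x y
      using gf[of "?g x \<oplus>\<^bsub>V\<^esub> ?g y"] g that fg by (simp add: f.f_add)
    show "?g (c \<odot>\<^bsub>W\<^esub> x) = c \<odot>\<^bsub>V\<^esub> ?g x" if "c \<in> carrier K" "x \<in> carrier W" for c x
      using gf[of "c \<odot>\<^bsub>V\<^esub> ?g x"] g that fg by simp
  qed (use bij_betw_inv_into[OF bij] f.V.vectorspace_axioms f.W.vectorspace_axioms in auto)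
qed

lemma linear_iso_comp:
  assumes "linear_iso K U V f" "linear_iso K V W g"
  shows "linear_iso K U W (\<lambda>x. g (f x))"
proof -
  interpret f: linear_map K U V f using assms by (simp add: linear_iso_def)
  interpret g: linear_map K V W g using assms by (simp add: linear_iso_def)
  have "bij_betw (\<lambda>x. g (f x)) (carrier U) (carrier W)"
    using assms bij_betw_trans[of f "carrier U" "carrier V" g "carrier W"] by (auto simp: linear_iso_def comp_def)
  then show ?thesis
    by (rule linear_isoI[rotated 2]) (auto intro: f.V.vectorspace_axioms g.W.vectorspace_axioms)
qed

lemma linear_iso_dim:
  assumes "linear_iso K V W f" "vectorspace.fin_dim K V"
  shows "vectorspace.dim K W = vectorspace.dim K V" "vectorspace.fin_dim K W"
proof -
  interpret f: linear_map K V W f using assms by (simp add: linear_iso_def)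
  have "inj_on f (carrier V)" "f ` carrier V = carrier W" using assms by (auto simp: linear_iso_def bij_betw_def)
  then show "vectorspace.dim K W = vectorspace.dim K V" "vectorspace.fin_dim K W"
    using f.dim_eq f.surj_fin_dim assms by auto
qed

lemma func_space_simps:
  assumes "field K"
  shows "carrier (ring.func_space K S) = (S \<rightarrow>\<^sub>E carrier K)"
    "f \<oplus>\<^bsub>ring.func_space K S\<^esub> g = (\<lambda>s\<in>S. f s \<oplus>\<^bsub>K\<^esub> g s)"
    "c \<odot>\<^bsub>ring.func_space K S\<^esub> f = (\<lambda>s\<in>S. c \<otimes>\<^bsub>K\<^esub> f s)"
    "\<zero>\<^bsub>ring.func_space K S\<^esub> = (\<lambda>s\<in>S. \<zero>\<^bsub>K\<^esub>)"
proof -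
  interpret field K by fact
  show "carrier (func_space S) = (S \<rightarrow>\<^sub>E carrier K)"
    "f \<oplus>\<^bsub>func_space S\<^esub> g = (\<lambda>s\<in>S. f s \<oplus>\<^bsub>K\<^esub> g s)"
    "c \<odot>\<^bsub>func_space S\<^esub> f = (\<lambda>s\<in>S. c \<otimes>\<^bsub>K\<^esub> f s)"
    "\<zero>\<^bsub>func_space S\<^esub> = (\<lambda>s\<in>S. \<zero>\<^bsub>K\<^esub>)"
    by (simp_all add: func_space_def)
qed

lemma func_space_vectorspace:
  assumes "field K"
  shows "vectorspace K (ring.func_space K S)"
proof -
  interpret field K by fact
  show ?thesis using func_space_is_module[of S] by (auto simp: vectorspace_def intro: field_axioms)
qed

lemma func_space_finsum:
  assumes "field K" "finite A" "\<And>x. x \<in> A \<Longrightarrow> g x \<in> S \<rightarrow>\<^sub>E carrier K" "t \<in> S"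
  shows "finsum (ring.func_space K S) g A t = (\<Oplus>\<^bsub>K\<^esub>x\<in>A. g x t)"
proof -
  interpret field K by fact
  interpret F: vectorspace K "func_space S" by (rule func_space_vectorspace) fact
  note fs = func_space_simps[OF assms(1)]
  show ?thesis using assms(2,3)
  proof (induction A)
    case empty
    then show ?case using assms(4) by (simp add: fs)
  next
    case (insert x A)
    have "g \<in> A \<rightarrow> carrier (func_space S)" "g x \<in> carrier (func_space S)" using insert by (auto simp: fs)
    then have "finsum (func_space S) g (insert x A) = g x \<oplus>\<^bsub>func_space S\<^esub> finsum (func_space S) g A"
      using insert.hyps by (simp add: F.M.finsum_insert)
    moreover have "(\<lambda>x. g x t) \<in> insert x A \<rightarrow> carrier K" using insert.prems assms(4) by auto
    ultimately show ?case using insert.IH insert.prems insert.hyps assms(4) by (simp add: fs)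
  qed
qed

definition unit_fun where
  "unit_fun K S s = (\<lambda>t\<in>S. if t = s then \<one>\<^bsub>K\<^esub> else \<zero>\<^bsub>K\<^esub>)"

lemma func_space_basis:
  assumes K: "field K" and S: "finite S"
  shows "vectorspace.basis K (ring.func_space K S) (unit_fun K S ` S)"
    "vectorspace.dim K (ring.func_space K S) = card S"
    "vectorspace.fin_dim K (ring.func_space K S)"
proof -
  interpret field K by fact
  interpret F: vectorspace K "func_space S" by (rule func_space_vectorspace) fact
  note fs = func_space_simps[OF K]
  let ?A = "unit_fun K S ` S"
  have inj: "inj_on (unit_fun K S) S"
  proof (rule inj_onI)
    fix s t assume "s \<in> S" "t \<in> S" "unit_fun K S s = unit_fun K S t"
    then have "unit_fun K S s s = unit_fun K S t s" by simp
    then show "s = t" using \<open>s \<in> S\<close> by (auto simp: unit_fun_def split: if_splits)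
  qed
  have sub: "?A \<subseteq> carrier (func_space S)" by (auto simp: fs unit_fun_def)
  have fin: "finite ?A" using S by simp
  have eval: "F.lincomb a ?A t = a (unit_fun K S t)" if a: "a \<in> ?A \<rightarrow> carrier K" and t: "t \<in> S" for a t
  proof -
    have aS: "a (unit_fun K S s) \<in> carrier K" if "s \<in> S" for s using a that by auto
    have uS: "unit_fun K S s \<in> S \<rightarrow>\<^sub>E carrier K" for s by (auto simp: unit_fun_def)
    have uv: "unit_fun K S s t = (if t = s then \<one>\<^bsub>K\<^esub> else \<zero>\<^bsub>K\<^esub>)" for s using t by (simp add: unit_fun_def)
    have "F.lincomb a ?A t = (\<Oplus>\<^bsub>K\<^esub>x\<in>?A. (a x \<odot>\<^bsub>func_space S\<^esub> x) t)"
      unfolding F.lincomb_def by (rule func_space_finsum[OF K fin _ t]) (use aS uS in \<open>auto simp: fs\<close>)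
    also have "\<dots> = (\<Oplus>\<^bsub>K\<^esub>s\<in>S. (a (unit_fun K S s) \<odot>\<^bsub>func_space S\<^esub> unit_fun K S s) t)"
      by (rule add.finprod_reindex[OF _ inj]) (use aS uS t in \<open>auto simp: fs uv PiE_mem\<close>)
    also have "\<dots> = (\<Oplus>\<^bsub>K\<^esub>s\<in>S. if t = s then a (unit_fun K S s) else \<zero>\<^bsub>K\<^esub>)"
      by (rule add.finprod_cong') (use aS uS t in \<open>auto simp: fs uv PiE_mem\<close>)
    also have "\<dots> = a (unit_fun K S t)"
      by (rule add.finprod_singleton[OF t S]) (use aS in auto)
    finally show ?thesis .
  qed
  have li: "F.lin_indpt ?A"
  proof (rule F.finite_lin_indpt2[OF fin sub])
    fix a assume a: "a \<in> ?A \<rightarrow> carrier K" and "F.lincomb a ?A = \<zero>\<^bsub>func_space S\<^esub>"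
    then have "a (unit_fun K S t) = \<zero>\<^bsub>K\<^esub>" if "t \<in> S" for t
      using eval[OF a that] that by (simp add: fs)
    then show "\<forall>v\<in>?A. a v = \<zero>\<^bsub>K\<^esub>" by auto
  qed
  have gen: "F.gen_set ?A"
  proof
    show "F.span ?A \<subseteq> carrier (func_space S)" by (rule F.span_is_subset2[OF sub])
    show "carrier (func_space S) \<subseteq> F.span ?A"
    proof
      fix v assume v: "v \<in> carrier (func_space S)"
      define a where "a x = v (the_inv_into S (unit_fun K S) x)" for x
      have a: "a (unit_fun K S s) = v s" if "s \<in> S" for s
        using the_inv_into_f_f[OF inj that] by (simp add: a_def)
      have aK: "a \<in> ?A \<rightarrow> carrier K" using v a by (auto simp: fs)
      have "F.lincomb a ?A \<in> carrier (func_space S)" using sub aK by auto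
      then have "F.lincomb a ?A = v"
        using eval[OF aK] a v by (intro PiE_ext[of _ S "\<lambda>_. carrier K"]) (auto simp: fs)
      then show "v \<in> F.span ?A" using F.finite_span[OF fin sub] aK by auto
    qed
  qed
  show b: "F.basis ?A" unfolding F.basis_def using li gen sub by simp
  show "F.dim = card S" using F.dim_basis[OF fin b] card_image[OF inj] by simp
  show "F.fin_dim" unfolding F.fin_dim_def using fin sub gen by blast
qed

text \<open>
  Linear combination of a basis is a bijection from coordinate vectors onto the space; its inverse is the
  coordinate map.
\<close>

lemma coordinates_exist:
  assumes "vectorspace K V" "vectorspace.fin_dim K V"
  obtains B :: "'v set" and \<phi> where "finite B" "linear_iso K (V :: ('k,'v,'m) module_scheme) (ring.func_space K B) \<phi>"
proof -
  interpret V: vectorspace K V by fact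
  obtain B where B: "finite B" "V.basis B" using V.finite_basis_exists assms(2) by auto
  then have BV: "B \<subseteq> carrier V" by (simp add: V.basis_def)
  let ?g = "\<lambda>a. V.lincomb a B"
  note fs = func_space_simps[OF V.field_axioms]
  interpret g: linear_map K "V.func_space B" V ?g by (rule V.lincomb_is_linear[OF B(1) BV])
  have *: "\<And>v. v \<in> carrier V \<Longrightarrow> \<exists>!a. a \<in> B \<rightarrow>\<^sub>E carrier K \<and> ?g a = v"
    using V.basis_criterion[OF B(1) BV] B(2) by blast
  have "bij_betw ?g (carrier (V.func_space B)) (carrier V)"
  proof (rule bij_betwI')
    show "?g x = ?g y \<longleftrightarrow> x = y" if "x \<in> carrier (V.func_space B)" "y \<in> carrier (V.func_space B)" for x y
      using *[OF g.f_im[OF that(1)]] that by (auto simp: fs)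
    show "\<exists>x\<in>carrier (V.func_space B). y = ?g x" if "y \<in> carrier V" for y
      using *[OF that] by (auto simp: fs)
  qed (use g.f_im in auto)
  then have "linear_iso K (V.func_space B) V ?g" by (simp add: linear_iso_def g.linear_map_axioms)
  from linear_iso_inv[OF this] B(1) that show ?thesis by blast
qed

lemma linear_map_conj:
  assumes f: "linear_map K V W f" and \<phi>: "linear_iso K V V' \<phi>" and \<psi>: "linear_iso K W W' \<psi>"
    and comm: "\<And>x. x \<in> carrier V \<Longrightarrow> f' (\<phi> x) = \<psi> (f x)"
  shows "linear_map K V' W' f'"
proof (rule linear_mapI)
  have lp: "linear_map K V V' \<phi>" and lq: "linear_map K W W' \<psi>" using \<phi> \<psi> by (auto simp: linear_iso_def)
  note f' = linear_mapD[OF f] and p = linear_mapD[OF lp] and q = linear_mapD[OF lq]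
  show "vectorspace K V'" "vectorspace K W'" by (rule p q)+
  interpret V: vectorspace K V by (rule f')
  have ex: "\<exists>x\<in>carrier V. y = \<phi> x" if "y \<in> carrier V'" for y
    using that \<phi> by (auto simp: linear_iso_def bij_betw_def)
  show "f' y \<in> carrier W'" if "y \<in> carrier V'" for y
    using ex[OF that] comm f'(1) q(1) by auto
  show "f' (y \<oplus>\<^bsub>V'\<^esub> z) = f' y \<oplus>\<^bsub>W'\<^esub> f' z" if y: "y \<in> carrier V'" and z: "z \<in> carrier V'" for y z
  proof -
    obtain a b where ab: "a \<in> carrier V" "y = \<phi> a" "b \<in> carrier V" "z = \<phi> b" using ex[OF y] ex[OF z] by blast
    then have "y \<oplus>\<^bsub>V'\<^esub> z = \<phi> (a \<oplus>\<^bsub>V\<^esub> b)" by (simp add: p(2))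
    then show ?thesis using ab comm by (simp add: f' q)
  qed
  show "f' (c \<odot>\<^bsub>V'\<^esub> y) = c \<odot>\<^bsub>W'\<^esub> f' y" if c: "c \<in> carrier K" and y: "y \<in> carrier V'" for c y
  proof -
    obtain a where a: "a \<in> carrier V" "y = \<phi> a" using ex[OF y] by blast
    then have "c \<odot>\<^bsub>V'\<^esub> y = \<phi> (c \<odot>\<^bsub>V\<^esub> a)" using c by (simp add: p(3))
    then show ?thesis using a c comm by (simp add: f' q)
  qed
qed

lemma linear_map_comp:
  assumes "linear_map K U V f" "linear_map K V W g"
  shows "linear_map K U W (\<lambda>x. g (f x))"
  using linear_mapD[OF assms(1)] linear_mapD[OF assms(2)] by (intro linear_mapI) auto

section \<open>Rank of a linear map\<close>

definition rank where
  "rank K V W f = vectorspace.dim K (W\<lparr>carrier := f ` carrier V\<rparr>)"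

lemma linear_map_onto_image:
  assumes "linear_map K V W f"
  shows "linear_map K V (W\<lparr>carrier := f ` carrier V\<rparr>) f"
proof -
  interpret f: linear_map K V W f by fact
  have "subspace K (f ` carrier V) W"
    by (rule subspace_image[OF assms subspace_carrier]) (rule f.V.vectorspace_axioms)
  from subspaceD(8)[OF this] show ?thesis
    by (intro linear_mapI) (auto intro: f.V.vectorspace_axioms)
qed

lemma linear_iso_image:
  assumes f: "linear_map K V W f" and f': "linear_map K V' W' f'"
    and \<phi>: "linear_iso K V V' \<phi>" and \<psi>: "linear_iso K W W' \<psi>"
    and comm: "\<And>x. x \<in> carrier V \<Longrightarrow> \<psi> (f x) = f' (\<phi> x)"
  shows "linear_iso K (W\<lparr>carrier := f ` carrier V\<rparr>) (W'\<lparr>carrier := f' ` carrier V'\<rparr>) \<psi>"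
proof -
  interpret f: linear_map K V W f by fact
  interpret f': linear_map K V' W' f' by fact
  interpret \<psi>: linear_map K W W' \<psi> using \<psi> by (simp add: linear_iso_def)
  have "\<psi> ` f ` carrier V = f' ` \<phi> ` carrier V" unfolding image_image using comm by (rule image_cong[OF refl])
  also have "\<phi> ` carrier V = carrier V'" using \<phi> by (auto simp: linear_iso_def bij_betw_def)
  finally have im: "\<psi> ` f ` carrier V = f' ` carrier V'" .
  have "inj_on \<psi> (carrier W)" using \<psi> by (auto simp: linear_iso_def bij_betw_def)
  then have "inj_on \<psi> (f ` carrier V)" by (rule inj_on_subset) auto
  then show ?thesis
    using linear_map_onto_image[OF f] linear_map_onto_image[OF f'] im
    by (intro linear_isoI) (auto simp: bij_betw_def linear_map_def)
qed

text \<open>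
  The isomorphism of the targets restricts to an isomorphism of the images.
\<close>

lemma rank_iso:
  assumes "linear_map K V W f" "linear_map K V' W' f'"
    and "linear_iso K V V' \<phi>" "linear_iso K W W' \<psi>"
    and "\<And>x. x \<in> carrier V \<Longrightarrow> \<psi> (f x) = f' (\<phi> x)"
    and fd: "vectorspace.fin_dim K V"
  shows "rank K V' W' f' = rank K V W f"
proof -
  interpret f: linear_map K V "W\<lparr>carrier := f ` carrier V\<rparr>" f by (rule linear_map_onto_image) fact
  have "vectorspace.fin_dim K (W\<lparr>carrier := f ` carrier V\<rparr>)"
    by (rule f.surj_fin_dim[OF fd]) simp
  from linear_iso_dim(1)[OF linear_iso_image[OF assms(1-5)] this] show ?thesis by (simp add: rank_def)
qed

lemma rank_inj:
  assumes "linear_map K V W f" "inj_on f (carrier V)" "vectorspace.fin_dim K V"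
  shows "rank K V W f = vectorspace.dim K V"
proof -
  interpret f: linear_map K V "W\<lparr>carrier := f ` carrier V\<rparr>" f by (rule linear_map_onto_image) fact
  show ?thesis using f.dim_eq[OF assms(3,2)] by (simp add: rank_def)
qed

lemma rank_surj: "f ` carrier V = carrier W \<Longrightarrow> rank K V W f = vectorspace.dim K W"
  by (simp add: rank_def)

lemma dim_zero_space:
  assumes "vectorspace K V" "carrier V = {\<zero>\<^bsub>V\<^esub>}"
  shows "vectorspace.dim K V = 0"
proof -
  interpret V: vectorspace K V by fact
  have "V.gen_set {\<zero>\<^bsub>V\<^esub>}" using V.span_is_subset2[of "{\<zero>\<^bsub>V\<^esub>}"] V.in_own_span[of "{\<zero>\<^bsub>V\<^esub>}"] assms(2) by auto
  then show ?thesis by (rule V.dim0I)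
qed

lemma rank_zero:
  assumes "linear_map K V W f" "\<And>x. x \<in> carrier V \<Longrightarrow> f x = \<zero>\<^bsub>W\<^esub>"
  shows "rank K V W f = 0"
proof -
  interpret f: linear_map K V W f by fact
  interpret g: linear_map K V "W\<lparr>carrier := f ` carrier V\<rparr>" f by (rule linear_map_onto_image) fact
  have "f ` carrier V = {\<zero>\<^bsub>W\<^esub>}" using assms(2) subspaceD(2)[OF subspace_carrier[OF f.V.vectorspace_axioms]] by (metis image_cong image_constant)
  then show ?thesis unfolding rank_def by (intro dim_zero_space) (use g.W.vectorspace_axioms in auto)
qed

lemma rank_le_dim:
  assumes f: "linear_map K V W f" and fd: "vectorspace.fin_dim K V"
  shows "rank K V W f \<le> vectorspace.dim K V"
proof -
  interpret f: linear_map K V W f by (rule f)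
  show ?thesis using f.rank_nullity[OF fd] by (simp add: rank_def f.im_def)
qed

lemma rank_le_codim:
  assumes f: "linear_map K V W f" and fd: "vectorspace.fin_dim K W"
  shows "rank K V W f \<le> vectorspace.dim K W"
proof -
  have J: "subspace K (f ` carrier V) W" by (rule subspace_image[OF f subspace_carrier[OF linear_mapD(5)[OF f]]])
  obtain p where p: "linear_map K W W p" "\<And>x. x \<in> carrier W \<Longrightarrow> p x \<in> f ` carrier V"
      "\<And>x. x \<in> f ` carrier V \<Longrightarrow> p x = x" "p ` carrier W = f ` carrier V"
    using projection_exists[OF J] by metis
  show ?thesis using rank_le_dim[OF p(1) fd] p(4) by (simp add: rank_def)
qed

lemma func_space_restrict_map:
  assumes K: "field K" and TST: "T1 \<subseteq> S \<inter> T"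
  shows "linear_map K (ring.func_space K S) (ring.func_space K T) (\<lambda>c. \<lambda>t\<in>T. if t \<in> T1 then c t else \<zero>\<^bsub>K\<^esub>)"
proof -
  interpret field K by fact
  note fs = func_space_simps[OF K]
  show ?thesis
  proof (rule linear_mapI[OF func_space_vectorspace[OF K] func_space_vectorspace[OF K]])
    fix x y assume x: "x \<in> carrier (func_space S)"
    then have xc: "\<And>s. s \<in> S \<Longrightarrow> x s \<in> carrier K" by (auto simp: fs)
    show "(\<lambda>t\<in>T. if t \<in> T1 then x t else \<zero>\<^bsub>K\<^esub>) \<in> carrier (func_space T)"
      using xc TST by (auto simp: fs)
    show "(\<lambda>t\<in>T. if t \<in> T1 then (x \<oplus>\<^bsub>func_space S\<^esub> y) t else \<zero>\<^bsub>K\<^esub>) =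
      (\<lambda>t\<in>T. if t \<in> T1 then x t else \<zero>\<^bsub>K\<^esub>) \<oplus>\<^bsub>func_space T\<^esub> (\<lambda>t\<in>T. if t \<in> T1 then y t else \<zero>\<^bsub>K\<^esub>)"
      using TST by (auto simp: fs intro!: restrict_ext)
  next
    fix c x assume "c \<in> carrier K" "x \<in> carrier (func_space S)"
    then show "(\<lambda>t\<in>T. if t \<in> T1 then (c \<odot>\<^bsub>func_space S\<^esub> x) t else \<zero>\<^bsub>K\<^esub>) =
      c \<odot>\<^bsub>func_space T\<^esub> (\<lambda>t\<in>T. if t \<in> T1 then x t else \<zero>\<^bsub>K\<^esub>)"
      using TST by (auto simp: fs intro!: restrict_ext)
  qed
qed

lemma rank_func_space_restrict:
  assumes K: "field K" and T: "finite T" and TST: "T1 \<subseteq> S \<inter> T"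
  shows "rank K (ring.func_space K S) (ring.func_space K T) (\<lambda>c. \<lambda>t\<in>T. if t \<in> T1 then c t else \<zero>\<^bsub>K\<^esub>) = card T1"
proof -
  interpret field K by fact
  note fs = func_space_simps[OF K]
  let ?f = "\<lambda>c. \<lambda>t\<in>T. if t \<in> T1 then c t else \<zero>\<^bsub>K\<^esub>"
  have T1: "finite T1" using T TST finite_subset by blast
  have lin: "linear_map K (func_space T1) (func_space T) ?f"
    by (rule func_space_restrict_map[OF K]) (use TST in auto)
  have inj: "inj_on ?f (carrier (func_space T1))"
  proof (rule inj_onI)
    fix x y assume xy: "x \<in> carrier (func_space T1)" "y \<in> carrier (func_space T1)" and eq: "?f x = ?f y"
    show "x = y"
    proof (rule PiE_ext[of _ T1 "\<lambda>_. carrier K"])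
      fix t assume t: "t \<in> T1"
      have "?f x t = ?f y t" using eq by simp
      then show "x t = y t" using t TST by (simp split: if_splits) auto
    qed (use xy in \<open>auto simp: fs\<close>)
  qed
  have im: "?f ` carrier (func_space T1) = ?f ` carrier (func_space S)"
  proof (intro equalityI subsetI)
    fix y assume "y \<in> ?f ` carrier (func_space T1)"
    then obtain x where x: "x \<in> T1 \<rightarrow>\<^sub>E carrier K" "y = ?f x" by (auto simp: fs)
    have "(\<lambda>s\<in>S. if s \<in> T1 then x s else \<zero>\<^bsub>K\<^esub>) \<in> carrier (func_space S)" using x TST by (auto simp: fs)
    moreover have "y = ?f (\<lambda>s\<in>S. if s \<in> T1 then x s else \<zero>\<^bsub>K\<^esub>)" using x TST by (auto intro!: restrict_ext)
    ultimately show "y \<in> ?f ` carrier (func_space S)" by blast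
  next
    fix y assume "y \<in> ?f ` carrier (func_space S)"
    then obtain x where x: "x \<in> S \<rightarrow>\<^sub>E carrier K" "y = ?f x" by (auto simp: fs)
    have "restrict x T1 \<in> carrier (func_space T1)" using x TST by (auto simp: fs)
    moreover have "y = ?f (restrict x T1)" using x TST by (auto intro!: restrict_ext)
    ultimately show "y \<in> ?f ` carrier (func_space T1)" by blast
  qed
  have "rank K (func_space T1) (func_space T) ?f = card T1"
    using rank_inj[OF lin inj] func_space_basis[OF K T1] by simp
  then show ?thesis by (simp add: rank_def im)
qed

lemma subspace_fin_dim:
  assumes "subspace K U V" "vectorspace.fin_dim K V"
  shows "vectorspace.fin_dim K (V\<lparr>carrier := U\<rparr>)"
proof -
  obtain p where p: "linear_map K V V p" "\<And>x. x \<in> carrier V \<Longrightarrow> p x \<in> U" "\<And>x. x \<in> U \<Longrightarrow> p x = x"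
      "p ` carrier V = U"
    using projection_exists[OF assms(1)] by metis
  show ?thesis
    using linear_map.surj_fin_dim[OF linear_map_onto_image[OF p(1)] assms(2)] p(4) by simp
qed

lemma linear_iso_func_space_Plus:
  assumes p: "linear_map K V A p" and q: "linear_map K V B q"
    and bij: "bij_betw (\<lambda>x. (p x, q x)) (carrier V) (carrier A \<times> carrier B)"
    and \<alpha>: "linear_iso K A (ring.func_space K S) \<alpha>" and \<beta>: "linear_iso K B (ring.func_space K T) \<beta>"
  shows "linear_iso K V (ring.func_space K (S <+> T))
    (\<lambda>x. \<lambda>s\<in>S <+> T. case s of Inl a \<Rightarrow> \<alpha> (p x) a | Inr b \<Rightarrow> \<beta> (q x) b)" (is "linear_iso _ _ _ ?\<phi>")
proof -
  interpret p: linear_map K V A p by fact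
  interpret q: linear_map K V B q by fact
  interpret \<alpha>: linear_map K A "ring.func_space K S" \<alpha> using \<alpha> by (simp add: linear_iso_def)
  interpret \<beta>: linear_map K B "ring.func_space K T" \<beta> using \<beta> by (simp add: linear_iso_def)
  have V: "vectorspace K V" and K: "field K" using p.V.vectorspace_axioms by (auto simp: vectorspace_def)
  note fs = func_space_simps[OF K]
  have b\<alpha>: "bij_betw \<alpha> (carrier A) (S \<rightarrow>\<^sub>E carrier K)" and b\<beta>: "bij_betw \<beta> (carrier B) (T \<rightarrow>\<^sub>E carrier K)"
    using \<alpha> \<beta> by (auto simp: linear_iso_def fs)
  have m\<alpha>: "\<alpha> (p x) \<in> S \<rightarrow>\<^sub>E carrier K" and m\<beta>: "\<beta> (q x) \<in> T \<rightarrow>\<^sub>E carrier K" if "x \<in> carrier V" for x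
    using that \<alpha>.f_im[of "p x"] \<beta>.f_im[of "q x"] by (auto simp: fs)
  have m\<phi>: "?\<phi> x \<in> (S <+> T) \<rightarrow>\<^sub>E carrier K" if "x \<in> carrier V" for x
    unfolding restrict_PiE_iff using PiE_mem[OF m\<alpha>[OF that]] PiE_mem[OF m\<beta>[OF that]] by auto
  show ?thesis
  proof (rule linear_isoI[OF V func_space_vectorspace[OF K]])
    show "bij_betw ?\<phi> (carrier V) (carrier (ring.func_space K (S <+> T)))"
    proof (rule bij_betwI')
      fix x y assume x: "x \<in> carrier V" and y: "y \<in> carrier V"
      show "?\<phi> x = ?\<phi> y \<longleftrightarrow> x = y"
      proof
        assume eq: "?\<phi> x = ?\<phi> y"
        have "\<alpha> (p x) = \<alpha> (p y)"
        proof (rule PiE_ext[OF m\<alpha>[OF x] m\<alpha>[OF y]])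
          fix a assume "a \<in> S"
          then show "\<alpha> (p x) a = \<alpha> (p y) a" using fun_cong[OF eq, of "Inl a"] by (simp add: InlI)
        qed
        moreover have "\<beta> (q x) = \<beta> (q y)"
        proof (rule PiE_ext[OF m\<beta>[OF x] m\<beta>[OF y]])
          fix a assume "a \<in> T"
          then show "\<beta> (q x) a = \<beta> (q y) a" using fun_cong[OF eq, of "Inr a"] by (simp add: InrI)
        qed
        ultimately have "p x = p y" "q x = q y"
          using b\<alpha> b\<beta> x y by (auto simp: bij_betw_def dest: inj_onD)
        then show "x = y" using bij x y by (auto simp: bij_betw_def dest!: inj_onD)
      next
        assume "x = y"
        then show "?\<phi> x = ?\<phi> y" by (simp only:)
      qed
    next
      fix x assume "x \<in> carrier V"
      then show "?\<phi> x \<in> carrier (ring.func_space K (S <+> T))"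
        using m\<phi> by (simp only: fs)
    next
      fix c assume "c \<in> carrier (ring.func_space K (S <+> T))"
      then have c: "c \<in> (S <+> T) \<rightarrow>\<^sub>E carrier K" by (simp add: fs)
      then have "(\<lambda>a\<in>S. c (Inl a)) \<in> S \<rightarrow>\<^sub>E carrier K" "(\<lambda>b\<in>T. c (Inr b)) \<in> T \<rightarrow>\<^sub>E carrier K" by auto
      then have "(\<lambda>a\<in>S. c (Inl a)) \<in> \<alpha> ` carrier A" "(\<lambda>b\<in>T. c (Inr b)) \<in> \<beta> ` carrier B"
        by (simp_all only: bij_betw_imp_surj_on[OF b\<alpha>] bij_betw_imp_surj_on[OF b\<beta>])
      then obtain a b where ab: "a \<in> carrier A" "\<alpha> a = (\<lambda>a\<in>S. c (Inl a))" "b \<in> carrier B" "\<beta> b = (\<lambda>b\<in>T. c (Inr b))"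
        by (elim imageE) (rule that, simp_all)
      then have "(a, b) \<in> (\<lambda>x. (p x, q x)) ` carrier V" using bij by (auto simp: bij_betw_def)
      then obtain x where x: "x \<in> carrier V" "p x = a" "q x = b" by auto
      have "c = ?\<phi> x"
      proof (rule PiE_ext[OF c m\<phi>[OF x(1)]])
        fix s assume "s \<in> S <+> T"
        then show "c s = ?\<phi> x s" using x(2,3) ab(2,4) by auto
      qed
      then show "\<exists>x\<in>carrier V. c = ?\<phi> x" using x(1) by blast
    qed
  next
    fix x y assume x: "x \<in> carrier V" and y: "y \<in> carrier V"
    then show "?\<phi> (x \<oplus>\<^bsub>V\<^esub> y) = ?\<phi> x \<oplus>\<^bsub>ring.func_space K (S <+> T)\<^esub> ?\<phi> y"
      unfolding fs by (intro restrict_ext) (auto simp: fs)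
  next
    fix c x assume c: "c \<in> carrier K" and x: "x \<in> carrier V"
    then show "?\<phi> (c \<odot>\<^bsub>V\<^esub> x) = c \<odot>\<^bsub>ring.func_space K (S <+> T)\<^esub> ?\<phi> x"
      unfolding fs by (intro restrict_ext) (auto simp: fs)
  qed
qed

text \<open>
  In suitable coordinates every linear map copies some coordinates and kills the others. Split the source
  into the kernel and a complement, and the target into the image and a complement; the complement of
  the kernel gets the coordinates of the image, transported along \<open>f\<close>. Both coordinate sets live in the
  same type, so that the copied coordinates carry the same names in source and target.
\<close>

lemma linear_map_normal_form:
  fixes V :: "('k, 'v, 'm) module_scheme" and W :: "('k, 'v, 'n) module_scheme"
  assumes f: "linear_map K V W f" and fdV: "vectorspace.fin_dim K V" and fdW: "vectorspace.fin_dim K W"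
  obtains S T T1 :: "('v + 'v) set" and \<phi> \<psi>
  where "finite S" "finite T" "T1 \<subseteq> S \<inter> T"
    "linear_iso K V (ring.func_space K S) \<phi>" "linear_iso K W (ring.func_space K T) \<psi>"
    "\<And>x t. x \<in> carrier V \<Longrightarrow> t \<in> T \<Longrightarrow> \<psi> (f x) t = (if t \<in> T1 then \<phi> x t else \<zero>\<^bsub>K\<^esub>)"
proof -
  have V: "vectorspace K V" and W: "vectorspace K W" using f by (auto simp: linear_map_def)
  interpret V: vectorspace K V by (rule V)
  interpret W: vectorspace K W by (rule W)
  interpret f: linear_map K V W f by fact
  have K: "field K" using V by (simp add: vectorspace_def)
  note fs = func_space_simps[OF K]
  let ?F = "ring.func_space K"
  define J where "J = f ` carrier V"
  have J: "subspace K J W" unfolding J_def by (rule subspace_image[OF f subspace_carrier[OF V]])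
  obtain \<pi> where \<pi>: "linear_map K W W \<pi>" "\<And>x. x \<in> carrier W \<Longrightarrow> \<pi> x \<in> J" "\<And>x. x \<in> J \<Longrightarrow> \<pi> x = x"
      "\<pi> ` carrier W = J"
    using projection_exists[OF J] by metis
  interpret \<pi>: linear_map K W W \<pi> by fact
  define N where "N = {x \<in> carrier V. f x = \<zero>\<^bsub>W\<^esub>}"
  have N: "subspace K N V" using subspace_vimage[OF f subspace_zero[OF W]] by (simp add: N_def)
  obtain \<kappa> where \<kappa>: "linear_map K V V \<kappa>" "\<And>x. x \<in> carrier V \<Longrightarrow> \<kappa> x \<in> N" "\<And>x. x \<in> N \<Longrightarrow> \<kappa> x = x"
      "\<kappa> ` carrier V = N"
    using projection_exists[OF N] by metis
  interpret \<kappa>: linear_map K V V \<kappa> by fact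
  define D where "D = {x \<in> carrier W. \<pi> x = \<zero>\<^bsub>W\<^esub>}"
  have D: "subspace K D W" using subspace_vimage[OF \<pi>(1) subspace_zero[OF W]] by (simp add: D_def)
  obtain SJ \<alpha> where SJ: "finite (SJ :: 'v set)" "linear_iso K (W\<lparr>carrier := J\<rparr>) (?F SJ) \<alpha>"
    using coordinates_exist[OF subspaceD(8)[OF J] subspace_fin_dim[OF J fdW]] by blast
  obtain SN \<beta> where SN: "finite (SN :: 'v set)" "linear_iso K (V\<lparr>carrier := N\<rparr>) (?F SN) \<beta>"
    using coordinates_exist[OF subspaceD(8)[OF N] subspace_fin_dim[OF N fdV]] by blast
  obtain SD \<gamma> where SD: "finite (SD :: 'v set)" "linear_iso K (W\<lparr>carrier := D\<rparr>) (?F SD) \<gamma>"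
    using coordinates_exist[OF subspaceD(8)[OF D] subspace_fin_dim[OF D fdW]] by blast
  have \<alpha>0: "\<alpha> \<zero>\<^bsub>W\<^esub> = \<zero>\<^bsub>?F SJ\<^esub>" and \<gamma>0: "\<gamma> \<zero>\<^bsub>W\<^esub> = \<zero>\<^bsub>?F SD\<^esub>"
    using SJ(2) SD(2) by (auto simp: linear_iso_def dest: linear_mapD(4))
  \<comment> \<open>The left summands index the coordinates of the image, for source and target alike.\<close>
  let ?S = "SJ <+> SN" and ?T = "SJ <+> SD"
  define \<phi> where "\<phi> x = (\<lambda>s\<in>?S. case s of Inl a \<Rightarrow> \<alpha> (f x) a | Inr b \<Rightarrow> \<beta> (\<kappa> x) b)" for x
  define \<psi> where "\<psi> y = (\<lambda>t\<in>?T. case t of Inl a \<Rightarrow> \<alpha> (\<pi> y) a | Inr b \<Rightarrow> \<gamma> (y \<ominus>\<^bsub>W\<^esub> \<pi> y) b)" for y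
  have fJ: "f x \<in> J" if "x \<in> carrier V" for x using that by (simp add: J_def)
  have Jc: "\<And>j. j \<in> J \<Longrightarrow> j \<in> carrier W" using subspaceD(1)[OF J] by blast
  have dD: "y \<ominus>\<^bsub>W\<^esub> \<pi> y \<in> D" if "y \<in> carrier W" for y
    using that \<pi>(2,3) Jc by (auto simp: D_def a_minus_def W.M.r_neg)
  have \<phi>: "linear_iso K V (?F ?S) \<phi>"
    unfolding \<phi>_def
  proof (rule linear_iso_func_space_Plus[OF _ _ _ SJ(2) SN(2)])
    show "linear_map K V (W\<lparr>carrier := J\<rparr>) f" unfolding J_def by (rule linear_map_onto_image[OF f])
    show "linear_map K V (V\<lparr>carrier := N\<rparr>) \<kappa>"
      by (rule linear_mapI[OF V subspaceD(8)[OF N]]) (use \<kappa>(2) in auto)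
    show "bij_betw (\<lambda>x. (f x, \<kappa> x)) (carrier V) (carrier (W\<lparr>carrier := J\<rparr>) \<times> carrier (V\<lparr>carrier := N\<rparr>))"
    proof (rule bij_betwI')
      fix x y assume xy: "x \<in> carrier V" "y \<in> carrier V"
      show "(f x, \<kappa> x) = (f y, \<kappa> y) \<longleftrightarrow> x = y"
      proof
        assume eq: "(f x, \<kappa> x) = (f y, \<kappa> y)"
        have "f (x \<oplus>\<^bsub>V\<^esub> \<ominus>\<^bsub>V\<^esub> y) = \<zero>\<^bsub>W\<^esub>" using eq xy by (simp add: W.M.r_neg)
        then have "x \<oplus>\<^bsub>V\<^esub> \<ominus>\<^bsub>V\<^esub> y \<in> N" using xy by (simp add: N_def)
        then have "x \<oplus>\<^bsub>V\<^esub> \<ominus>\<^bsub>V\<^esub> y = \<kappa> (x \<oplus>\<^bsub>V\<^esub> \<ominus>\<^bsub>V\<^esub> y)" using \<kappa>(3) by simp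
        also have "\<dots> = y \<oplus>\<^bsub>V\<^esub> \<ominus>\<^bsub>V\<^esub> y" using eq xy by (simp add: V.M.r_neg)
        finally show "x = y" using xy by (simp add: V.M.add.right_cancel)
      qed simp
    next
      fix x assume "x \<in> carrier V"
      then show "(f x, \<kappa> x) \<in> carrier (W\<lparr>carrier := J\<rparr>) \<times> carrier (V\<lparr>carrier := N\<rparr>)" using fJ \<kappa>(2) by simp
    next
      fix z assume "z \<in> carrier (W\<lparr>carrier := J\<rparr>) \<times> carrier (V\<lparr>carrier := N\<rparr>)"
      then obtain x0 n where z: "z = (f x0, n)" "x0 \<in> carrier V" "n \<in> N" by (auto simp: J_def)
      have n: "n \<in> carrier V" "f n = \<zero>\<^bsub>W\<^esub>" "f (\<kappa> x0) = \<zero>\<^bsub>W\<^esub>" using z \<kappa>(2) by (auto simp: N_def)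
      let ?x = "x0 \<oplus>\<^bsub>V\<^esub> (\<ominus>\<^bsub>V\<^esub> \<kappa> x0 \<oplus>\<^bsub>V\<^esub> n)"
      have "f ?x = f x0" using z n by simp
      moreover have "\<kappa> ?x = n" using z n \<kappa>(2,3) by (simp add: V.M.r_neg2)
      ultimately show "\<exists>x\<in>carrier V. z = (f x, \<kappa> x)" using z n by (intro bexI[of _ ?x]) auto
    qed
  qed
  have \<psi>: "linear_iso K W (?F ?T) \<psi>"
    unfolding \<psi>_def
  proof (rule linear_iso_func_space_Plus[OF _ _ _ SJ(2) SD(2)])
    show "linear_map K W (W\<lparr>carrier := J\<rparr>) \<pi>"
      by (rule linear_mapI[OF W subspaceD(8)[OF J]]) (use \<pi>(2) in auto)
    show "linear_map K W (W\<lparr>carrier := D\<rparr>) (\<lambda>y. y \<ominus>\<^bsub>W\<^esub> \<pi> y)"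
      by (rule linear_mapI[OF W subspaceD(8)[OF D]])
        (use dD in \<open>auto simp: a_minus_def W.M.minus_add W.M.a_ac W.smult_r_distr W.smult_r_minus\<close>)
    show "bij_betw (\<lambda>x. (\<pi> x, x \<ominus>\<^bsub>W\<^esub> \<pi> x)) (carrier W) (carrier (W\<lparr>carrier := J\<rparr>) \<times> carrier (W\<lparr>carrier := D\<rparr>))"
    proof (rule bij_betwI')
      fix x y assume xy: "x \<in> carrier W" "y \<in> carrier W"
      show "(\<pi> x, x \<ominus>\<^bsub>W\<^esub> \<pi> x) = (\<pi> y, y \<ominus>\<^bsub>W\<^esub> \<pi> y) \<longleftrightarrow> x = y"
        using xy by (auto simp: a_minus_def W.M.add.right_cancel)
    next
      fix x assume "x \<in> carrier W"
      then show "(\<pi> x, x \<ominus>\<^bsub>W\<^esub> \<pi> x) \<in> carrier (W\<lparr>carrier := J\<rparr>) \<times> carrier (W\<lparr>carrier := D\<rparr>)" using dD \<pi>(2) by simp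
    next
      fix z assume "z \<in> carrier (W\<lparr>carrier := J\<rparr>) \<times> carrier (W\<lparr>carrier := D\<rparr>)"
      then obtain j d where z: "z = (j, d)" "j \<in> J" "d \<in> D" by auto
      have d: "d \<in> carrier W" "\<pi> d = \<zero>\<^bsub>W\<^esub>" and j: "j \<in> carrier W" using z Jc by (auto simp: D_def)
      have 1: "\<pi> (j \<oplus>\<^bsub>W\<^esub> d) = j" using \<pi>(3)[OF z(2)] d j by simp
      have "(j \<oplus>\<^bsub>W\<^esub> d) \<ominus>\<^bsub>W\<^esub> j = d" using d j by (simp add: a_minus_def W.M.a_assoc W.M.a_comm[of d] W.M.r_neg2)
      with 1 show "\<exists>x\<in>carrier W. z = (\<pi> x, x \<ominus>\<^bsub>W\<^esub> \<pi> x)" using z d j by (intro bexI[of _ "j \<oplus>\<^bsub>W\<^esub> d"]) auto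
    qed
  qed
  have "\<psi> (f x) t = (if t \<in> Inl ` SJ then \<phi> x t else \<zero>\<^bsub>K\<^esub>)" if "x \<in> carrier V" "t \<in> ?T" for x t
    using that \<pi>(3)[OF fJ[OF that(1)]] \<gamma>0
    by (auto simp: \<psi>_def \<phi>_def a_minus_def W.M.r_neg fs split: sum.splits)
  then show ?thesis using SJ(1) SN(1) SD(1) by (intro that[OF _ _ _ \<phi> \<psi>, of "Inl ` SJ"]) auto
qed

section \<open>Finite direct sums\<close>

lemma dsum_space_simps:
  "carrier (dsum_space I V) = (\<Pi>\<^sub>E j\<in>I. carrier (V j))"
  "f \<oplus>\<^bsub>dsum_space I V\<^esub> g = (\<lambda>j\<in>I. f j \<oplus>\<^bsub>V j\<^esub> g j)"
  "c \<odot>\<^bsub>dsum_space I V\<^esub> f = (\<lambda>j\<in>I. c \<odot>\<^bsub>V j\<^esub> f j)"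
  "\<zero>\<^bsub>dsum_space I V\<^esub> = (\<lambda>j\<in>I. \<zero>\<^bsub>V j\<^esub>)"
  by (simp_all add: dsum_space_def)

lemma dsum_space_component:
  "v \<in> carrier (dsum_space I V) \<Longrightarrow> j \<in> I \<Longrightarrow> v j \<in> carrier (V j)"
  by (auto simp: dsum_space_simps)

lemma dsum_space_vectorspace:
  assumes K: "field K" and V: "\<And>j. j \<in> I \<Longrightarrow> vectorspace K (V j)"
  shows "vectorspace K (dsum_space I V)"
proof -
  have M: "abelian_group (V j)" "module K (V j)" if "j \<in> I" for j using V[OF that] by (auto simp: vectorspace_def module_def)
  note ag = abelian_groupE[OF M(1)]
  note m = M(2)
  show ?thesis
  proof (rule vs_criteria[OF K]; (intro allI ballI impI; (elim conjE)?)?)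
    show "\<zero>\<^bsub>dsum_space I V\<^esub> \<in> carrier (dsum_space I V)" using ag(2) by (auto simp: dsum_space_simps)
    show "v \<oplus>\<^bsub>dsum_space I V\<^esub> w \<in> carrier (dsum_space I V)" if "v \<in> carrier (dsum_space I V)" "w \<in> carrier (dsum_space I V)" for v w
      using that[THEN dsum_space_component] ag(1) by (auto simp: dsum_space_simps)
    show "c \<odot>\<^bsub>dsum_space I V\<^esub> v \<in> carrier (dsum_space I V)" if "c \<in> carrier K" "v \<in> carrier (dsum_space I V)" for c v
      using that(1) that(2)[THEN dsum_space_component] module.smult_closed[OF m] by (auto simp: dsum_space_simps)
    show "v \<oplus>\<^bsub>dsum_space I V\<^esub> w = w \<oplus>\<^bsub>dsum_space I V\<^esub> v" if "v \<in> carrier (dsum_space I V)" "w \<in> carrier (dsum_space I V)" for v w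
      unfolding dsum_space_simps by (intro restrict_ext ag(4)) (use that[THEN dsum_space_component] in auto)
    show "v \<oplus>\<^bsub>dsum_space I V\<^esub> w \<oplus>\<^bsub>dsum_space I V\<^esub> x = v \<oplus>\<^bsub>dsum_space I V\<^esub> (w \<oplus>\<^bsub>dsum_space I V\<^esub> x)"
      if "v \<in> carrier (dsum_space I V)" "w \<in> carrier (dsum_space I V)" "x \<in> carrier (dsum_space I V)" for v w x
      unfolding dsum_space_simps by (intro restrict_ext) (use that[THEN dsum_space_component] ag(3) ag(1) in auto)
    fix v assume v: "v \<in> carrier (dsum_space I V)"
    then have vj: "\<And>j. j \<in> I \<Longrightarrow> v j \<in> carrier (V j)" by (auto simp: dsum_space_simps)
    have "(\<lambda>j\<in>I. \<ominus>\<^bsub>V j\<^esub> v j) \<in> carrier (dsum_space I V)" 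
      using vj abelian_group.a_inv_closed[OF M(1)] by (auto simp: dsum_space_simps)
    moreover have "v \<oplus>\<^bsub>dsum_space I V\<^esub> (\<lambda>j\<in>I. \<ominus>\<^bsub>V j\<^esub> v j) = \<zero>\<^bsub>dsum_space I V\<^esub>"
      unfolding dsum_space_simps by (intro restrict_ext) (use vj abelian_group.r_neg[OF M(1)] in auto)
    ultimately show "\<exists>w\<in>carrier (dsum_space I V). v \<oplus>\<^bsub>dsum_space I V\<^esub> w = \<zero>\<^bsub>dsum_space I V\<^esub>" by blast
    have vr: "restrict v I = v" using v by (simp add: dsum_space_simps PiE_restrict)
    have "v \<oplus>\<^bsub>dsum_space I V\<^esub> \<zero>\<^bsub>dsum_space I V\<^esub> = restrict v I"
      unfolding dsum_space_simps by (intro restrict_ext) (use vj abelian_monoid.r_zero[OF abelian_group.axioms(1)[OF M(1)]] in auto)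
    then show "v \<oplus>\<^bsub>dsum_space I V\<^esub> \<zero>\<^bsub>dsum_space I V\<^esub> = v" using vr by simp
    have "\<one>\<^bsub>K\<^esub> \<odot>\<^bsub>dsum_space I V\<^esub> v = restrict v I"
      unfolding dsum_space_simps by (intro restrict_ext) (use vj module.smult_one[OF m] in auto)
    then show "\<one>\<^bsub>K\<^esub> \<odot>\<^bsub>dsum_space I V\<^esub> v = v" using vr by simp
  next
    fix a b v assume a: "a \<in> carrier K" and b: "b \<in> carrier K" and v: "v \<in> carrier (dsum_space I V)"
    then have vj: "\<And>j. j \<in> I \<Longrightarrow> v j \<in> carrier (V j)" by (auto simp: dsum_space_simps)
    show "(a \<otimes>\<^bsub>K\<^esub> b) \<odot>\<^bsub>dsum_space I V\<^esub> v = a \<odot>\<^bsub>dsum_space I V\<^esub> (b \<odot>\<^bsub>dsum_space I V\<^esub> v)"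
      unfolding dsum_space_simps by (intro restrict_ext) (use vj a b module.smult_assoc1[OF m] in auto)
    show "(a \<oplus>\<^bsub>K\<^esub> b) \<odot>\<^bsub>dsum_space I V\<^esub> v = a \<odot>\<^bsub>dsum_space I V\<^esub> v \<oplus>\<^bsub>dsum_space I V\<^esub> b \<odot>\<^bsub>dsum_space I V\<^esub> v"
      unfolding dsum_space_simps by (intro restrict_ext) (use vj a b module.smult_l_distr[OF m] in auto)
  next
    fix a v w assume a: "a \<in> carrier K" and v: "v \<in> carrier (dsum_space I V)" and w: "w \<in> carrier (dsum_space I V)"
    show "a \<odot>\<^bsub>dsum_space I V\<^esub> (v \<oplus>\<^bsub>dsum_space I V\<^esub> w) = a \<odot>\<^bsub>dsum_space I V\<^esub> v \<oplus>\<^bsub>dsum_space I V\<^esub> a \<odot>\<^bsub>dsum_space I V\<^esub> w"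
      unfolding dsum_space_simps by (intro restrict_ext) (use v[THEN dsum_space_component] w[THEN dsum_space_component] a module.smult_r_distr[OF m] in auto)
  qed
qed

lemma dsum_space_map:
  assumes K: "field K" and f: "\<And>j. j \<in> I \<Longrightarrow> linear_map K (V j) (W j) (f j)"
  shows "linear_map K (dsum_space I V) (dsum_space I W) (\<lambda>x. \<lambda>j\<in>I. f j (x j))"
proof -
  note fj = linear_mapD[OF f]
  show ?thesis
  proof (rule linear_mapI)
    show "vectorspace K (dsum_space I V)" "vectorspace K (dsum_space I W)"
      by (rule dsum_space_vectorspace[OF K]; simp add: fj)+
  next
    fix x assume "x \<in> carrier (dsum_space I V)"
    then show "(\<lambda>j\<in>I. f j (x j)) \<in> carrier (dsum_space I W)" using fj(1) dsum_space_component by (auto simp: dsum_space_simps)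
  next
    fix x y assume xy: "x \<in> carrier (dsum_space I V)" "y \<in> carrier (dsum_space I V)"
    have "f j (x j \<oplus>\<^bsub>V j\<^esub> y j) = f j (x j) \<oplus>\<^bsub>W j\<^esub> f j (y j)" if "j \<in> I" for j
      by (rule fj(2)[OF that xy[THEN dsum_space_component, OF that]])
    then show "(\<lambda>j\<in>I. f j ((x \<oplus>\<^bsub>dsum_space I V\<^esub> y) j)) = (\<lambda>j\<in>I. f j (x j)) \<oplus>\<^bsub>dsum_space I W\<^esub> (\<lambda>j\<in>I. f j (y j))"
      unfolding dsum_space_simps(2-) by (intro restrict_ext) auto
  next
    fix c x assume cx: "c \<in> carrier K" "x \<in> carrier (dsum_space I V)"
    have "f j (c \<odot>\<^bsub>V j\<^esub> x j) = c \<odot>\<^bsub>W j\<^esub> f j (x j)" if "j \<in> I" for j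
      by (rule fj(3)[OF that cx(1) dsum_space_component[OF cx(2) that]])
    then show "(\<lambda>j\<in>I. f j ((c \<odot>\<^bsub>dsum_space I V\<^esub> x) j)) = c \<odot>\<^bsub>dsum_space I W\<^esub> (\<lambda>j\<in>I. f j (x j))"
      unfolding dsum_space_simps(2-) by (intro restrict_ext) auto
  qed
qed

lemma image_PiE_componentwise:
  "(\<lambda>x. \<lambda>j\<in>I. f j (x j)) ` (\<Pi>\<^sub>E j\<in>I. A j) = (\<Pi>\<^sub>E j\<in>I. f j ` A j)"
proof (intro equalityI subsetI)
  fix y assume y: "y \<in> (\<Pi>\<^sub>E j\<in>I. f j ` A j)"
  then have "\<forall>j\<in>I. \<exists>a\<in>A j. y j = f j a" by (auto simp: PiE_iff)
  then obtain x where x: "\<And>j. j \<in> I \<Longrightarrow> x j \<in> A j \<and> y j = f j (x j)" by metis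
  have "y = (\<lambda>j\<in>I. f j (restrict x I j))" using x y by (intro ext) (auto simp: PiE_iff extensional_def)
  moreover have "restrict x I \<in> (\<Pi>\<^sub>E j\<in>I. A j)" using x by auto
  ultimately show "y \<in> (\<lambda>x. \<lambda>j\<in>I. f j (x j)) ` (\<Pi>\<^sub>E j\<in>I. A j)" by blast
qed auto

lemma dsum_space_iso:
  assumes K: "field K" and f: "\<And>j. j \<in> I \<Longrightarrow> linear_iso K (V j) (W j) (f j)"
  shows "linear_iso K (dsum_space I V) (dsum_space I W) (\<lambda>x. \<lambda>j\<in>I. f j (x j))"
  unfolding linear_iso_def
proof
  show "linear_map K (dsum_space I V) (dsum_space I W) (\<lambda>x. \<lambda>j\<in>I. f j (x j))"
    by (rule dsum_space_map[OF K]) (use f in \<open>auto simp: linear_iso_def\<close>)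
  have bij: "inj_on (f j) (carrier (V j))" "f j ` carrier (V j) = carrier (W j)" if "j \<in> I" for j
    using f[OF that] by (auto simp: linear_iso_def bij_betw_def)
  show "bij_betw (\<lambda>x. \<lambda>j\<in>I. f j (x j)) (carrier (dsum_space I V)) (carrier (dsum_space I W))"
    unfolding bij_betw_def dsum_space_simps image_PiE_componentwise
  proof
    show "inj_on (\<lambda>x. \<lambda>j\<in>I. f j (x j)) (\<Pi>\<^sub>E j\<in>I. carrier (V j))"
    proof (rule inj_onI)
      fix x y assume xy: "x \<in> (\<Pi>\<^sub>E j\<in>I. carrier (V j))" "y \<in> (\<Pi>\<^sub>E j\<in>I. carrier (V j))"
        and eq: "(\<lambda>j\<in>I. f j (x j)) = (\<lambda>j\<in>I. f j (y j))"
      show "x = y"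
      proof (rule PiE_ext[OF xy])
        fix j assume j: "j \<in> I"
        then have "f j (x j) = f j (y j)" using fun_cong[OF eq, of j] by simp
        then show "x j = y j" using bij(1)[OF j] xy j by (auto simp: inj_on_def)
      qed
    qed
    show "(\<Pi>\<^sub>E j\<in>I. f j ` carrier (V j)) = (\<Pi>\<^sub>E j\<in>I. carrier (W j))" using bij(2) by (intro PiE_cong) auto
  qed
qed

text \<open>
  A family of coordinate vectors is one coordinate vector on the disjoint union of the index sets; so
  dimensions add up in a direct sum.
\<close>

lemma dsum_func_space_iso:
  assumes K: "field K"
  shows "linear_iso K (dsum_space I (\<lambda>j. ring.func_space K (B j))) (ring.func_space K (Sigma I B))
    (\<lambda>x. \<lambda>(j, s)\<in>Sigma I B. x j s)"
proof (rule linear_isoI)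
  note fs = func_space_simps[OF K]
  let ?f = "\<lambda>x. \<lambda>(j, s)\<in>Sigma I B. x j s"
  show "vectorspace K (dsum_space I (\<lambda>j. ring.func_space K (B j)))"
    by (rule dsum_space_vectorspace[OF K func_space_vectorspace[OF K]])
  show "vectorspace K (ring.func_space K (Sigma I B))" by (rule func_space_vectorspace[OF K])
  show "bij_betw ?f (carrier (dsum_space I (\<lambda>j. ring.func_space K (B j)))) (carrier (ring.func_space K (Sigma I B)))"
    unfolding dsum_space_simps fs
  proof (rule bij_betw_byWitness[where f' = "\<lambda>c. \<lambda>j\<in>I. \<lambda>s\<in>B j. c (j, s)"])
    show "\<forall>x\<in>\<Pi>\<^sub>E j\<in>I. B j \<rightarrow>\<^sub>E carrier K. (\<lambda>j\<in>I. \<lambda>s\<in>B j. ?f x (j, s)) = x"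
    proof
      fix x assume x: "x \<in> (\<Pi>\<^sub>E j\<in>I. B j \<rightarrow>\<^sub>E carrier K)"
      have "x j s = undefined" if "j \<in> I" "s \<notin> B j" for j s using x that by (auto simp: PiE_iff extensional_def)
      then show "(\<lambda>j\<in>I. \<lambda>s\<in>B j. ?f x (j, s)) = x" using x by (auto simp: fun_eq_iff restrict_def PiE_iff extensional_def)
    qed
    show "\<forall>c\<in>Sigma I B \<rightarrow>\<^sub>E carrier K. ?f (\<lambda>j\<in>I. \<lambda>s\<in>B j. c (j, s)) = c"
      by (auto simp: fun_eq_iff restrict_def PiE_iff extensional_def)
    show "?f ` (\<Pi>\<^sub>E j\<in>I. B j \<rightarrow>\<^sub>E carrier K) \<subseteq> Sigma I B \<rightarrow>\<^sub>E carrier K"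
    proof
      fix y assume "y \<in> ?f ` (\<Pi>\<^sub>E j\<in>I. B j \<rightarrow>\<^sub>E carrier K)"
      then obtain x where x: "x \<in> (\<Pi>\<^sub>E j\<in>I. B j \<rightarrow>\<^sub>E carrier K)" "y = ?f x" by blast
      have "x j s \<in> carrier K" if "j \<in> I" "s \<in> B j" for j s
        using PiE_mem[OF PiE_mem[OF x(1) that(1)] that(2)] .
      then show "y \<in> Sigma I B \<rightarrow>\<^sub>E carrier K" unfolding x(2) restrict_PiE_iff by auto
    qed
    show "(\<lambda>c. \<lambda>j\<in>I. \<lambda>s\<in>B j. c (j, s)) ` (Sigma I B \<rightarrow>\<^sub>E carrier K) \<subseteq> (\<Pi>\<^sub>E j\<in>I. B j \<rightarrow>\<^sub>E carrier K)" by auto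
  qed
  show "?f (x \<oplus>\<^bsub>dsum_space I (\<lambda>j. ring.func_space K (B j))\<^esub> y) = ?f x \<oplus>\<^bsub>ring.func_space K (Sigma I B)\<^esub> ?f y" for x y
    unfolding dsum_space_simps fs by (intro restrict_ext) auto
  show "?f (c \<odot>\<^bsub>dsum_space I (\<lambda>j. ring.func_space K (B j))\<^esub> x) = c \<odot>\<^bsub>ring.func_space K (Sigma I B)\<^esub> ?f x" for c x
    unfolding dsum_space_simps fs by (intro restrict_ext) auto
qed

lemma dsum_space_dim:
  fixes V :: "'j \<Rightarrow> ('k, 'v) module"
  assumes K: "field K" and I: "finite I" and V: "\<And>j. j \<in> I \<Longrightarrow> vectorspace K (V j) \<and> vectorspace.fin_dim K (V j)"
  shows "vectorspace.dim K (dsum_space I V) = (\<Sum>j\<in>I. vectorspace.dim K (V j))"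
    and "vectorspace.fin_dim K (dsum_space I V)"
proof -
  have "\<forall>j\<in>I. \<exists>B :: 'v set. \<exists>\<phi>. finite B \<and> linear_iso K (V j) (ring.func_space K B) \<phi>"
    using coordinates_exist V by metis
  then obtain B :: "'j \<Rightarrow> 'v set" and \<phi> where B: "\<And>j. j \<in> I \<Longrightarrow> finite (B j) \<and> linear_iso K (V j) (ring.func_space K (B j)) (\<phi> j)"
    by metis
  have "linear_iso K (dsum_space I V) (dsum_space I (\<lambda>j. ring.func_space K (B j))) (\<lambda>x. \<lambda>j\<in>I. \<phi> j (x j))"
    by (rule dsum_space_iso[OF K]) (use B in auto)
  from linear_iso_inv[OF linear_iso_comp[OF this dsum_func_space_iso[OF K]]]
  obtain g where g: "linear_iso K (ring.func_space K (Sigma I B)) (dsum_space I V) g" by blast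
  have fin: "finite (Sigma I B)" using I B by auto
  note F = func_space_basis[OF K fin]
  show "vectorspace.fin_dim K (dsum_space I V)" by (rule linear_iso_dim(2)[OF g F(3)])
  have "vectorspace.dim K (dsum_space I V) = card (Sigma I B)"
    using linear_iso_dim(1)[OF g F(3)] F(2) by simp
  also have "\<dots> = (\<Sum>j\<in>I. card (B j))" using I B by (intro card_SigmaI) auto
  also have "\<dots> = (\<Sum>j\<in>I. vectorspace.dim K (V j))"
  proof (rule sum.cong[OF refl])
    fix j assume j: "j \<in> I"
    show "card (B j) = vectorspace.dim K (V j)"
      using linear_iso_dim(1)[of K "V j" "ring.func_space K (B j)" "\<phi> j"] B[OF j] V[OF j] func_space_basis(2)[OF K, of "B j"] by simp
  qed
  finally show "vectorspace.dim K (dsum_space I V) = (\<Sum>j\<in>I. vectorspace.dim K (V j))" .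
qed

text \<open>
  The image of a componentwise map is, even as a record, the direct sum of the images, so additivity of the
  rank is additivity of the dimension.
\<close>

lemma dsum_space_rank:
  fixes W :: "'j \<Rightarrow> ('k, 'v) module"
  assumes K: "field K" and I: "finite I" and f: "\<And>j. j \<in> I \<Longrightarrow> linear_map K (V j) (W j) (f j)"
    and fd: "\<And>j. j \<in> I \<Longrightarrow> vectorspace.fin_dim K (V j)"
  shows "rank K (dsum_space I V) (dsum_space I W) (\<lambda>x. \<lambda>j\<in>I. f j (x j)) = (\<Sum>j\<in>I. rank K (V j) (W j) (f j))"
proof -
  let ?J = "\<lambda>j. W j\<lparr>carrier := f j ` carrier (V j)\<rparr>"
  have "(dsum_space I W)\<lparr>carrier := (\<lambda>x. \<lambda>j\<in>I. f j (x j)) ` carrier (dsum_space I V)\<rparr> = dsum_space I ?J"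
    by (simp add: dsum_space_def image_PiE_componentwise)
  moreover have "vectorspace K (?J j)" "vectorspace.fin_dim K (?J j)" if "j \<in> I" for j
  proof -
    interpret g: linear_map K "V j" "?J j" "f j" by (rule linear_map_onto_image[OF f[OF that]])
    show "vectorspace K (?J j)" by (rule g.W.vectorspace_axioms)
    show "vectorspace.fin_dim K (?J j)" by (rule g.surj_fin_dim[OF fd[OF that]]) simp
  qed
  ultimately show ?thesis unfolding rank_def by (simp add: dsum_space_dim(1)[OF K I])
qed

section \<open>Free modules\<close>

lemma free_mod_simps:
  "carrier (free_mod K G) = {f. finite {s. f s \<noteq> \<zero>\<^bsub>K\<^esub>} \<and> (\<forall>s\<in>G. f s \<in> carrier K) \<and> (\<forall>s. s \<notin> G \<longrightarrow> f s = \<zero>\<^bsub>K\<^esub>)}"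
  "f \<oplus>\<^bsub>free_mod K G\<^esub> g = (\<lambda>s. f s \<oplus>\<^bsub>K\<^esub> g s)"
  "c \<odot>\<^bsub>free_mod K G\<^esub> f = (\<lambda>s. c \<otimes>\<^bsub>K\<^esub> f s)"
  "\<zero>\<^bsub>free_mod K G\<^esub> = (\<lambda>s. \<zero>\<^bsub>K\<^esub>)"
  by (simp_all add: free_mod_def)

lemma free_mod_value:
  assumes "field K" "f \<in> carrier (free_mod K G)"
  shows "f s \<in> carrier K"
proof -
  interpret field K by fact
  show ?thesis using assms(2) by (cases "s \<in> G") (auto simp: free_mod_simps)
qed

lemma free_mod_support: "f \<in> carrier (free_mod K G) \<Longrightarrow> {s. f s \<noteq> \<zero>\<^bsub>K\<^esub>} \<subseteq> G"
  by (auto simp: free_mod_simps)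

lemma free_mod_vectorspace:
  assumes K: "field K"
  shows "vectorspace K (free_mod K G)"
proof -
  interpret field K by fact
  note val = free_mod_value[OF K, of _ G]
  show ?thesis
  proof (rule vs_criteria[OF K]; (intro allI ballI impI; (elim conjE)?)?)
    show "\<zero>\<^bsub>free_mod K G\<^esub> \<in> carrier (free_mod K G)" by (simp add: free_mod_simps)
    show "v \<oplus>\<^bsub>free_mod K G\<^esub> w \<in> carrier (free_mod K G)"
      if "v \<in> carrier (free_mod K G)" "w \<in> carrier (free_mod K G)" for v w
    proof -
      have "{s. v s \<oplus>\<^bsub>K\<^esub> w s \<noteq> \<zero>\<^bsub>K\<^esub>} \<subseteq> {s. v s \<noteq> \<zero>\<^bsub>K\<^esub>} \<union> {s. w s \<noteq> \<zero>\<^bsub>K\<^esub>}" by auto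
      from finite_subset[OF this] have "finite {s. v s \<oplus>\<^bsub>K\<^esub> w s \<noteq> \<zero>\<^bsub>K\<^esub>}"
        using that by (simp add: free_mod_simps)
      then show ?thesis using that val[OF that(1)] val[OF that(2)] by (simp add: free_mod_simps)
    qed
    show "c \<odot>\<^bsub>free_mod K G\<^esub> v \<in> carrier (free_mod K G)" if "c \<in> carrier K" "v \<in> carrier (free_mod K G)" for c v
    proof -
      have "{s. c \<otimes>\<^bsub>K\<^esub> v s \<noteq> \<zero>\<^bsub>K\<^esub>} \<subseteq> {s. v s \<noteq> \<zero>\<^bsub>K\<^esub>}" using that by auto
      from finite_subset[OF this] have "finite {s. c \<otimes>\<^bsub>K\<^esub> v s \<noteq> \<zero>\<^bsub>K\<^esub>}"
        using that by (simp add: free_mod_simps)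
      then show ?thesis using that val[OF that(2)] by (simp add: free_mod_simps)
    qed
    show "v \<oplus>\<^bsub>free_mod K G\<^esub> w = w \<oplus>\<^bsub>free_mod K G\<^esub> v"
      if "v \<in> carrier (free_mod K G)" "w \<in> carrier (free_mod K G)" for v w
      unfolding free_mod_simps(2) using val[OF that(1)] val[OF that(2)] by (intro ext a_comm)
    show "v \<oplus>\<^bsub>free_mod K G\<^esub> w \<oplus>\<^bsub>free_mod K G\<^esub> x = v \<oplus>\<^bsub>free_mod K G\<^esub> (w \<oplus>\<^bsub>free_mod K G\<^esub> x)"
      if "v \<in> carrier (free_mod K G)" "w \<in> carrier (free_mod K G)" "x \<in> carrier (free_mod K G)" for v w x
      unfolding free_mod_simps(2) using val[OF that(1)] val[OF that(2)] val[OF that(3)] by (intro ext a_assoc)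
    fix v assume v: "v \<in> carrier (free_mod K G)"
    have "{s. \<ominus>\<^bsub>K\<^esub> v s \<noteq> \<zero>\<^bsub>K\<^esub>} \<subseteq> {s. v s \<noteq> \<zero>\<^bsub>K\<^esub>}" by auto
    from finite_subset[OF this] have "finite {s. \<ominus>\<^bsub>K\<^esub> v s \<noteq> \<zero>\<^bsub>K\<^esub>}" using v by (simp add: free_mod_simps)
    then have "(\<lambda>s. \<ominus>\<^bsub>K\<^esub> v s) \<in> carrier (free_mod K G)" using v by (auto simp: free_mod_simps)
    moreover have "v \<oplus>\<^bsub>free_mod K G\<^esub> (\<lambda>s. \<ominus>\<^bsub>K\<^esub> v s) = \<zero>\<^bsub>free_mod K G\<^esub>"
      unfolding free_mod_simps(2,4) using val[OF v] by (intro ext r_neg)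
    ultimately show "\<exists>w\<in>carrier (free_mod K G). v \<oplus>\<^bsub>free_mod K G\<^esub> w = \<zero>\<^bsub>free_mod K G\<^esub>" by blast
    show "v \<oplus>\<^bsub>free_mod K G\<^esub> \<zero>\<^bsub>free_mod K G\<^esub> = v" "\<one>\<^bsub>K\<^esub> \<odot>\<^bsub>free_mod K G\<^esub> v = v"
      unfolding free_mod_simps(2-4) using val[OF v] by auto
  next
    fix a b v assume ab: "a \<in> carrier K" "b \<in> carrier K" and v: "v \<in> carrier (free_mod K G)"
    show "(a \<otimes>\<^bsub>K\<^esub> b) \<odot>\<^bsub>free_mod K G\<^esub> v = a \<odot>\<^bsub>free_mod K G\<^esub> (b \<odot>\<^bsub>free_mod K G\<^esub> v)"
      "(a \<oplus>\<^bsub>K\<^esub> b) \<odot>\<^bsub>free_mod K G\<^esub> v = a \<odot>\<^bsub>free_mod K G\<^esub> v \<oplus>\<^bsub>free_mod K G\<^esub> b \<odot>\<^bsub>free_mod K G\<^esub> v"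
      unfolding free_mod_simps(2-4) using ab val[OF v] by (simp_all add: m_assoc l_distr)
  next
    fix a v w assume a: "a \<in> carrier K" and v: "v \<in> carrier (free_mod K G)" and w: "w \<in> carrier (free_mod K G)"
    show "a \<odot>\<^bsub>free_mod K G\<^esub> (v \<oplus>\<^bsub>free_mod K G\<^esub> w) = a \<odot>\<^bsub>free_mod K G\<^esub> v \<oplus>\<^bsub>free_mod K G\<^esub> a \<odot>\<^bsub>free_mod K G\<^esub> w"
      unfolding free_mod_simps(2-4) using a val[OF v] val[OF w] by (simp add: r_distr)
  qed
qed

lemma free_gen_carrier: "field K \<Longrightarrow> s \<in> G \<Longrightarrow> free_gen K s \<in> carrier (free_mod K G)"
proof -
  assume "field K" "s \<in> G"
  then interpret field K by simp
  show ?thesis using \<open>s \<in> G\<close> by (auto simp: free_mod_simps free_gen_def)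
qed

lemma subspace_finsum_closed:
  assumes P: "subspace K P V" and "finite A" "\<And>x. x \<in> A \<Longrightarrow> g x \<in> P"
  shows "finsum V g A \<in> P"
proof -
  interpret V: vectorspace K V by (rule subspaceD(7)[OF P])
  have PV: "\<And>x. x \<in> P \<Longrightarrow> x \<in> carrier V" using subspaceD(1)[OF P] by blast
  show ?thesis using assms(2,3)
  proof (induction A)
    case empty then show ?case using subspaceD(2)[OF P] by simp
  next
    case (insert x A)
    then have "finsum V g (insert x A) = g x \<oplus>\<^bsub>V\<^esub> finsum V g A" using PV by (intro V.M.finsum_insert) auto
    then show ?case using insert subspaceD(3)[OF P] by simp
  qed
qed

lemma free_mod_expand:
  assumes K: "field K" and u: "u \<in> carrier (free_mod K G)"
  shows "u = (\<Oplus>\<^bsub>free_mod K G\<^esub>s\<in>{s. u s \<noteq> \<zero>\<^bsub>K\<^esub>}. u s \<odot>\<^bsub>free_mod K G\<^esub> free_gen K s)"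
proof -
  interpret field K by fact
  interpret F: vectorspace K "free_mod K G" by (rule free_mod_vectorspace[OF K])
  let ?A = "{s. u s \<noteq> \<zero>\<^bsub>K\<^esub>}"
  have A: "finite ?A" "?A \<subseteq> G" using u free_mod_support by (auto simp: free_mod_simps)
  have mem: "u s \<odot>\<^bsub>free_mod K G\<^esub> free_gen K s \<in> carrier (free_mod K G)" if "s \<in> G" for s
    using free_gen_carrier[OF K that] free_mod_value[OF K u] by auto
  have "(\<Oplus>\<^bsub>free_mod K G\<^esub>s\<in>B. u s \<odot>\<^bsub>free_mod K G\<^esub> free_gen K s) = (\<lambda>t. if t \<in> B then u t else \<zero>\<^bsub>K\<^esub>)"
    if "finite B" "B \<subseteq> G" for B
    using that
  proof (induction B)
    case empty then show ?case by (simp add: free_mod_simps)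
  next
    case (insert s B)
    then have "(\<Oplus>\<^bsub>free_mod K G\<^esub>s\<in>insert s B. u s \<odot>\<^bsub>free_mod K G\<^esub> free_gen K s)
      = u s \<odot>\<^bsub>free_mod K G\<^esub> free_gen K s \<oplus>\<^bsub>free_mod K G\<^esub> (\<lambda>t. if t \<in> B then u t else \<zero>\<^bsub>K\<^esub>)"
      using mem by (subst F.M.finsum_insert) auto
    then show ?case using insert.hyps free_mod_value[OF K u] by (auto simp: free_mod_simps free_gen_def)
  qed
  from this[OF A] show ?thesis by auto
qed

lemma free_mod_induct:
  assumes K: "field K" and P: "subspace K P (free_mod K G)" and gen: "\<And>s. s \<in> G \<Longrightarrow> free_gen K s \<in> P"
    and u: "u \<in> carrier (free_mod K G)"
  shows "u \<in> P"
proof (subst free_mod_expand[OF K u], rule subspace_finsum_closed[OF P])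
  show "finite {s. u s \<noteq> \<zero>\<^bsub>K\<^esub>}" using u by (simp add: free_mod_simps)
  show "u s \<odot>\<^bsub>free_mod K G\<^esub> free_gen K s \<in> P" if "s \<in> {s. u s \<noteq> \<zero>\<^bsub>K\<^esub>}" for s
    using that free_mod_support[OF u] gen free_mod_value[OF K u] by (intro subspaceD(4)[OF P]) auto
qed

text \<open>
  The universal property of the free module: the linear extension of \<open>g\<close> from generators.
\<close>

definition free_ext where
  "free_ext K W g u = (\<Oplus>\<^bsub>W\<^esub>s\<in>{s. u s \<noteq> \<zero>\<^bsub>K\<^esub>}. u s \<odot>\<^bsub>W\<^esub> g s)"

lemma free_ext_superset:
  assumes W: "vectorspace K W" and g: "\<And>s. s \<in> G \<Longrightarrow> g s \<in> carrier W" and u: "u \<in> carrier (free_mod K G)"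
    and A: "finite A" "{s. u s \<noteq> \<zero>\<^bsub>K\<^esub>} \<subseteq> A" "A \<subseteq> G"
  shows "free_ext K W g u = (\<Oplus>\<^bsub>W\<^esub>s\<in>A. u s \<odot>\<^bsub>W\<^esub> g s)"
proof -
  interpret W: vectorspace K W by (rule W)
  show ?thesis unfolding free_ext_def
    by (rule W.M.add.finprod_mono_neutral_cong_left) (use A g free_mod_value[OF W.field_axioms u] in auto)
qed

lemma free_ext_linear:
  assumes W: "vectorspace K W" and g: "\<And>s. s \<in> G \<Longrightarrow> g s \<in> carrier W"
  shows "linear_map K (free_mod K G) W (free_ext K W g)"
    and "\<And>s. s \<in> G \<Longrightarrow> free_ext K W g (free_gen K s) = g s"
proof -
  interpret W: vectorspace K W by (rule W)
  have K: "field K" ..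
  note F = free_mod_vectorspace[OF K, of G]
  interpret F: vectorspace K "free_mod K G" by (rule F)
  note val = free_mod_value[OF K, of _ G]
  have fin: "finite {s. u s \<noteq> \<zero>\<^bsub>K\<^esub>}" "{s. u s \<noteq> \<zero>\<^bsub>K\<^esub>} \<subseteq> G" if "u \<in> carrier (free_mod K G)" for u
    using that free_mod_support[OF that] by (auto simp: free_mod_simps)
  show "linear_map K (free_mod K G) W (free_ext K W g)"
  proof (rule linear_mapI[OF F W])
    fix u assume u: "u \<in> carrier (free_mod K G)"
    show "free_ext K W g u \<in> carrier W"
      unfolding free_ext_def using fin[OF u] g val[OF u] by (intro W.M.finsum_closed) auto
  next
    fix u v assume u: "u \<in> carrier (free_mod K G)" and v: "v \<in> carrier (free_mod K G)"
    let ?A = "{s. u s \<noteq> \<zero>\<^bsub>K\<^esub>} \<union> {s. v s \<noteq> \<zero>\<^bsub>K\<^esub>}"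
    have A: "finite ?A" "?A \<subseteq> G" using fin u v by auto
    have uv: "u \<oplus>\<^bsub>free_mod K G\<^esub> v \<in> carrier (free_mod K G)" using u v by simp
    have "{s. (u \<oplus>\<^bsub>free_mod K G\<^esub> v) s \<noteq> \<zero>\<^bsub>K\<^esub>} \<subseteq> ?A" by (auto simp: free_mod_simps)
    then have "free_ext K W g (u \<oplus>\<^bsub>free_mod K G\<^esub> v) = (\<Oplus>\<^bsub>W\<^esub>s\<in>?A. (u s \<odot>\<^bsub>W\<^esub> g s) \<oplus>\<^bsub>W\<^esub> (v s \<odot>\<^bsub>W\<^esub> g s))"
      using free_ext_superset[OF W g uv A(1) _ A(2)] val[OF u] val[OF v] g A(2)
      by (simp add: free_mod_simps(2)) (intro W.M.finsum_cong', auto simp: W.smult_l_distr subset_iff)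
    also have "\<dots> = (\<Oplus>\<^bsub>W\<^esub>s\<in>?A. u s \<odot>\<^bsub>W\<^esub> g s) \<oplus>\<^bsub>W\<^esub> (\<Oplus>\<^bsub>W\<^esub>s\<in>?A. v s \<odot>\<^bsub>W\<^esub> g s)"
      using val[OF u] val[OF v] g A(2) by (intro W.M.finsum_addf) auto
    also have "\<dots> = free_ext K W g u \<oplus>\<^bsub>W\<^esub> free_ext K W g v"
      using free_ext_superset[OF W g u A(1) _ A(2)] free_ext_superset[OF W g v A(1) _ A(2)] by simp
    finally show "free_ext K W g (u \<oplus>\<^bsub>free_mod K G\<^esub> v) = free_ext K W g u \<oplus>\<^bsub>W\<^esub> free_ext K W g v" .
  next
    fix c u assume c: "c \<in> carrier K" and u: "u \<in> carrier (free_mod K G)"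
    let ?A = "{s. u s \<noteq> \<zero>\<^bsub>K\<^esub>}"
    have cu: "c \<odot>\<^bsub>free_mod K G\<^esub> u \<in> carrier (free_mod K G)" using c u by simp
    have "{s. (c \<odot>\<^bsub>free_mod K G\<^esub> u) s \<noteq> \<zero>\<^bsub>K\<^esub>} \<subseteq> ?A" using c by (auto simp: free_mod_simps)
    then have "free_ext K W g (c \<odot>\<^bsub>free_mod K G\<^esub> u) = (\<Oplus>\<^bsub>W\<^esub>s\<in>?A. c \<odot>\<^bsub>W\<^esub> (u s \<odot>\<^bsub>W\<^esub> g s))"
      using free_ext_superset[OF W g cu fin(1)[OF u] _ fin(2)[OF u]] val[OF u] g c fin(2)[OF u]
      by (simp add: free_mod_simps(3)) (intro W.M.finsum_cong', auto simp: W.smult_assoc1 subset_iff)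
    also have "\<dots> = c \<odot>\<^bsub>W\<^esub> free_ext K W g u"
      unfolding free_ext_def using val[OF u] g fin[OF u] c by (intro W.finsum_smult[symmetric]) auto
    finally show "free_ext K W g (c \<odot>\<^bsub>free_mod K G\<^esub> u) = c \<odot>\<^bsub>W\<^esub> free_ext K W g u" .
  qed
  show "free_ext K W g (free_gen K s) = g s" if "s \<in> G" for s
  proof -
    have "free_ext K W g (free_gen K s) = (\<Oplus>\<^bsub>W\<^esub>t\<in>{s}. free_gen K s t \<odot>\<^bsub>W\<^esub> g t)"
      using that by (intro free_ext_superset[OF W g free_gen_carrier[OF K that]]) (auto simp: free_gen_def)
    also have "\<dots> = g s" using g[OF that] by (simp add: free_gen_def)
    finally show ?thesis .
  qed
qed

lemma linear_map_free_mod_eq: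
  assumes K: "field K" and f: "linear_map K (free_mod K G) W f" and g: "linear_map K (free_mod K G) W g"
    and eq: "\<And>s. s \<in> G \<Longrightarrow> f (free_gen K s) = g (free_gen K s)"
    and u: "u \<in> carrier (free_mod K G)"
  shows "f u = g u"
proof -
  note f' = linear_mapD[OF f] and g' = linear_mapD[OF g]
  let ?P = "{u \<in> carrier (free_mod K G). f u = g u}"
  interpret F: vectorspace K "free_mod K G" by (rule free_mod_vectorspace[OF K])
  have "subspace K ?P (free_mod K G)"
    by (rule subspaceI[OF F.vectorspace_axioms]) (auto simp: f' g')
  then have "u \<in> ?P" by (rule free_mod_induct[OF K]) (use eq u free_gen_carrier[OF K] in auto)
  then show ?thesis by simp
qed

section \<open>Tensor powers of a space and of a map\<close>

text \<open>
  The coordinate of the pure tensor \<open>x\<^sub>1 \<otimes> \<dots> \<otimes> x\<^sub>n\<close> at \<open>(t\<^sub>1, \<dots>, t\<^sub>n)\<close>.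
\<close>

primrec coord_prod :: "('k, 'z) ring_scheme \<Rightarrow> ('v \<Rightarrow> 's \<Rightarrow> 'k) \<Rightarrow> 'v list \<Rightarrow> 's list \<Rightarrow> 'k" where
  "coord_prod K \<phi> [] ts = \<one>\<^bsub>K\<^esub>"
| "coord_prod K \<phi> (x # xs) ts = \<phi> x (hd ts) \<otimes>\<^bsub>K\<^esub> coord_prod K \<phi> xs (tl ts)"

definition lists_over where
  "lists_over n S = {ts. length ts = n \<and> set ts \<subseteq> S}"

lemma finite_lists_over: "finite S \<Longrightarrow> finite (lists_over n S)"
  and card_lists_over: "finite S \<Longrightarrow> card (lists_over n S) = card S ^ n"
  using finite_lists_length_eq[of S n] card_lists_length_eq[of S n] by (simp_all add: lists_over_def conj_commute)

lemma tuples_replicate: "tuples (replicate n V) = lists_over n (carrier V)"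
  by (auto simp: tuples_def lists_over_def in_set_conv_nth subset_iff)

text \<open>
  Coordinates on \<open>V\<close> indexed by \<open>S\<close> induce coordinates on the \<open>n\<close>-th tensor power of \<open>V\<close> indexed by the
  words of length \<open>n\<close> over \<open>S\<close>. The map \<open>coord\<close> sends the free module on the tuples onto the
  coordinate vectors, and its kernel is exactly the span of the multilinearity relations. So the elements
  of the tensor power, which are cosets, are the fibres of \<open>coord\<close>.
\<close>

locale tensor_coordinates =
  fixes K :: "('k, 'z) ring_scheme" and V :: "('k, 'v) module" and S :: "'s set"
    and \<phi> :: "'v \<Rightarrow> 's \<Rightarrow> 'k" and n :: nat
  assumes fin_S: "finite S" and coords: "linear_iso K V (ring.func_space K S) \<phi>"
begin

abbreviation "L \<equiv> lists_over n S"
abbreviation "tup \<equiv> lists_over n (carrier V)"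
abbreviation "F \<equiv> free_mod K tup"
abbreviation "null \<equiv> tensor_null K (replicate n V)"

lemma coords_linear: "linear_map K V (ring.func_space K S) \<phi>"
  using coords by (simp add: linear_iso_def)

lemma vectorspace_V: "vectorspace K V"
  using linear_mapD(5)[OF coords_linear] .

lemma field_K: "field K"
  using vectorspace_V by (simp add: vectorspace_def)

lemmas fs = func_space_simps[OF field_K]

lemma vectorspace_F: "vectorspace K F"
  by (rule free_mod_vectorspace[OF field_K])

lemma vectorspace_L: "vectorspace K (ring.func_space K L)"
  by (rule func_space_vectorspace[OF field_K])

lemma phi_closed: "x \<in> carrier V \<Longrightarrow> s \<in> S \<Longrightarrow> \<phi> x s \<in> carrier K"
  using linear_mapD(1)[OF coords_linear] by (auto simp: fs)

lemma phi_add: "x \<in> carrier V \<Longrightarrow> y \<in> carrier V \<Longrightarrow> s \<in> S \<Longrightarrow> \<phi> (x \<oplus>\<^bsub>V\<^esub> y) s = \<phi> x s \<oplus>\<^bsub>K\<^esub> \<phi> y s"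
  using linear_mapD(2)[OF coords_linear] by (simp add: fs)

lemma phi_smult: "c \<in> carrier K \<Longrightarrow> x \<in> carrier V \<Longrightarrow> s \<in> S \<Longrightarrow> \<phi> (c \<odot>\<^bsub>V\<^esub> x) s = c \<otimes>\<^bsub>K\<^esub> \<phi> x s"
  using linear_mapD(3)[OF coords_linear] by (simp add: fs)

lemma coord_prod_closed:
  "length xs = length ts \<Longrightarrow> set xs \<subseteq> carrier V \<Longrightarrow> set ts \<subseteq> S \<Longrightarrow> coord_prod K \<phi> xs ts \<in> carrier K"
proof (induction xs arbitrary: ts)
  case Nil
  interpret field K by (rule field_K)
  show ?case by simp
next
  case (Cons x xs)
  interpret field K by (rule field_K)
  from Cons.prems obtain t ts' where "ts = t # ts'" by (cases ts) auto
  with Cons show ?case by (auto simp: phi_closed)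
qed

lemma coord_prod_add:
  assumes "length xs = length ts" "set xs \<subseteq> carrier V" "set ts \<subseteq> S" "j < length xs" "x \<in> carrier V" "y \<in> carrier V"
  shows "coord_prod K \<phi> (xs[j := x \<oplus>\<^bsub>V\<^esub> y]) ts = coord_prod K \<phi> (xs[j := x]) ts \<oplus>\<^bsub>K\<^esub> coord_prod K \<phi> (xs[j := y]) ts"
  using assms(1-4)
proof (induction xs arbitrary: ts j)
  case (Cons z xs)
  interpret field K by (rule field_K)
  from Cons.prems obtain t ts' where ts: "ts = t # ts'" by (cases ts) auto
  show ?case
  proof (cases j)
    case 0
    have "coord_prod K \<phi> xs ts' \<in> carrier K" using Cons.prems ts by (intro coord_prod_closed) auto
    then show ?thesis using 0 ts Cons.prems assms(5,6) by (simp add: phi_add phi_closed l_distr)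
  next
    case (Suc i)
    have mem: "coord_prod K \<phi> (xs[i := w]) ts' \<in> carrier K" if "w \<in> carrier V" for w
      using Cons.prems ts that set_update_subset_insert[of xs i w] by (intro coord_prod_closed) auto
    have "coord_prod K \<phi> (xs[i := x \<oplus>\<^bsub>V\<^esub> y]) ts' = coord_prod K \<phi> (xs[i := x]) ts' \<oplus>\<^bsub>K\<^esub> coord_prod K \<phi> (xs[i := y]) ts'"
      using Cons.prems ts Suc by (intro Cons.IH) auto
    then show ?thesis using Suc ts Cons.prems mem[OF assms(5)] mem[OF assms(6)] by (simp add: phi_closed r_distr)
  qed
qed simp

lemma coord_prod_smult:
  assumes "length xs = length ts" "set xs \<subseteq> carrier V" "set ts \<subseteq> S" "j < length xs" "x \<in> carrier V" "c \<in> carrier K"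
  shows "coord_prod K \<phi> (xs[j := c \<odot>\<^bsub>V\<^esub> x]) ts = c \<otimes>\<^bsub>K\<^esub> coord_prod K \<phi> (xs[j := x]) ts"
  using assms(1-4)
proof (induction xs arbitrary: ts j)
  case (Cons z xs)
  interpret field K by (rule field_K)
  from Cons.prems obtain t ts' where ts: "ts = t # ts'" by (cases ts) auto
  show ?case
  proof (cases j)
    case 0
    have "coord_prod K \<phi> xs ts' \<in> carrier K" using Cons.prems ts by (intro coord_prod_closed) auto
    then show ?thesis using 0 ts Cons.prems assms(5,6) by (simp add: phi_smult phi_closed m_assoc)
  next
    case (Suc i)
    have mem: "coord_prod K \<phi> (xs[i := x]) ts' \<in> carrier K"
      using Cons.prems ts assms(5) set_update_subset_insert[of xs i x] by (intro coord_prod_closed) auto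
    have "coord_prod K \<phi> (xs[i := c \<odot>\<^bsub>V\<^esub> x]) ts' = c \<otimes>\<^bsub>K\<^esub> coord_prod K \<phi> (xs[i := x]) ts'"
      using Cons.prems ts Suc by (intro Cons.IH) auto
    then show ?thesis using Suc ts Cons.prems mem assms(6) by (simp add: phi_closed m_lcomm)
  qed
qed simp

definition coord :: "('v list \<Rightarrow> 'k) \<Rightarrow> 's list \<Rightarrow> 'k" where
  "coord = free_ext K (ring.func_space K L) (\<lambda>xs. \<lambda>ts\<in>L. coord_prod K \<phi> xs ts)"

lemma coord_prod_mem: "xs \<in> tup \<Longrightarrow> (\<lambda>ts\<in>L. coord_prod K \<phi> xs ts) \<in> carrier (ring.func_space K L)"
  unfolding fs restrict_PiE_iff by (auto simp: lists_over_def intro: coord_prod_closed)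

lemma coord_linear: "linear_map K F (ring.func_space K L) coord"
  unfolding coord_def by (rule free_ext_linear[OF vectorspace_L]) (rule coord_prod_mem)

lemma coord_gen: "xs \<in> tup \<Longrightarrow> coord (free_gen K xs) = (\<lambda>ts\<in>L. coord_prod K \<phi> xs ts)"
  unfolding coord_def by (rule free_ext_linear(2)[OF vectorspace_L]) (rule coord_prod_mem)

lemma tup_update: "xs \<in> tup \<Longrightarrow> x \<in> carrier V \<Longrightarrow> xs[j := x] \<in> tup"
  using set_update_subset_insert[of xs j x] by (auto simp: lists_over_def)

lemma rels_cases:
  assumes "r \<in> multilinear_rels K (replicate n V)"
  obtains (add) xs j x y where "xs \<in> tup" "j < n" "x \<in> carrier V" "y \<in> carrier V"
      "r = free_gen K (xs[j := x \<oplus>\<^bsub>V\<^esub> y]) \<ominus>\<^bsub>F\<^esub> (free_gen K (xs[j := x]) \<oplus>\<^bsub>F\<^esub> free_gen K (xs[j := y]))"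
  | (smult) xs j c x where "xs \<in> tup" "j < n" "c \<in> carrier K" "x \<in> carrier V"
      "r = free_gen K (xs[j := c \<odot>\<^bsub>V\<^esub> x]) \<ominus>\<^bsub>F\<^esub> c \<odot>\<^bsub>F\<^esub> free_gen K (xs[j := x])"
proof -
  have "(\<exists>xs j x y. xs \<in> tup \<and> j < n \<and> x \<in> carrier V \<and> y \<in> carrier V \<and>
      r = free_gen K (xs[j := x \<oplus>\<^bsub>V\<^esub> y]) \<ominus>\<^bsub>F\<^esub> (free_gen K (xs[j := x]) \<oplus>\<^bsub>F\<^esub> free_gen K (xs[j := y]))) \<or>
    (\<exists>xs j c x. xs \<in> tup \<and> j < n \<and> c \<in> carrier K \<and> x \<in> carrier V \<and>
      r = free_gen K (xs[j := c \<odot>\<^bsub>V\<^esub> x]) \<ominus>\<^bsub>F\<^esub> c \<odot>\<^bsub>F\<^esub> free_gen K (xs[j := x]))"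
    using assms unfolding multilinear_rels_def Let_def tuples_replicate length_replicate by fastforce
  then show ?thesis using add smult by (elim disjE exE conjE)
qed

lemma rels_addI:
  assumes "xs \<in> tup" "j < n" "x \<in> carrier V" "y \<in> carrier V"
  shows "free_gen K (xs[j := x \<oplus>\<^bsub>V\<^esub> y]) \<ominus>\<^bsub>F\<^esub> (free_gen K (xs[j := x]) \<oplus>\<^bsub>F\<^esub> free_gen K (xs[j := y]))
    \<in> multilinear_rels K (replicate n V)"
  unfolding multilinear_rels_def Let_def tuples_replicate length_replicate
  by (intro UnI1 CollectI exI[of _ xs] exI[of _ j] exI[of _ x] exI[of _ y]) (use assms in auto)

lemma rels_smultI:
  assumes "xs \<in> tup" "j < n" "c \<in> carrier K" "x \<in> carrier V"
  shows "free_gen K (xs[j := c \<odot>\<^bsub>V\<^esub> x]) \<ominus>\<^bsub>F\<^esub> c \<odot>\<^bsub>F\<^esub> free_gen K (xs[j := x])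
    \<in> multilinear_rels K (replicate n V)"
  unfolding multilinear_rels_def Let_def tuples_replicate length_replicate
  by (intro UnI2 CollectI exI[of _ xs] exI[of _ j] exI[of _ c] exI[of _ x]) (use assms in auto)

lemma rels_carrier: "multilinear_rels K (replicate n V) \<subseteq> carrier F"
proof
  fix r assume "r \<in> multilinear_rels K (replicate n V)"
  interpret F: vectorspace K F by (rule vectorspace_F)
  interpret V: vectorspace K V by (rule vectorspace_V)
  note gen = free_gen_carrier[OF field_K tup_update]
  from \<open>r \<in> _\<close> show "r \<in> carrier F"
    by (cases r rule: rels_cases) (auto simp: gen)
qed

lemma null_subspace: "subspace K null F"
proof -
  interpret F: vectorspace K F by (rule vectorspace_F)
  show ?thesis unfolding tensor_null_def tuples_replicate by (rule F.span_is_subspace[OF rels_carrier])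
qed

lemma rels_null: "multilinear_rels K (replicate n V) \<subseteq> null"
proof -
  interpret F: vectorspace K F by (rule vectorspace_F)
  show ?thesis unfolding tensor_null_def tuples_replicate by (rule F.in_own_span[OF rels_carrier])
qed

text \<open>
  The coordinates of a pure tensor are multilinear in its entries.
\<close>

lemma coord_rel:
  assumes "r \<in> multilinear_rels K (replicate n V)"
  shows "coord r = \<zero>\<^bsub>ring.func_space K L\<^esub>"
proof -
  interpret F: vectorspace K F by (rule vectorspace_F)
  interpret V: vectorspace K V by (rule vectorspace_V)
  interpret W: vectorspace K "ring.func_space K L" by (rule vectorspace_L)
  interpret c: linear_map K F "ring.func_space K L" coord by (rule coord_linear)
  note gen = free_gen_carrier[OF field_K tup_update] and tu = tup_update
  have eq: "a = b \<Longrightarrow> b \<in> carrier (ring.func_space K L) \<Longrightarrow> a \<ominus>\<^bsub>ring.func_space K L\<^esub> b = \<zero>\<^bsub>ring.func_space K L\<^esub>" for a b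
    by (simp add: a_minus_def W.M.r_neg)
  from assms show ?thesis
  proof (cases r rule: rels_cases)
    case (add xs j x y)
    note len = add(1)[unfolded lists_over_def, simplified]
    have "coord (free_gen K (xs[j := x \<oplus>\<^bsub>V\<^esub> y])) = coord (free_gen K (xs[j := x])) \<oplus>\<^bsub>ring.func_space K L\<^esub> coord (free_gen K (xs[j := y]))"
      using add len by (simp add: coord_gen tu fs) (intro restrict_ext, auto simp: coord_prod_add lists_over_def)
    then show ?thesis using add by (simp add: gen eq)
  next
    case (smult xs j c x)
    note len = smult(1)[unfolded lists_over_def, simplified]
    have "coord (free_gen K (xs[j := c \<odot>\<^bsub>V\<^esub> x])) = c \<odot>\<^bsub>ring.func_space K L\<^esub> coord (free_gen K (xs[j := x]))"
      using smult len by (simp add: coord_gen tu fs) (intro restrict_ext, auto simp: coord_prod_smult lists_over_def)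
    then show ?thesis using smult by (simp add: gen eq)
  qed
qed

lemma null_le_ker: "u \<in> null \<Longrightarrow> coord u = \<zero>\<^bsub>ring.func_space K L\<^esub>"
proof -
  interpret F: vectorspace K F by (rule vectorspace_F)
  let ?N = "{u \<in> carrier F. coord u \<in> {\<zero>\<^bsub>ring.func_space K L\<^esub>}}"
  have "subspace K ?N F" by (rule subspace_vimage[OF coord_linear subspace_zero[OF vectorspace_L]])
  moreover have "multilinear_rels K (replicate n V) \<subseteq> ?N" using coord_rel rels_carrier by auto
  ultimately have "null \<subseteq> ?N" unfolding tensor_null_def tuples_replicate by (intro F.span_is_subset) auto
  then show "u \<in> null \<Longrightarrow> coord u = \<zero>\<^bsub>ring.func_space K L\<^esub>" by auto
qed

text \<open>
  The basis of \<open>V\<close> to which the coordinates belong.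
\<close>

definition base :: "'s \<Rightarrow> 'v" where
  "base s = inv_into (carrier V) \<phi> (unit_fun K S s)"

lemma unit_fun_mem: "unit_fun K A s \<in> carrier (ring.func_space K A)"
proof -
  interpret field K by (rule field_K)
  show ?thesis by (auto simp: unit_fun_def fs)
qed

lemma base_carrier: "base s \<in> carrier V"
proof -
  have "linear_map K (ring.func_space K S) V (inv_into (carrier V) \<phi>)"
    using linear_iso_inv[OF coords] by (simp add: linear_iso_def)
  from linear_mapD(1)[OF this unit_fun_mem] show ?thesis by (simp add: base_def)
qed

lemma phi_base: "\<phi> (base s) = unit_fun K S s"
  unfolding base_def by (rule bij_betw_inv_into_right[OF _ unit_fun_mem]) (use coords in \<open>simp add: linear_iso_def\<close>)

text \<open>
  The unit vectors span.
\<close>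

lemma func_space_subspace_full:
  assumes A: "finite A" and P: "subspace K P (ring.func_space K A)" and unit: "\<And>s. s \<in> A \<Longrightarrow> unit_fun K A s \<in> P"
  shows "carrier (ring.func_space K A) \<subseteq> P"
proof -
  interpret W: vectorspace K "ring.func_space K A" by (rule func_space_vectorspace[OF field_K])
  have "W.span (unit_fun K A ` A) = carrier (ring.func_space K A)"
    using func_space_basis(1)[OF field_K A] by (simp add: W.basis_def)
  moreover have "W.span (unit_fun K A ` A) \<subseteq> P"
    by (rule W.span_is_subset) (use unit P in auto)
  ultimately show ?thesis by simp
qed

lemma subspace_full:
  assumes P: "subspace K P V" and base: "\<And>s. s \<in> S \<Longrightarrow> base s \<in> P"
  shows "carrier V \<subseteq> P"
proof
  let ?g = "inv_into (carrier V) \<phi>"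
  have g: "linear_map K (ring.func_space K S) V ?g" using linear_iso_inv[OF coords] by (simp add: linear_iso_def)
  have "carrier (ring.func_space K S) \<subseteq> {c \<in> carrier (ring.func_space K S). ?g c \<in> P}"
    by (rule func_space_subspace_full[OF fin_S subspace_vimage[OF g P]])
      (use base unit_fun_mem in \<open>auto simp: base_def\<close>)
  moreover fix x assume x: "x \<in> carrier V"
  moreover have "?g (\<phi> x) = x" using coords x by (intro bij_betw_inv_into_left) (auto simp: linear_iso_def)
  ultimately show "x \<in> P" using linear_mapD(1)[OF coords_linear x] by force
qed

lemma base_inj: "inj_on base S"
proof (rule inj_onI)
  fix s t assume st: "s \<in> S" "t \<in> S" and eq: "base s = base t"
  interpret field K by (rule field_K)
  have "unit_fun K S s s = unit_fun K S t s" using phi_base[of s] phi_base[of t] eq by simp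
  then show "s = t" using st by (simp add: unit_fun_def split: if_splits)
qed

lemma map_base_inj: "inj_on (map base) L"
proof (rule inj_onI)
  fix ts us assume "ts \<in> L" "us \<in> L" and eq: "map base ts = map base us"
  then have "set ts \<union> set us \<subseteq> S" by (auto simp: lists_over_def)
  from map_inj_on[OF eq inj_on_subset[OF base_inj this]] show "ts = us" .
qed

lemma map_base_tup: "ts \<in> L \<Longrightarrow> map base ts \<in> tup"
  using base_carrier by (auto simp: lists_over_def)

lemma coord_prod_base:
  "length ts = length us \<Longrightarrow> set ts \<subseteq> S \<Longrightarrow> set us \<subseteq> S \<Longrightarrow>
    coord_prod K \<phi> (map base ts) us = (if us = ts then \<one>\<^bsub>K\<^esub> else \<zero>\<^bsub>K\<^esub>)"
proof (induction ts arbitrary: us)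
  case (Cons t ts)
  interpret field K by (rule field_K)
  from Cons.prems obtain u us' where us: "us = u # us'" by (cases us) auto
  then show ?case using Cons.prems Cons.IH[of us'] by (auto simp: phi_base unit_fun_def)
qed auto

lemma coord_base: "ts \<in> L \<Longrightarrow> coord (free_gen K (map base ts)) = unit_fun K L ts"
  by (subst coord_gen[OF map_base_tup], assumption, unfold unit_fun_def, intro restrict_ext coord_prod_base)
    (auto simp: lists_over_def)

text \<open>
  The combination of pure tensors of basis vectors with coefficients \<open>c\<close>: a section of \<open>coord\<close>.
\<close>

definition lift_coord :: "('s list \<Rightarrow> 'k) \<Rightarrow> 'v list \<Rightarrow> 'k" where
  "lift_coord c xs = (if xs \<in> map base ` L then c (the_inv_into L (map base) xs) else \<zero>\<^bsub>K\<^esub>)"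

lemma lift_coord_base: "ts \<in> L \<Longrightarrow> lift_coord c (map base ts) = c ts"
  by (simp add: lift_coord_def the_inv_into_f_f[OF map_base_inj])

lemma lift_coord_linear: "linear_map K (ring.func_space K L) F lift_coord"
proof (rule linear_mapI[OF vectorspace_L vectorspace_F])
  interpret field K by (rule field_K)
  have eq: "f = g" if "\<And>ts. ts \<in> L \<Longrightarrow> f (map base ts) = g (map base ts)" "\<And>xs. xs \<notin> map base ` L \<Longrightarrow> f xs = g xs"
    for f g :: "'v list \<Rightarrow> 'k"
  proof (rule ext)
    show "f xs = g xs" for xs using that by (cases "xs \<in> map base ` L") auto
  qed
  have out: "xs \<notin> map base ` L \<Longrightarrow> lift_coord c xs = \<zero>\<^bsub>K\<^esub>" for c xs by (simp add: lift_coord_def)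
  fix c assume c: "c \<in> carrier (ring.func_space K L)"
  then have ck: "c ts \<in> carrier K" if "ts \<in> L" for ts using that by (auto simp: fs)
  have "{xs. lift_coord c xs \<noteq> \<zero>\<^bsub>K\<^esub>} \<subseteq> map base ` L" using out[of _ c] by auto
  then have "finite {xs. lift_coord c xs \<noteq> \<zero>\<^bsub>K\<^esub>}"
    by (rule finite_subset) (simp add: finite_lists_over[OF fin_S])
  moreover have "lift_coord c xs \<in> carrier K" for xs
    using ck out by (cases "xs \<in> map base ` L") (auto simp: lift_coord_base)
  moreover have "lift_coord c xs = \<zero>\<^bsub>K\<^esub>" if "xs \<notin> tup" for xs
    by (rule out) (use that map_base_tup in auto)
  ultimately show "lift_coord c \<in> carrier F" by (auto simp: free_mod_simps)
  show "lift_coord (k \<odot>\<^bsub>ring.func_space K L\<^esub> c) = k \<odot>\<^bsub>F\<^esub> lift_coord c" if "k \<in> carrier K" for k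
    by (rule eq) (use that in \<open>auto simp: fs free_mod_simps lift_coord_base out\<close>)
  show "lift_coord (c \<oplus>\<^bsub>ring.func_space K L\<^esub> d) = lift_coord c \<oplus>\<^bsub>F\<^esub> lift_coord d" for d
    by (rule eq) (auto simp: fs free_mod_simps lift_coord_base out)
qed

lemma lift_coord_unit: "ts \<in> L \<Longrightarrow> lift_coord (unit_fun K L ts) = free_gen K (map base ts)"
proof
  fix xs assume ts: "ts \<in> L"
  show "lift_coord (unit_fun K L ts) xs = free_gen K (map base ts) xs"
  proof (cases "xs \<in> map base ` L")
    case True
    then obtain us where us: "us \<in> L" "xs = map base us" by blast
    then have "us = ts \<longleftrightarrow> map base us = map base ts" using map_base_inj ts by (auto dest: inj_onD)
    then show ?thesis using us by (auto simp: lift_coord_base unit_fun_def free_gen_def)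
  next
    case False
    then show ?thesis using ts by (auto simp: lift_coord_def free_gen_def)
  qed
qed

text \<open>
  Modulo the relations every element is the combination of pure tensors of basis vectors that its
  coordinates prescribe. The elements with this property form a subspace, so only generators matter; and
  in a generator the entries can be replaced by basis vectors one slot at a time, because the
  vectors that may fill a fixed slot form a subspace of \<open>V\<close> by the relations for this slot.
\<close>

lemma reduce_mod_null:
  assumes "u \<in> carrier F"
  shows "u \<ominus>\<^bsub>F\<^esub> lift_coord (coord u) \<in> null"
proof -
  interpret F: vectorspace K F by (rule vectorspace_F)
  interpret V: vectorspace K V by (rule vectorspace_V)
  interpret c: linear_map K F "ring.func_space K L" coord by (rule coord_linear)
  interpret l: linear_map K "ring.func_space K L" F lift_coord by (rule lift_coord_linear)
  let ?h = "\<lambda>u. u \<ominus>\<^bsub>F\<^esub> lift_coord (coord u)"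
  have h: "linear_map K F F ?h"
    by (rule linear_mapI[OF vectorspace_F vectorspace_F])
      (auto simp: a_minus_def F.M.minus_add F.M.a_ac F.smult_r_distr F.smult_r_minus)
  define P where "P = {u \<in> carrier F. ?h u \<in> null}"
  have P: "subspace K P F" unfolding P_def by (rule subspace_vimage[OF h null_subspace])
  note Pd = subspaceD[OF P]
  have neg0: "\<ominus>\<^bsub>F\<^esub> \<zero>\<^bsub>F\<^esub> = \<zero>\<^bsub>F\<^esub>" by (rule F.M.minus_equality) auto
  \<comment> \<open>Relations have coordinates 0, so nothing is subtracted from them.\<close>
  have nullP: "u \<in> P" if "u \<in> null" for u
    using that null_le_ker[OF that] subspaceD(1)[OF null_subspace] by (auto simp: P_def a_minus_def neg0)
  have gen: "free_gen K xs \<in> P" if "xs \<in> tup" for xs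
    using that
  proof (induction "card {j. j < n \<and> xs ! j \<notin> base ` S}" arbitrary: xs rule: less_induct)
    case less
    have len: "length xs = n" using less.prems by (simp add: lists_over_def)
    show ?case
    proof (cases "\<exists>j<n. xs ! j \<notin> base ` S")
      case False
      then have "\<forall>x\<in>set xs. x \<in> base ` S" using len by (auto simp: in_set_conv_nth)
      then have "\<forall>x\<in>set xs. \<exists>s. s \<in> S \<and> x = base s" by blast
      then obtain f where f: "\<And>x. x \<in> set xs \<Longrightarrow> f x \<in> S \<and> x = base (f x)" by metis
      then have "map f xs \<in> L" "xs = map base (map f xs)" using len by (auto simp: lists_over_def intro!: nth_equalityI)
      then have "coord (free_gen K xs) = unit_fun K L (map f xs)" "lift_coord (unit_fun K L (map f xs)) = free_gen K xs"
        using coord_base[of "map f xs"] lift_coord_unit[of "map f xs"] by simp_all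
      then show ?thesis using free_gen_carrier[OF field_K less.prems] subspaceD(2)[OF null_subspace]
        by (simp add: P_def a_minus_def F.M.r_neg)
    next
      case True
      then obtain j where j: "j < n" "xs ! j \<notin> base ` S" by blast
      \<comment> \<open>The vectors that may fill slot \<open>j\<close>.\<close>
      define D where "D = {x \<in> carrier V. free_gen K (xs[j := x]) \<in> P}"
      have g: "free_gen K (xs[j := x]) \<in> carrier F" if "x \<in> carrier V" for x
        by (rule free_gen_carrier[OF field_K tup_update[OF less.prems that]])
      have cancel: "a \<in> P" if "a \<ominus>\<^bsub>F\<^esub> b \<in> P" "b \<in> P" "a \<in> carrier F" for a b
      proof -
        have "b \<in> carrier F" using that(2) Pd(1) by blast
        then have "(a \<ominus>\<^bsub>F\<^esub> b) \<oplus>\<^bsub>F\<^esub> b = a" using that(3) by (simp add: a_minus_def F.M.a_assoc F.M.l_neg)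
        then show ?thesis using Pd(3)[OF that(1,2)] by simp
      qed
      have Dsm: "c \<odot>\<^bsub>V\<^esub> x \<in> D" if c: "c \<in> carrier K" and x: "x \<in> carrier V" "c \<odot>\<^bsub>F\<^esub> free_gen K (xs[j := x]) \<in> P" for c x
        using cancel[OF nullP[OF subsetD[OF rels_null rels_smultI[OF less.prems j(1) c x(1)]]] x(2) g] c x by (simp add: D_def)
      have "subspace K D V"
      proof (rule subspaceI[OF vectorspace_V])
        have "\<zero>\<^bsub>K\<^esub> \<odot>\<^bsub>V\<^esub> \<zero>\<^bsub>V\<^esub> \<in> D" by (rule Dsm) (use g Pd(2) in auto)
        then show "\<zero>\<^bsub>V\<^esub> \<in> D" by simp
        show "x \<oplus>\<^bsub>V\<^esub> y \<in> D" if "x \<in> D" "y \<in> D" for x y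
        proof -
          have xy: "x \<in> carrier V" "y \<in> carrier V" using that by (auto simp: D_def)
          have "free_gen K (xs[j := x]) \<oplus>\<^bsub>F\<^esub> free_gen K (xs[j := y]) \<in> P" using that Pd(3) by (simp add: D_def)
          from cancel[OF nullP[OF subsetD[OF rels_null rels_addI[OF less.prems j(1) xy]]] this g] xy
          show ?thesis by (simp add: D_def)
        qed
        show "c \<odot>\<^bsub>V\<^esub> x \<in> D" if "c \<in> carrier K" "x \<in> D" for c x
          using that Dsm Pd(4) by (simp add: D_def)
      qed (auto simp: D_def)
      moreover have "base s \<in> D" if "s \<in> S" for s
      proof -
        have "{i. i < n \<and> xs[j := base s] ! i \<notin> base ` S} \<subset> {i. i < n \<and> xs ! i \<notin> base ` S}"
        proof (rule psubsetI)
          show "{i. i < n \<and> xs[j := base s] ! i \<notin> base ` S} \<subseteq> {i. i < n \<and> xs ! i \<notin> base ` S}"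
          proof
            fix i assume "i \<in> {i. i < n \<and> xs[j := base s] ! i \<notin> base ` S}"
            then show "i \<in> {i. i < n \<and> xs ! i \<notin> base ` S}" using that len by (cases "i = j") auto
          qed
          have "j \<notin> {i. i < n \<and> xs[j := base s] ! i \<notin> base ` S}" using that len j by simp
          then show "{i. i < n \<and> xs[j := base s] ! i \<notin> base ` S} \<noteq> {i. i < n \<and> xs ! i \<notin> base ` S}" using j by blast
        qed
        then have "card {i. i < n \<and> xs[j := base s] ! i \<notin> base ` S} < card {i. i < n \<and> xs ! i \<notin> base ` S}"
          by (intro psubset_card_mono) auto
        from less.hyps[OF this tup_update[OF less.prems base_carrier]] show ?thesis
          using base_carrier by (simp add: D_def)
      qed
      ultimately have "carrier V \<subseteq> D" by (rule subspace_full)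
      moreover have "xs ! j \<in> carrier V" using less.prems j(1) by (auto simp: lists_over_def)
      ultimately have "xs ! j \<in> D" by blast
      then show ?thesis by (simp add: D_def)
    qed
  qed
  from free_mod_induct[OF field_K P gen assms] show ?thesis by (simp add: P_def)
qed

lemma ker_eq_null: "u \<in> carrier F \<Longrightarrow> coord u = \<zero>\<^bsub>ring.func_space K L\<^esub> \<longleftrightarrow> u \<in> null"
proof
  interpret F: vectorspace K F by (rule vectorspace_F)
  have neg0: "\<ominus>\<^bsub>F\<^esub> \<zero>\<^bsub>F\<^esub> = \<zero>\<^bsub>F\<^esub>" by (rule F.M.minus_equality) auto
  assume u: "u \<in> carrier F" and "coord u = \<zero>\<^bsub>ring.func_space K L\<^esub>"
  then show "u \<in> null" using reduce_mod_null[OF u] linear_mapD(4)[OF lift_coord_linear] by (simp add: a_minus_def neg0)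
qed (rule null_le_ker)

lemma coord_surj: "carrier (ring.func_space K L) \<subseteq> coord ` carrier F"
proof (rule func_space_subspace_full[OF finite_lists_over[OF fin_S]])
  show "subspace K (coord ` carrier F) (ring.func_space K L)"
    by (rule subspace_image[OF coord_linear subspace_carrier[OF vectorspace_F]])
  show "unit_fun K L ts \<in> coord ` carrier F" if "ts \<in> L" for ts
    using coord_base[OF that] free_gen_carrier[OF field_K map_base_tup[OF that]] by (metis image_eqI)
qed

definition fibre :: "('s list \<Rightarrow> 'k) \<Rightarrow> ('v list \<Rightarrow> 'k) set" where
  "fibre c = {u \<in> carrier F. coord u = c}"

lemma fibre_nonempty: "c \<in> carrier (ring.func_space K L) \<Longrightarrow> \<exists>u. u \<in> fibre c"
  using coord_surj by (force simp: fibre_def)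

text \<open>
  The kernel of \<open>coord\<close> is the span of the relations, so two elements are congruent modulo the relations
  exactly if their coordinates agree.
\<close>

lemma coset_eq_fibre:
  assumes u: "u \<in> carrier F"
  shows "null +>\<^bsub>F\<^esub> u = fibre (coord u)"
proof -
  interpret F: vectorspace K F by (rule vectorspace_F)
  interpret W: vectorspace K "ring.func_space K L" by (rule vectorspace_L)
  interpret c: linear_map K F "ring.func_space K L" coord by (rule coord_linear)
  note nc = subspaceD(1)[OF null_subspace]
  show ?thesis
  proof (intro equalityI subsetI)
    fix w assume "w \<in> null +>\<^bsub>F\<^esub> u"
    then obtain h where h: "h \<in> null" "w = h \<oplus>\<^bsub>F\<^esub> u" by (auto simp: a_r_coset_def')
    then have "h \<in> carrier F" using nc by blast
    then show "w \<in> fibre (coord u)" using h u null_le_ker[OF h(1)] by (simp add: fibre_def)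
  next
    fix w assume w: "w \<in> fibre (coord u)"
    then have wc: "w \<in> carrier F" by (simp add: fibre_def)
    have "coord (w \<oplus>\<^bsub>F\<^esub> \<ominus>\<^bsub>F\<^esub> u) = \<zero>\<^bsub>ring.func_space K L\<^esub>"
      using w u by (simp add: fibre_def W.M.r_neg)
    then have "w \<oplus>\<^bsub>F\<^esub> \<ominus>\<^bsub>F\<^esub> u \<in> null" using ker_eq_null[of "w \<oplus>\<^bsub>F\<^esub> \<ominus>\<^bsub>F\<^esub> u"] wc u by simp
    moreover have "w = (w \<oplus>\<^bsub>F\<^esub> \<ominus>\<^bsub>F\<^esub> u) \<oplus>\<^bsub>F\<^esub> u" using wc u by (simp add: F.M.a_assoc F.M.l_neg)
    ultimately show "w \<in> null +>\<^bsub>F\<^esub> u" unfolding a_r_coset_def' by blast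
  qed
qed

lemma fibre_add:
  assumes "c \<in> carrier (ring.func_space K L)" "d \<in> carrier (ring.func_space K L)"
  shows "fibre c <+>\<^bsub>F\<^esub> fibre d = fibre (c \<oplus>\<^bsub>ring.func_space K L\<^esub> d)"
proof -
  interpret F: vectorspace K F by (rule vectorspace_F)
  interpret W: vectorspace K "ring.func_space K L" by (rule vectorspace_L)
  interpret h: linear_map K F "ring.func_space K L" coord by (rule coord_linear)
  obtain u where u: "u \<in> fibre c" using fibre_nonempty assms(1) by blast
  show ?thesis
  proof (intro equalityI subsetI)
    fix w assume "w \<in> fibre c <+>\<^bsub>F\<^esub> fibre d"
    then show "w \<in> fibre (c \<oplus>\<^bsub>ring.func_space K L\<^esub> d)" by (auto elim!: set_addE simp: fibre_def)
  next
    fix w assume w: "w \<in> fibre (c \<oplus>\<^bsub>ring.func_space K L\<^esub> d)"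
    have uw: "u \<in> carrier F" "w \<in> carrier F" using u w by (auto simp: fibre_def)
    have "\<ominus>\<^bsub>F\<^esub> u \<oplus>\<^bsub>F\<^esub> w \<in> fibre d" using u w assms by (simp add: fibre_def W.M.r_neg1)
    moreover have "w = u \<oplus>\<^bsub>F\<^esub> (\<ominus>\<^bsub>F\<^esub> u \<oplus>\<^bsub>F\<^esub> w)" using uw by (simp add: F.M.r_neg2)
    ultimately show "w \<in> fibre c <+>\<^bsub>F\<^esub> fibre d" using u set_addI by metis
  qed
qed

lemma tensor_space_simps:
  "carrier (tensor_space K (replicate n V)) = (\<lambda>u. null +>\<^bsub>F\<^esub> u) ` carrier F"
  "Y \<oplus>\<^bsub>tensor_space K (replicate n V)\<^esub> Z = Y <+>\<^bsub>F\<^esub> Z"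
  "a \<odot>\<^bsub>tensor_space K (replicate n V)\<^esub> Y = (\<Union>x\<in>Y. null +>\<^bsub>F\<^esub> (a \<odot>\<^bsub>F\<^esub> x))"
  "\<zero>\<^bsub>tensor_space K (replicate n V)\<^esub> = null"
  by (auto simp: tensor_space_def quot_mod_def tuples_replicate A_RCOSETS_def')

lemma fibre_iso: "linear_iso K (ring.func_space K L) (tensor_space K (replicate n V)) fibre"
proof (rule linear_iso_transport[OF vectorspace_L])
  interpret F: vectorspace K F by (rule vectorspace_F)
  interpret h: linear_map K F "ring.func_space K L" coord by (rule coord_linear)
  show "bij_betw fibre (carrier (ring.func_space K L)) (carrier (tensor_space K (replicate n V)))"
  proof (rule bij_betwI')
    fix c d assume c: "c \<in> carrier (ring.func_space K L)" and d: "d \<in> carrier (ring.func_space K L)"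
    from fibre_nonempty[OF c] obtain u where "u \<in> fibre c" ..
    then show "fibre c = fibre d \<longleftrightarrow> c = d" by (auto simp: fibre_def)
  next
    fix c assume "c \<in> carrier (ring.func_space K L)"
    from fibre_nonempty[OF this] obtain u where "u \<in> fibre c" ..
    then have "u \<in> carrier F" "fibre c = null +>\<^bsub>F\<^esub> u" using coset_eq_fibre[of u] by (auto simp: fibre_def)
    then show "fibre c \<in> carrier (tensor_space K (replicate n V))" by (simp add: tensor_space_simps)
  next
    fix Y assume "Y \<in> carrier (tensor_space K (replicate n V))"
    then obtain u where "u \<in> carrier F" "Y = null +>\<^bsub>F\<^esub> u" by (auto simp: tensor_space_simps)
    then show "\<exists>c\<in>carrier (ring.func_space K L). Y = fibre c" using coset_eq_fibre[of u] h.f_im by auto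
  qed
  show "fibre (c \<oplus>\<^bsub>ring.func_space K L\<^esub> d) = fibre c \<oplus>\<^bsub>tensor_space K (replicate n V)\<^esub> fibre d"
    if "c \<in> carrier (ring.func_space K L)" "d \<in> carrier (ring.func_space K L)" for c d
    using fibre_add[OF that] by (simp add: tensor_space_simps)
  show "fibre (a \<odot>\<^bsub>ring.func_space K L\<^esub> c) = a \<odot>\<^bsub>tensor_space K (replicate n V)\<^esub> fibre c"
    if a: "a \<in> carrier K" and c: "c \<in> carrier (ring.func_space K L)" for a c
  proof -
    have "null +>\<^bsub>F\<^esub> (a \<odot>\<^bsub>F\<^esub> u) = fibre (a \<odot>\<^bsub>ring.func_space K L\<^esub> c)" if "u \<in> fibre c" for u
      using that a coset_eq_fibre[of "a \<odot>\<^bsub>F\<^esub> u"] by (simp add: fibre_def)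
    then show ?thesis using fibre_nonempty[OF c] by (auto simp: tensor_space_simps)
  qed
  show "fibre \<zero>\<^bsub>ring.func_space K L\<^esub> = \<zero>\<^bsub>tensor_space K (replicate n V)\<^esub>"
    using ker_eq_null subspaceD(1)[OF null_subspace] by (auto simp: tensor_space_simps fibre_def)
qed

end

lemma tensor_power_dim:
  fixes V :: "('k, 'v) module"
  assumes V: "vectorspace K V" and fd: "vectorspace.fin_dim K V"
  shows "vectorspace.dim K (tensor_space K (replicate n V)) = vectorspace.dim K V ^ n"
    and "vectorspace.fin_dim K (tensor_space K (replicate n V))"
    and "vectorspace K (tensor_space K (replicate n V))"
proof -
  obtain B :: "'v set" and \<phi> where B: "finite B" "linear_iso K V (ring.func_space K B) \<phi>"
    using coordinates_exist[OF V fd] by blast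
  interpret t: tensor_coordinates K V B \<phi> n by unfold_locales (use B in auto)
  note K = t.field_K
  note L = finite_lists_over[OF B(1), of n]
  note iso = t.fibre_iso
  note F = func_space_basis[OF K L] and FB = func_space_basis[OF K B(1)]
  show "vectorspace.fin_dim K (tensor_space K (replicate n V))" by (rule linear_iso_dim(2)[OF iso F(3)])
  show "vectorspace K (tensor_space K (replicate n V))" using iso by (auto simp: linear_iso_def linear_map_def)
  have "vectorspace.dim K V = card B" using linear_iso_dim(1)[OF B(2) fd] FB(2) by simp
  then show "vectorspace.dim K (tensor_space K (replicate n V)) = vectorspace.dim K V ^ n"
    using linear_iso_dim(1)[OF iso F(3)] F(2) card_lists_over[OF B(1)] by simp
qed

text \<open>
  If \<open>f\<close> copies the coordinates in \<open>T1\<close> and kills the others, then so does its tensor power with the words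
  over \<open>T1\<close>. The second conjunct makes the induction go through.
\<close>

lemma coord_prod_map:
  assumes K: "field K" and fc: "\<And>x t. x \<in> A \<Longrightarrow> t \<in> T \<Longrightarrow> \<psi> (f x) t = (if t \<in> T1 then \<phi> x t else \<zero>\<^bsub>K\<^esub>)"
    and closed: "\<And>x t. x \<in> A \<Longrightarrow> t \<in> T1 \<Longrightarrow> \<phi> x t \<in> carrier K" and "T1 \<subseteq> T"
    and "length xs = length ts" "set xs \<subseteq> A" "set ts \<subseteq> T"
  shows "coord_prod K \<psi> (map f xs) ts = (if set ts \<subseteq> T1 then coord_prod K \<phi> xs ts else \<zero>\<^bsub>K\<^esub>)
    \<and> (set ts \<subseteq> T1 \<longrightarrow> coord_prod K \<phi> xs ts \<in> carrier K)"
  using assms(5-7)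
proof (induction xs arbitrary: ts)
  case Nil
  interpret field K by (rule K)
  show ?case using Nil by simp
next
  case (Cons x xs)
  interpret field K by (rule K)
  from Cons.prems obtain t ts' where ts: "ts = t # ts'" by (cases ts) auto
  then show ?case using Cons.prems Cons.IH[of ts'] fc[of x t] closed[of x t] by (auto split: if_splits)
qed

text \<open>
  By the normal form, \<open>f\<close> copies \<open>rank f\<close> coordinates and kills the others; on words of length \<open>n\<close> this
  leaves \<open>(rank f)\<^sup>n\<close> copied coordinates.
\<close>

lemma tensor_map_linear_rank:
  fixes V W :: "('k, 'v) module"
  assumes f: "linear_map K V W f" and fdV: "vectorspace.fin_dim K V" and fdW: "vectorspace.fin_dim K W"
  shows "linear_map K (tensor_space K (replicate n V)) (tensor_space K (replicate n W))
      (tensor_map K (replicate n W) (replicate n f))"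
    and "rank K (tensor_space K (replicate n V)) (tensor_space K (replicate n W))
      (tensor_map K (replicate n W) (replicate n f)) = rank K V W f ^ n"
proof -
  obtain S T T1 :: "('v + 'v) set" and \<phi> \<psi> where *: "finite S" "finite T" "T1 \<subseteq> S \<inter> T"
    "linear_iso K V (ring.func_space K S) \<phi>" "linear_iso K W (ring.func_space K T) \<psi>"
    "\<And>x t. x \<in> carrier V \<Longrightarrow> t \<in> T \<Longrightarrow> \<psi> (f x) t = (if t \<in> T1 then \<phi> x t else \<zero>\<^bsub>K\<^esub>)"
    using linear_map_normal_form[OF assms] by blast
  interpret v: tensor_coordinates K V S \<phi> n by unfold_locales (use * in auto)
  interpret w: tensor_coordinates K W T \<psi> n by unfold_locales (use * in auto)
  note K = v.field_K
  interpret field K by (rule K)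
  note fs = func_space_simps[OF K]
  let ?T1 = "lists_over n T1"
  \<comment> \<open>The tensor power of \<open>f\<close> in coordinates.\<close>
  define \<Theta> where "\<Theta> = (\<lambda>c. \<lambda>t\<in>w.L. if t \<in> ?T1 then c t else \<zero>\<^bsub>K\<^esub>)"
  have sub: "?T1 \<subseteq> v.L \<inter> w.L" using *(3) by (auto simp: lists_over_def)
  have \<Theta>: "linear_map K (func_space v.L) (func_space w.L) \<Theta>"
    unfolding \<Theta>_def by (rule func_space_restrict_map[OF K sub])
  have ftup: "map f xs \<in> w.tup" if "xs \<in> v.tup" for xs
    using that linear_mapD(1)[OF f] by (auto simp: lists_over_def)
  let ?g = "\<lambda>xs. free_gen K (map f xs)"
  have gmem: "?g xs \<in> carrier w.F" if "xs \<in> v.tup" for xs by (rule free_gen_carrier[OF K ftup[OF that]])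
  note push = free_ext_linear[OF w.vectorspace_F gmem]
  have push2: "free_ext K w.F ?g (free_gen K xs) = free_gen K (map f xs)" if "xs \<in> v.tup" for xs
    by (rule free_ext_linear(2)[where G = v.tup, OF w.vectorspace_F gmem that])
  have comm: "w.coord (free_ext K w.F ?g u) = \<Theta> (v.coord u)" if "u \<in> carrier v.F" for u
  proof (rule linear_map_free_mod_eq[OF K _ _ _ that])
    show "linear_map K v.F (func_space w.L) (\<lambda>u. w.coord (free_ext K w.F ?g u))"
      by (rule linear_map_comp[OF push(1) w.coord_linear])
    show "linear_map K v.F (func_space w.L) (\<lambda>u. \<Theta> (v.coord u))"
      by (rule linear_map_comp[OF v.coord_linear \<Theta>])
    fix xs assume xs: "xs \<in> v.tup"
    show "w.coord (free_ext K w.F ?g (free_gen K xs)) = \<Theta> (v.coord (free_gen K xs))"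
      unfolding push2[OF xs] v.coord_gen[OF xs] w.coord_gen[OF ftup[OF xs]] \<Theta>_def
    proof (rule restrict_ext)
      fix t assume t: "t \<in> w.L"
      have "coord_prod K \<psi> (map f xs) t = (if set t \<subseteq> T1 then coord_prod K \<phi> xs t else \<zero>\<^bsub>K\<^esub>)"
        by (rule coord_prod_map[where A = "carrier V" and T = T, THEN conjunct1])
          (use K *(3,6) v.phi_closed xs t in \<open>auto simp: lists_over_def\<close>)
      then show "coord_prod K \<psi> (map f xs) t = (if t \<in> ?T1 then (\<lambda>ts\<in>v.L. coord_prod K \<phi> xs ts) t else \<zero>\<^bsub>K\<^esub>)"
        using t sub by (auto simp: lists_over_def)
    qed
  qed
  have map2: "map2 (\<lambda>f x. f x) (replicate n f) xs = map f xs" if "xs \<in> v.tup" for xs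
    using that by (intro nth_equalityI) (auto simp: lists_over_def)
  have tm: "tensor_map K (replicate n W) (replicate n f) (v.fibre c) = w.fibre (\<Theta> c)"
    if c: "c \<in> carrier (func_space v.L)" for c
  proof -
    interpret WF: vectorspace K w.F by (rule w.vectorspace_F)
    have "w.null +>\<^bsub>w.F\<^esub> (\<Oplus>\<^bsub>w.F\<^esub> s\<in>{s. u s \<noteq> \<zero>\<^bsub>K\<^esub>}. u s \<odot>\<^bsub>w.F\<^esub> free_gen K (map2 (\<lambda>f x. f x) (replicate n f) s)) = w.fibre (\<Theta> c)"
      if u: "u \<in> v.fibre c" for u
    proof -
      have uF: "u \<in> carrier v.F" "v.coord u = c" using u by (auto simp: v.fibre_def)
      have "(\<Oplus>\<^bsub>w.F\<^esub> s\<in>{s. u s \<noteq> \<zero>\<^bsub>K\<^esub>}. u s \<odot>\<^bsub>w.F\<^esub> free_gen K (map2 (\<lambda>f x. f x) (replicate n f) s)) = free_ext K w.F ?g u"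
        unfolding free_ext_def
      proof (rule WF.M.finsum_cong'[OF refl])
        fix s assume "s \<in> {s. u s \<noteq> \<zero>\<^bsub>K\<^esub>}"
        then have "s \<in> v.tup" using free_mod_support[OF uF(1)] by blast
        then show "u s \<odot>\<^bsub>w.F\<^esub> free_gen K (map2 (\<lambda>f x. f x) (replicate n f) s) = u s \<odot>\<^bsub>w.F\<^esub> free_gen K (map f s)"
          by (simp only: map2)
      next
        show "(\<lambda>s. u s \<odot>\<^bsub>w.F\<^esub> free_gen K (map f s)) \<in> {s. u s \<noteq> \<zero>\<^bsub>K\<^esub>} \<rightarrow> carrier w.F"
          using free_mod_support[OF uF(1)] gmem free_mod_value[OF K uF(1)] by (auto intro!: WF.smult_closed)
      qed
      moreover have "free_ext K w.F ?g u \<in> carrier w.F" by (rule linear_mapD(1)[OF push(1) uF(1)])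
      ultimately show ?thesis using w.coset_eq_fibre comm[OF uF(1)] uF(2) by simp
    qed
    then show ?thesis unfolding tensor_map_def Let_def tuples_replicate using v.fibre_nonempty[OF c] by auto
  qed
  show lin: "linear_map K (tensor_space K (replicate n V)) (tensor_space K (replicate n W))
      (tensor_map K (replicate n W) (replicate n f))"
    by (rule linear_map_conj[where \<phi> = v.fibre and \<psi> = w.fibre, OF \<Theta> v.fibre_iso w.fibre_iso]) (rule tm)
  have "rank K (tensor_space K (replicate n V)) (tensor_space K (replicate n W))
      (tensor_map K (replicate n W) (replicate n f)) = rank K (func_space v.L) (func_space w.L) \<Theta>"
    by (rule rank_iso[where \<phi> = v.fibre and \<psi> = w.fibre, OF \<Theta> lin v.fibre_iso w.fibre_iso])
      (use tm func_space_basis(3)[OF K finite_lists_over[OF *(1)]] in auto)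
  also have "\<dots> = card T1 ^ n"
    unfolding \<Theta>_def using rank_func_space_restrict[OF K finite_lists_over[OF *(2)] sub] card_lists_over[of T1 n] *(2,3)
    by (metis finite_subset le_inf_iff)
  also have "card T1 = rank K V W f"
  proof -
    let ?h = "\<lambda>c. \<lambda>t\<in>T. if t \<in> T1 then c t else \<zero>\<^bsub>K\<^esub>"
    have h: "linear_map K (func_space S) (func_space T) ?h" by (rule func_space_restrict_map[OF K *(3)])
    have "\<psi> (f x) = ?h (\<phi> x)" if x: "x \<in> carrier V" for x
    proof (rule PiE_ext)
      show "\<psi> (f x) \<in> T \<rightarrow>\<^sub>E carrier K" using linear_mapD(1)[OF w.coords_linear linear_mapD(1)[OF f x]] by (simp add: fs)
      show "?h (\<phi> x) \<in> T \<rightarrow>\<^sub>E carrier K" using linear_mapD(1)[OF h linear_mapD(1)[OF v.coords_linear x]] by (simp only: fs)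
    qed (use *(6)[OF x] in auto)
    from rank_iso[where \<phi> = \<phi> and \<psi> = \<psi>, OF f h *(4,5) this fdV] show ?thesis
      unfolding rank_func_space_restrict[OF K *(2,3)] .
  qed
  finally show "rank K (tensor_space K (replicate n V)) (tensor_space K (replicate n W))
      (tensor_map K (replicate n W) (replicate n f)) = rank K V W f ^ n" .
qed

section \<open>Flags and compatible splittings\<close>

text \<open>
  Both trivial subspaces belong to a flag. The whole space makes the two parts of a compatible splitting
  span it, and the zero space makes a splitting of the source of a map compatible with the kernel, which
  is the preimage of 0.
\<close>

definition flag where
  "flag K V \<F> \<longleftrightarrow> finite \<F> \<and> (\<forall>F\<in>\<F>. subspace K F V) \<and> (\<forall>F\<in>\<F>. \<forall>G\<in>\<F>. F \<subseteq> G \<or> G \<subseteq> F)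
    \<and> {\<zero>\<^bsub>V\<^esub>} \<in> \<F> \<and> carrier V \<in> \<F>"

definition compatible_splitting where
  "compatible_splitting K V \<F> A B \<longleftrightarrow> subspace K A V \<and> subspace K B V \<and> A \<inter> B = {\<zero>\<^bsub>V\<^esub>}
    \<and> (\<forall>F\<in>\<F>. F \<subseteq> (F \<inter> A) <+>\<^bsub>V\<^esub> (F \<inter> B))"

lemma flagD:
  assumes "flag K V \<F>"
  shows "finite \<F>" "\<And>F. F \<in> \<F> \<Longrightarrow> subspace K F V" "\<And>F G. F \<in> \<F> \<Longrightarrow> G \<in> \<F> \<Longrightarrow> F \<subseteq> G \<or> G \<subseteq> F"
    "{\<zero>\<^bsub>V\<^esub>} \<in> \<F>" "carrier V \<in> \<F>" "vectorspace K V"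
  using assms subspaceD(7)[of K "carrier V" V] unfolding flag_def by auto

lemma flag_trivial: "vectorspace K V \<Longrightarrow> flag K V {{\<zero>\<^bsub>V\<^esub>}, carrier V}"
  using subspace_zero[of K V] subspace_carrier[of K V] subspaceD(1)[OF subspace_zero, of K V] unfolding flag_def by auto

lemma flag_image:
  assumes f: "linear_map K V W f" and \<F>: "flag K V \<F>"
  shows "flag K W (insert (carrier W) ((`) f ` \<F>))"
proof -
  note F = flagD[OF \<F>]
  have im: "subspace K (f ` G) W" if "G \<in> \<F>" for G by (rule subspace_image[OF f F(2)[OF that]])
  have "f ` {\<zero>\<^bsub>V\<^esub>} = {\<zero>\<^bsub>W\<^esub>}" using linear_mapD(4)[OF f] by simp
  then have "{\<zero>\<^bsub>W\<^esub>} \<in> (`) f ` \<F>" using F(4) by (metis image_eqI)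
  moreover have "f ` G \<subseteq> carrier W" if "G \<in> \<F>" for G using subspaceD(1)[OF im[OF that]] .
  moreover have "f ` G \<subseteq> f ` H \<or> f ` H \<subseteq> f ` G" if "G \<in> \<F>" "H \<in> \<F>" for G H using F(3)[OF that] by blast
  ultimately show ?thesis using F(1) im subspace_carrier[OF linear_mapD(6)[OF f]] unfolding flag_def by auto
qed

lemma flag_vimage:
  assumes f: "linear_map K W V f" and \<F>: "flag K V \<F>"
  shows "flag K W (insert {\<zero>\<^bsub>W\<^esub>} ((\<lambda>F. {x \<in> carrier W. f x \<in> F}) ` \<F>))"
proof -
  note F = flagD[OF \<F>]
  have im: "subspace K {x \<in> carrier W. f x \<in> G} W" if "G \<in> \<F>" for G by (rule subspace_vimage[OF f F(2)[OF that]])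
  have "carrier W = {x \<in> carrier W. f x \<in> carrier V}" using linear_mapD(1)[OF f] by auto
  then have "carrier W \<in> (\<lambda>F. {x \<in> carrier W. f x \<in> F}) ` \<F>" by (rule image_eqI) (rule F(5))
  moreover have "{\<zero>\<^bsub>W\<^esub>} \<subseteq> {x \<in> carrier W. f x \<in> G}" if "G \<in> \<F>" for G using subspaceD(2)[OF im[OF that]] by blast
  moreover have "{x \<in> carrier W. f x \<in> G} \<subseteq> {x \<in> carrier W. f x \<in> H} \<or> {x \<in> carrier W. f x \<in> H} \<subseteq> {x \<in> carrier W. f x \<in> G}"
    if "G \<in> \<F>" "H \<in> \<F>" for G H using F(3)[OF that] by blast
  ultimately show ?thesis using F(1) im subspace_zero[OF linear_mapD(5)[OF f]] unfolding flag_def by auto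
qed

text \<open>
  All of the kernel is put into \<open>B\<close>, which becomes the full preimage of \<open>B'\<close>; then \<open>A\<close> only has to be a
  complement of the kernel inside the preimage of \<open>A'\<close>, and \<open>f\<close> is injective on it. Taking this complement
  compatible with the flag makes the splitting compatible.
\<close>

lemma compatible_splitting_pull_back:
  assumes f: "linear_map K V W f" and \<F>: "flag K V \<F>"
    and AB: "compatible_splitting K W (insert (carrier W) ((`) f ` \<F>)) A' B'"
  obtains A B where "compatible_splitting K V \<F> A B" "f ` A \<subseteq> A'" "f ` B \<subseteq> B'" "inj_on f A"
proof -
  note F = flagD[OF \<F>] and fD = linear_mapD[OF f]
  interpret V: vectorspace K V by (rule fD)
  interpret W: vectorspace K W by (rule fD)
  interpret f: linear_map K V W f by (rule f)
  have A': "subspace K A' W" and B': "subspace K B' W" and dis: "A' \<inter> B' = {\<zero>\<^bsub>W\<^esub>}"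
    and cmp: "\<And>G. G \<in> \<F> \<Longrightarrow> f ` G \<subseteq> (f ` G \<inter> A') <+>\<^bsub>W\<^esub> (f ` G \<inter> B')"
    using AB by (auto simp: compatible_splitting_def)
  define P where "P = {x \<in> carrier V. f x \<in> A'}"
  define B where "B = {x \<in> carrier V. f x \<in> B'}"
  define N where "N = {x \<in> carrier V. f x \<in> {\<zero>\<^bsub>W\<^esub>}}"
  have P: "subspace K P V" and B: "subspace K B V" and N: "subspace K N V"
    unfolding P_def B_def N_def by (rule subspace_vimage[OF f] A' B' subspace_zero[OF fD(6)])+
  note PD = subspaceD[OF P] and BD = subspaceD[OF B] and ND = subspaceD[OF N]
  let ?\<G> = "(\<lambda>F. F \<inter> P) ` \<F>"
  have "finite ?\<G>" "\<And>G. G \<in> ?\<G> \<Longrightarrow> subspace K G V" "\<And>G H. G \<in> ?\<G> \<Longrightarrow> H \<in> ?\<G> \<Longrightarrow> G \<subseteq> H \<or> H \<subseteq> G"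
    using F(1) subspace_Int[OF F(2) P] F(3) by (auto simp: subset_iff)
  from chain_complement_exists[OF N this] obtain A where A: "subspace K A V" "A \<inter> N = {\<zero>\<^bsub>V\<^esub>}"
    "A \<subseteq> insert \<zero>\<^bsub>V\<^esub> (\<Union>?\<G>)" "\<And>G. G \<in> ?\<G> \<Longrightarrow> G \<subseteq> (G \<inter> A) <+>\<^bsub>V\<^esub> (G \<inter> N)" by metis
  note AD = subspaceD[OF A(1)]
  have AP: "A \<subseteq> P" using A(3) PD(2) by blast
  have NB: "N \<subseteq> B" using subspaceD(2)[OF B'] by (auto simp: N_def B_def)
  show ?thesis
  proof (rule that[of A B])
    show "f ` A \<subseteq> A'" using AP by (auto simp: P_def)
    show "f ` B \<subseteq> B'" by (auto simp: B_def)
    show "inj_on f A"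
    proof (rule inj_onI)
      fix x y assume xy: "x \<in> A" "y \<in> A" "f x = f y"
      then have c: "x \<in> carrier V" "y \<in> carrier V" using AD(1) by auto
      have "x \<ominus>\<^bsub>V\<^esub> y \<in> N" using c xy(3) by (simp add: N_def a_minus_def W.M.r_neg)
      then have "x \<ominus>\<^bsub>V\<^esub> y = \<zero>\<^bsub>V\<^esub>" using A(2) AD(6)[OF xy(1,2)] by blast
      then have "x \<oplus>\<^bsub>V\<^esub> \<ominus>\<^bsub>V\<^esub> y = y \<oplus>\<^bsub>V\<^esub> \<ominus>\<^bsub>V\<^esub> y" using c by (simp add: a_minus_def V.M.r_neg)
      then show "x = y" using c by (simp add: V.M.add.right_cancel)
    qed
    show "compatible_splitting K V \<F> A B"
      unfolding compatible_splitting_def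
    proof (intro conjI ballI)
      show "A \<inter> B = {\<zero>\<^bsub>V\<^esub>}"
      proof
        show "A \<inter> B \<subseteq> {\<zero>\<^bsub>V\<^esub>}"
        proof
          fix x assume x: "x \<in> A \<inter> B"
          then have "f x \<in> A' \<inter> B'" using AP by (auto simp: P_def B_def)
          then have "x \<in> N" using dis x AD(1) by (auto simp: N_def)
          then show "x \<in> {\<zero>\<^bsub>V\<^esub>}" using A(2) x by blast
        qed
        show "{\<zero>\<^bsub>V\<^esub>} \<subseteq> A \<inter> B" using AD(2) BD(2) by blast
      qed
      fix G assume G: "G \<in> \<F>"
      note GD = subspaceD[OF F(2)[OF G]]
      show "G \<subseteq> (G \<inter> A) <+>\<^bsub>V\<^esub> (G \<inter> B)"
      proof
        fix x assume x: "x \<in> G"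
        then have "f x \<in> (f ` G \<inter> A') <+>\<^bsub>W\<^esub> (f ` G \<inter> B')" using cmp[OF G] by blast
        then obtain y z where yz: "y \<in> G" "f y \<in> A'" "z \<in> G" "f z \<in> B'" "f x = f y \<oplus>\<^bsub>W\<^esub> f z"
          by (auto elim!: set_addE)
        have c: "x \<in> carrier V" "y \<in> carrier V" "z \<in> carrier V" using x yz GD(1) by auto
        have "y \<in> G \<inter> P" using yz c by (simp add: P_def)
        then have "y \<in> (G \<inter> P \<inter> A) <+>\<^bsub>V\<^esub> (G \<inter> P \<inter> N)" using A(4)[of "G \<inter> P"] G by blast
        then obtain a m where am: "a \<in> G" "a \<in> A" "m \<in> G" "m \<in> N" "y = a \<oplus>\<^bsub>V\<^esub> m" by (auto elim!: set_addE)
        have ac: "a \<in> carrier V" "m \<in> carrier V" using am AD(1) ND(1) by auto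
        let ?b = "\<ominus>\<^bsub>V\<^esub> a \<oplus>\<^bsub>V\<^esub> x"
        have "f m = \<zero>\<^bsub>W\<^esub>" using am(4) by (simp add: N_def)
        then have "f x = f a \<oplus>\<^bsub>W\<^esub> f z" using yz(5) am(5) ac c by simp
        then have "f ?b = f z" using ac c by (simp add: W.M.r_neg1)
        then have "?b \<in> G \<inter> B" using yz(4) ac c GD(3,5) am(1) x by (simp add: B_def)
        moreover have "x = a \<oplus>\<^bsub>V\<^esub> ?b" using ac c by (simp add: V.M.r_neg2)
        ultimately show "x \<in> (G \<inter> A) <+>\<^bsub>V\<^esub> (G \<inter> B)" using am(1,2) by (metis IntI set_addI)
      qed
    qed (rule A B)+
  qed
qed

text \<open>
  The first part is just the image of \<open>A'\<close>; the second absorbs a complement of the whole image that is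
  compatible with the flag. The images of \<open>A'\<close> and \<open>B'\<close> meet trivially because the kernel, as a member of the
  flag on the source, is itself split by \<open>A'\<close> and \<open>B'\<close>.
\<close>

lemma compatible_splitting_push_forward:
  assumes f: "linear_map K W V f" and \<F>: "flag K V \<F>"
    and AB: "compatible_splitting K W (insert {\<zero>\<^bsub>W\<^esub>} ((\<lambda>F. {x \<in> carrier W. f x \<in> F}) ` \<F>)) A' B'"
  obtains B where "compatible_splitting K V \<F> (f ` A') B" "f ` B' \<subseteq> B"
proof -
  note F = flagD[OF \<F>] and fD = linear_mapD[OF f]
  interpret V: vectorspace K V by (rule fD)
  interpret W: vectorspace K W by (rule fD)
  interpret f: linear_map K W V f by (rule f)
  have A': "subspace K A' W" and B': "subspace K B' W" and dis: "A' \<inter> B' = {\<zero>\<^bsub>W\<^esub>}"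
    and cmp: "\<And>G. G \<in> \<F> \<Longrightarrow> {x \<in> carrier W. f x \<in> G} \<subseteq> ({x \<in> carrier W. f x \<in> G} \<inter> A') <+>\<^bsub>W\<^esub> ({x \<in> carrier W. f x \<in> G} \<inter> B')"
    using AB by (auto simp: compatible_splitting_def)
  note A'D = subspaceD[OF A'] and B'D = subspaceD[OF B']
  define J where "J = f ` carrier W"
  have J: "subspace K J V" unfolding J_def by (rule subspace_image[OF f subspace_carrier[OF fD(5)]])
  note JD = subspaceD[OF J]
  from chain_complement_exists[OF J F(1-3)] obtain Z where Z: "subspace K Z V" "Z \<inter> J = {\<zero>\<^bsub>V\<^esub>}"
    "\<And>G. G \<in> \<F> \<Longrightarrow> G \<subseteq> (G \<inter> Z) <+>\<^bsub>V\<^esub> (G \<inter> J)" by metis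
  note ZD = subspaceD[OF Z(1)]
  have fA: "subspace K (f ` A') V" and fB: "subspace K (f ` B') V" by (rule subspace_image[OF f] A' B')+
  note fAD = subspaceD[OF fA] and fBD = subspaceD[OF fB]
  define B where "B = (f ` B') <+>\<^bsub>V\<^esub> Z"
  have B: "subspace K B V" unfolding B_def by (rule subspace_sum[OF fB Z(1)])
  have zero: "f a = \<zero>\<^bsub>V\<^esub>" if ab: "a \<in> A'" "b \<in> B'" "f a = f b" for a b
  proof -
    have c: "a \<in> carrier W" "b \<in> carrier W" using ab A'D(1) B'D(1) by auto
    have "a \<ominus>\<^bsub>W\<^esub> b \<in> {x \<in> carrier W. f x \<in> {\<zero>\<^bsub>V\<^esub>}}" using c ab(3) by (simp add: a_minus_def V.M.r_neg)
    then have "a \<ominus>\<^bsub>W\<^esub> b \<in> ({x \<in> carrier W. f x \<in> {\<zero>\<^bsub>V\<^esub>}} \<inter> A') <+>\<^bsub>W\<^esub> ({x \<in> carrier W. f x \<in> {\<zero>\<^bsub>V\<^esub>}} \<inter> B')"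
      using cmp[OF F(4)] by blast
    then obtain a' b' where a'b': "a' \<in> A'" "f a' = \<zero>\<^bsub>V\<^esub>" "b' \<in> B'" "a \<ominus>\<^bsub>W\<^esub> b = a' \<oplus>\<^bsub>W\<^esub> b'" by (auto elim!: set_addE)
    have "a \<oplus>\<^bsub>W\<^esub> (\<ominus>\<^bsub>W\<^esub> b) = a' \<oplus>\<^bsub>W\<^esub> b'" using a'b'(4) by (simp add: a_minus_def)
    from complement_decomposition_unique(1)[OF A' B' dis ab(1) a'b'(1) B'D(5)[OF ab(2)] a'b'(3) this] a'b'(2)
    show ?thesis by simp
  qed
  show ?thesis
  proof (rule that[of B])
    show "f ` B' \<subseteq> B" unfolding B_def by (rule set_add_upper(1)[OF fB Z(1)])
    show "compatible_splitting K V \<F> (f ` A') B"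
      unfolding compatible_splitting_def
    proof (intro conjI ballI)
      show "f ` A' \<inter> B = {\<zero>\<^bsub>V\<^esub>}"
      proof
        show "{\<zero>\<^bsub>V\<^esub>} \<subseteq> f ` A' \<inter> B" using fAD(2) subspaceD(2)[OF B] by blast
        show "f ` A' \<inter> B \<subseteq> {\<zero>\<^bsub>V\<^esub>}"
        proof
          fix x assume "x \<in> f ` A' \<inter> B"
          then obtain a where a: "a \<in> A'" "x = f a" "f a \<in> (f ` B') <+>\<^bsub>V\<^esub> Z" by (auto simp: B_def)
          from a(3) obtain y z where "y \<in> f ` B'" "z \<in> Z" "f a = y \<oplus>\<^bsub>V\<^esub> z" by (rule set_addE)
          then obtain b where abz: "a \<in> A'" "x = f a" "b \<in> B'" "z \<in> Z" "f a = f b \<oplus>\<^bsub>V\<^esub> z" using a by auto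
          have c: "a \<in> carrier W" "b \<in> carrier W" "z \<in> carrier V" using abz A'D(1) B'D(1) ZD(1) by auto
          have "z = f (\<ominus>\<^bsub>W\<^esub> b \<oplus>\<^bsub>W\<^esub> a)" using abz(5) c by (simp add: V.M.r_neg1)
          then have "z \<in> J" unfolding J_def by (rule image_eqI) (use c in simp)
          then have "z = \<zero>\<^bsub>V\<^esub>" using Z(2) abz(4) by blast
          then have "f a = f b" using abz(5) c by simp
          then show "x \<in> {\<zero>\<^bsub>V\<^esub>}" using zero[OF abz(1,3)] abz(2) by simp
        qed
      qed
      fix G assume G: "G \<in> \<F>"
      note GD = subspaceD[OF F(2)[OF G]]
      show "G \<subseteq> (G \<inter> f ` A') <+>\<^bsub>V\<^esub> (G \<inter> B)"
      proof
        fix x assume x: "x \<in> G"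
        then have "x \<in> (G \<inter> Z) <+>\<^bsub>V\<^esub> (G \<inter> J)" using Z(3)[OF G] by blast
        then obtain z w where zw: "z \<in> G" "z \<in> Z" "w \<in> carrier W" "f w \<in> G" "x = z \<oplus>\<^bsub>V\<^esub> f w" by (auto simp: J_def elim!: set_addE)
        then have "w \<in> ({x \<in> carrier W. f x \<in> G} \<inter> A') <+>\<^bsub>W\<^esub> ({x \<in> carrier W. f x \<in> G} \<inter> B')" using cmp[OF G] by blast
        then obtain a b where ab: "a \<in> A'" "f a \<in> G" "b \<in> B'" "f b \<in> G" "w = a \<oplus>\<^bsub>W\<^esub> b" by (auto elim!: set_addE)
        have c: "a \<in> carrier W" "b \<in> carrier W" "z \<in> carrier V" using ab zw A'D(1) B'D(1) ZD(1) by auto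
        have "x = f a \<oplus>\<^bsub>V\<^esub> (f b \<oplus>\<^bsub>V\<^esub> z)" using zw(5) ab(5) c by (simp add: V.M.a_ac)
        moreover have "f b \<oplus>\<^bsub>V\<^esub> z \<in> G \<inter> B" using GD(3)[OF ab(4) zw(1)] set_addI[of "f b" "f ` B'" z Z V] ab zw by (simp add: B_def)
        ultimately show "x \<in> (G \<inter> f ` A') <+>\<^bsub>V\<^esub> (G \<inter> B)" using ab(1,2) by (metis IntI imageI set_addI)
      qed
    qed (rule fA B)+
  qed
qed

section \<open>Representations of a path\<close>

text \<open>
  A representation of the path \<open>1 \<midarrow> 2 \<midarrow> \<dots> \<midarrow> l\<close>: the map \<open>g i\<close> belongs to the edge between \<open>i\<close> and
  \<open>Suc i\<close> and points to the right exactly if \<open>fwd i\<close>.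
\<close>

locale zigzag =
  fixes K :: "('k, 'z) ring_scheme" and l :: nat and V :: "nat \<Rightarrow> ('k, 'v) module"
    and fwd :: "nat \<Rightarrow> bool" and g :: "nat \<Rightarrow> 'v \<Rightarrow> 'v"
  assumes spaces: "i \<in> {1..l} \<Longrightarrow> vectorspace K (V i)"
    and findim: "i \<in> {1..l} \<Longrightarrow> vectorspace.fin_dim K (V i)"
    and forward: "i \<in> {1..<l} \<Longrightarrow> fwd i \<Longrightarrow> linear_map K (V i) (V (Suc i)) (g i)"
    and backward: "i \<in> {1..<l} \<Longrightarrow> \<not> fwd i \<Longrightarrow> linear_map K (V (Suc i)) (V i) (g i)"
begin

definition preserves where
  "preserves i U \<longleftrightarrow> (if fwd i then g i ` U i \<subseteq> U (Suc i) else g i ` U (Suc i) \<subseteq> U i)"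

definition splitting where
  "splitting k U W \<longleftrightarrow>
     (\<forall>i\<in>{1..k}. subspace K (U i) (V i) \<and> subspace K (W i) (V i) \<and> U i \<inter> W i = {\<zero>\<^bsub>V i\<^esub>}
        \<and> U i <+>\<^bsub>V i\<^esub> W i = carrier (V i)) \<and>
     (\<forall>i\<in>{1..<k}. preserves i U \<and> preserves i W)"

text \<open>
  A vector of \<open>U i\<close> never dies on the edge to its right: it is not killed by a map pointing right, and it
  is hit by a map pointing left. Then the rank of \<open>U\<close> on this edge is the dimension of \<open>U i\<close>.
\<close>

definition persistent where
  "persistent i U \<longleftrightarrow> (if fwd i then inj_on (g i) (U i) else U i \<subseteq> g i ` U (Suc i))"

lemma set_add_eq_carrier:
  assumes "compatible_splitting K Z \<F> A B" "carrier Z \<in> \<F>"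
  shows "A <+>\<^bsub>Z\<^esub> B = carrier Z"
proof
  have A: "subspace K A Z" and B: "subspace K B Z" using assms(1) by (auto simp: compatible_splitting_def)
  show "A <+>\<^bsub>Z\<^esub> B \<subseteq> carrier Z" by (rule subspaceD(1)[OF subspace_sum[OF A B]])
  have "carrier Z \<subseteq> (carrier Z \<inter> A) <+>\<^bsub>Z\<^esub> (carrier Z \<inter> B)" using assms by (auto simp: compatible_splitting_def)
  moreover have "carrier Z \<inter> A = A" "carrier Z \<inter> B = B" using subspaceD(1)[OF A] subspaceD(1)[OF B] by auto
  ultimately show "carrier Z \<subseteq> A <+>\<^bsub>Z\<^esub> B" by simp
qed

lemma splitting_Suc:
  assumes k: "1 \<le> k" "Suc k \<le> l" and UW: "splitting k U W"
    and A: "compatible_splitting K (V (Suc k)) \<F> A B" "carrier (V (Suc k)) \<in> \<F>"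
    and step: "if fwd k then g k ` U k \<subseteq> A \<and> g k ` W k \<subseteq> B else g k ` A \<subseteq> U k \<and> g k ` B \<subseteq> W k"
  shows "splitting (Suc k) (U(Suc k := A)) (W(Suc k := B))"
proof -
  have "preserves i (U(Suc k := A)) \<and> preserves i (W(Suc k := B))" if "i \<in> {1..<Suc k}" for i
  proof (cases "i = k")
    case True
    then show ?thesis using step by (simp add: preserves_def split: if_splits)
  next
    case False
    then show ?thesis using UW that by (auto simp: splitting_def preserves_def)
  qed
  moreover have "subspace K ((U(Suc k := A)) i) (V i) \<and> subspace K ((W(Suc k := B)) i) (V i)
    \<and> (U(Suc k := A)) i \<inter> (W(Suc k := B)) i = {\<zero>\<^bsub>V i\<^esub>} \<and> (U(Suc k := A)) i <+>\<^bsub>V i\<^esub> (W(Suc k := B)) i = carrier (V i)"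
    if "i \<in> {1..Suc k}" for i
  proof (cases "i = Suc k")
    case True
    then show ?thesis using A(1) set_add_eq_carrier[OF A] by (simp add: compatible_splitting_def)
  next
    case False
    then show ?thesis using UW that by (simp add: splitting_def)
  qed
  ultimately show ?thesis unfolding splitting_def by blast
qed

text \<open>
  The splitting is prescribed at the right end and extended to the left one edge at a time, by pulling back
  along edges pointing right and pushing forward along edges pointing left; the flags move in the opposite
  direction.
\<close>

lemma flag_of_extendable_splittings:
  "1 \<le> k \<Longrightarrow> k \<le> l \<Longrightarrow> \<exists>\<F>. flag K (V k) \<F> \<and>
    (\<forall>A B. compatible_splitting K (V k) \<F> A B \<longrightarrow>
      (\<exists>U W. splitting k U W \<and> U k = A \<and> W k = B \<and> (\<forall>i\<in>{1..<k}. persistent i U)))"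
proof (induction k rule: nat_induct_at_least)
  case base
  have V1: "vectorspace K (V 1)" using spaces base by simp
  have "splitting 1 (\<lambda>_. A) (\<lambda>_. B)" if AB: "compatible_splitting K (V 1) {{\<zero>\<^bsub>V 1\<^esub>}, carrier (V 1)} A B" for A B
  proof -
    have "A <+>\<^bsub>V 1\<^esub> B = carrier (V 1)" by (rule set_add_eq_carrier[OF AB]) simp
    then show ?thesis using AB by (auto simp: splitting_def compatible_splitting_def)
  qed
  then show ?case using flag_trivial[OF V1]
    by (intro exI[of _ "{{\<zero>\<^bsub>V 1\<^esub>}, carrier (V 1)}"] conjI allI impI) (auto intro!: exI[of _ "\<lambda>_. _"])
next
  case (Suc k)
  then have k: "1 \<le> k" "k \<le> l" and kl: "k \<in> {1..<l}" by auto
  from Suc.IH[OF k(2)] obtain \<F> where \<F>: "flag K (V k) \<F>"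
    and ext: "\<And>A B. compatible_splitting K (V k) \<F> A B \<Longrightarrow>
      \<exists>U W. splitting k U W \<and> U k = A \<and> W k = B \<and> (\<forall>i\<in>{1..<k}. persistent i U)" by blast
  have pers: "persistent i (U(Suc k := A))" if "\<forall>i\<in>{1..<k}. persistent i U" "i \<in> {1..<k}" for i U A
    using that by (auto simp: persistent_def)
  show ?case
  proof (cases "fwd k")
    case True
    note f = forward[OF kl True]
    let ?\<F> = "insert (carrier (V (Suc k))) ((`) (g k) ` \<F>)"
    have fl: "flag K (V (Suc k)) ?\<F>" by (rule flag_image[OF f \<F>])
    have "\<exists>U W. splitting (Suc k) U W \<and> U (Suc k) = A \<and> W (Suc k) = B \<and> (\<forall>i\<in>{1..<Suc k}. persistent i U)"
      if AB: "compatible_splitting K (V (Suc k)) ?\<F> A B" for A B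
    proof -
      obtain A0 B0 where 0: "compatible_splitting K (V k) \<F> A0 B0" "g k ` A0 \<subseteq> A" "g k ` B0 \<subseteq> B" "inj_on (g k) A0"
        using compatible_splitting_pull_back[OF f \<F> AB] by metis
      from ext[OF 0(1)] obtain U W where UW: "splitting k U W" "U k = A0" "W k = B0" "\<forall>i\<in>{1..<k}. persistent i U" by blast
      have "splitting (Suc k) (U(Suc k := A)) (W(Suc k := B))"
        by (rule splitting_Suc[OF k(1) Suc.prems UW(1) AB]) (use 0 UW True in auto)
      moreover have "persistent i (U(Suc k := A))" if "i \<in> {1..<Suc k}" for i
      proof (cases "i = k")
        case True
        then show ?thesis using 0(4) UW(2) \<open>fwd k\<close> by (simp add: persistent_def)
      next
        case False
        then show ?thesis using pers[OF UW(4)] that by simp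
      qed
      ultimately show ?thesis by (intro exI[of _ "U(Suc k := A)"] exI[of _ "W(Suc k := B)"]) simp
    qed
    with fl show ?thesis by (intro exI[of _ ?\<F>] conjI allI impI)
  next
    case False
    note f = backward[OF kl False]
    let ?\<F> = "insert {\<zero>\<^bsub>V (Suc k)\<^esub>} ((\<lambda>F. {x \<in> carrier (V (Suc k)). g k x \<in> F}) ` \<F>)"
    have fl: "flag K (V (Suc k)) ?\<F>" by (rule flag_vimage[OF f \<F>])
    have "\<exists>U W. splitting (Suc k) U W \<and> U (Suc k) = A \<and> W (Suc k) = B \<and> (\<forall>i\<in>{1..<Suc k}. persistent i U)"
      if AB: "compatible_splitting K (V (Suc k)) ?\<F> A B" for A B
    proof -
      obtain B0 where 0: "compatible_splitting K (V k) \<F> (g k ` A) B0" "g k ` B \<subseteq> B0"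
        using compatible_splitting_push_forward[OF f \<F> AB] by metis
      from ext[OF 0(1)] obtain U W where UW: "splitting k U W" "U k = g k ` A" "W k = B0" "\<forall>i\<in>{1..<k}. persistent i U" by blast
      have "splitting (Suc k) (U(Suc k := A)) (W(Suc k := B))"
        by (rule splitting_Suc[OF k(1) Suc.prems UW(1) AB flagD(5)[OF fl]]) (use 0 UW False in auto)
      moreover have "persistent i (U(Suc k := A))" if "i \<in> {1..<Suc k}" for i
      proof (cases "i = k")
        case True
        then show ?thesis using UW(2) \<open>\<not> fwd k\<close> by (simp add: persistent_def)
      next
        case False
        then show ?thesis using pers[OF UW(4)] that by simp
      qed
      ultimately show ?thesis by (intro exI[of _ "U(Suc k := A)"] exI[of _ "W(Suc k := B)"]) simp
    qed
    with fl show ?thesis by (intro exI[of _ ?\<F>] conjI allI impI)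
  qed
qed

definition map_rank where
  "map_rank i = (if fwd i then rank K (V i) (V (Suc i)) (g i) else rank K (V (Suc i)) (V i) (g i))"

abbreviation "dm i \<equiv> vectorspace.dim K (V i)"

lemma line_exists:
  assumes Z: "vectorspace K Z" and v: "v \<in> carrier Z"
  obtains N where "subspace K N Z" "v \<in> N" "vectorspace.dim K (Z\<lparr>carrier := N\<rparr>) \<le> 1"
proof -
  interpret Z: vectorspace K Z by (rule Z)
  have sub: "{v} \<subseteq> carrier Z" using v by simp
  let ?N = "Z.span {v}"
  have N: "subspace K ?N Z" by (rule Z.span_is_subspace[OF sub])
  interpret N: vectorspace K "Z\<lparr>carrier := ?N\<rparr>" by (rule subspaceD(8)[OF N])
  have vN: "v \<in> ?N" using Z.in_own_span[OF sub] by simp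
  have "N.gen_set {v}"
    using Z.span_li_not_depend(1)[of "{v}" ?N] vN N by (simp add: subspace_def)
  then have "N.dim \<le> 1" by (rule N.dim_le1I) (use vN in simp)
  then show ?thesis using that[OF N vN] by simp
qed

text \<open>
  Only the line through one vector of the last nonzero space has to be split off. By persistence
  the dimensions do not decrease from the left up to the vertex \<open>k\<close>, where they reach 1.
\<close>

lemma indecomposable_thin:
  assumes nonzero: "\<exists>i\<in>{1..l}. carrier (V i) \<noteq> {\<zero>\<^bsub>V i\<^esub>}"
    and indec: "\<And>U W. splitting l U W \<Longrightarrow> (\<forall>i\<in>{1..l}. U i = {\<zero>\<^bsub>V i\<^esub>}) \<or> (\<forall>i\<in>{1..l}. W i = {\<zero>\<^bsub>V i\<^esub>})"
  obtains k where "k \<in> {1..l}" "dm k = 1" "\<And>i. i \<in> {k<..l} \<Longrightarrow> dm i = 0"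
    "\<And>i. i \<in> {1..<k} \<Longrightarrow> map_rank i = dm i \<and> dm i \<le> dm (Suc i)" "\<And>i. i \<in> {k..<l} \<Longrightarrow> map_rank i = 0"
proof -
  \<comment> \<open>The flag argument is applied at the last nonzero vertex, so that nothing to its right interferes.\<close>
  let ?I = "{i \<in> {1..l}. carrier (V i) \<noteq> {\<zero>\<^bsub>V i\<^esub>}}"
  define k where "k = Max ?I"
  have "k \<in> ?I" unfolding k_def by (rule Max_in) (use nonzero in auto)
  then have k: "1 \<le> k" "k \<le> l" "carrier (V k) \<noteq> {\<zero>\<^bsub>V k\<^esub>}" by auto
  have above: "carrier (V i) = {\<zero>\<^bsub>V i\<^esub>}" if "i \<in> {k<..l}" for i
    using Max_ge[of ?I i] that k(1) unfolding k_def[symmetric] by fastforce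
  have Vk: "vectorspace K (V k)" using spaces k by simp
  interpret Vk: vectorspace K "V k" by (rule Vk)
  obtain v where v: "v \<in> carrier (V k)" "v \<noteq> \<zero>\<^bsub>V k\<^esub>" using k(3) Vk.M.zero_closed by blast
  obtain N where N: "subspace K N (V k)" "v \<in> N" "vectorspace.dim K (V k\<lparr>carrier := N\<rparr>) \<le> 1"
    using line_exists[OF Vk v(1)] by blast
  obtain \<F> where \<F>: "flag K (V k) \<F>" and ext: "\<And>A B. compatible_splitting K (V k) \<F> A B \<Longrightarrow>
      \<exists>U W. splitting k U W \<and> U k = A \<and> W k = B \<and> (\<forall>i\<in>{1..<k}. persistent i U)"
    using flag_of_extendable_splittings[OF k(1,2)] by blast
  obtain H where H: "subspace K H (V k)" "H \<inter> N = {\<zero>\<^bsub>V k\<^esub>}" "\<And>F. F \<in> \<F> \<Longrightarrow> F \<subseteq> (F \<inter> H) <+>\<^bsub>V k\<^esub> (F \<inter> N)"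
    using chain_complement_exists[OF N(1) flagD(1-3)[OF \<F>]] by metis
  have "compatible_splitting K (V k) \<F> N H"
    unfolding compatible_splitting_def
  proof (intro conjI ballI)
    show "N \<inter> H = {\<zero>\<^bsub>V k\<^esub>}" using H(2) by blast
    show "F \<subseteq> (F \<inter> N) <+>\<^bsub>V k\<^esub> (F \<inter> H)" if "F \<in> \<F>" for F
    proof
      fix x assume "x \<in> F"
      then have "x \<in> (F \<inter> H) <+>\<^bsub>V k\<^esub> (F \<inter> N)" using H(3)[OF that] by blast
      then obtain h m where hm: "h \<in> F \<inter> H" "m \<in> F \<inter> N" "x = h \<oplus>\<^bsub>V k\<^esub> m" by (rule set_addE)
      then have "h \<in> carrier (V k)" "m \<in> carrier (V k)" using subspaceD(1)[OF H(1)] subspaceD(1)[OF N(1)] by auto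
      then have "x = m \<oplus>\<^bsub>V k\<^esub> h" using hm(3) by (simp add: Vk.M.a_comm)
      then show "x \<in> (F \<inter> N) <+>\<^bsub>V k\<^esub> (F \<inter> H)" using set_addI[OF hm(2,1)] by metis
    qed
  qed (rule N H)+
  from ext[OF this] obtain U W where UW: "splitting k U W" "U k = N" "W k = H" "\<forall>i\<in>{1..<k}. persistent i U" by blast
  \<comment> \<open>The two parts are continued by 0 to the right of \<open>k\<close>, where \<open>V\<close> vanishes.\<close>
  define U' where "U' i = (if i \<le> k then U i else {\<zero>\<^bsub>V i\<^esub>})" for i
  define W' where "W' i = (if i \<le> k then W i else {\<zero>\<^bsub>V i\<^esub>})" for i
  have mapzero: "g i ` S \<subseteq> {\<zero>\<^bsub>V (Suc i)\<^esub>}" if "i \<in> {1..<l}" "fwd i" "k \<le> i" "S \<subseteq> carrier (V i)" for i S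
    using linear_mapD(1)[OF forward[OF that(1,2)]] above[of "Suc i"] that by auto
  have mapzero': "g i ` {\<zero>\<^bsub>V (Suc i)\<^esub>} = {\<zero>\<^bsub>V i\<^esub>}" if "i \<in> {1..<l}" "\<not> fwd i" for i
    using linear_mapD(4)[OF backward[OF that]] by simp
  have extends: "preserves i S'" if "i \<in> {1..<l}" "\<And>i. i \<in> {1..<k} \<Longrightarrow> preserves i S"
      "\<And>i. S' i = (if i \<le> k then S i else {\<zero>\<^bsub>V i\<^esub>})" "\<And>i. i \<in> {1..k} \<Longrightarrow> subspace K (S i) (V i)" for i S S'
  proof (cases "i < k")
    case True
    then show ?thesis using that(1,3) that(2)[of i] by (auto simp: preserves_def)
  next
    case False
    have "subspace K (S' i) (V i)" using that(1,3,4) False k subspace_zero[OF spaces[of i]] by auto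
    note S' = subspaceD[OF this]
    have "S' (Suc i) = {\<zero>\<^bsub>V (Suc i)\<^esub>}" using False that(3) by simp
    then show ?thesis using mapzero[OF that(1) _ _ S'(1)] mapzero'[OF that(1)] False S'(2) by (auto simp: preserves_def)
  qed
  have subs: "\<And>i. i \<in> {1..k} \<Longrightarrow> subspace K (U i) (V i)" "\<And>i. i \<in> {1..k} \<Longrightarrow> subspace K (W i) (V i)"
    and pres: "\<And>i. i \<in> {1..<k} \<Longrightarrow> preserves i U" "\<And>i. i \<in> {1..<k} \<Longrightarrow> preserves i W"
    using UW(1) by (auto simp: splitting_def)
  have spl: "splitting l U' W'"
    unfolding splitting_def
  proof (intro conjI ballI)
    fix i assume i: "i \<in> {1..<l}"
    show "preserves i U'" by (rule extends[OF i pres(1) U'_def subs(1)])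
    show "preserves i W'" by (rule extends[OF i pres(2) W'_def subs(2)])
  next
    fix i assume i: "i \<in> {1..l}"
    note z = subspace_zero[OF spaces[OF i]]
    interpret Vi: vectorspace K "V i" by (rule spaces[OF i])
    show "subspace K (U' i) (V i)" "subspace K (W' i) (V i)" using i z subs by (auto simp: U'_def W'_def)
    show "U' i \<inter> W' i = {\<zero>\<^bsub>V i\<^esub>}" using i UW(1) by (auto simp: U'_def W'_def splitting_def)
    show "U' i <+>\<^bsub>V i\<^esub> W' i = carrier (V i)"
    proof (cases "i \<le> k")
      case True
      then show ?thesis using i UW(1) by (simp add: U'_def W'_def splitting_def)
    next
      case False
      then show ?thesis using above[of i] i by (auto simp: U'_def W'_def set_add_def')
    qed
  qed
  have "\<not> (\<forall>i\<in>{1..l}. U' i = {\<zero>\<^bsub>V i\<^esub>})" using v(2) N(2) UW(2) k by (auto simp: U'_def intro!: bexI[of _ k])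
  then have Wz: "W' i = {\<zero>\<^bsub>V i\<^esub>}" if "i \<in> {1..l}" for i using indec[OF spl] that by blast
  have full: "U' i = carrier (V i)" if i: "i \<in> {1..l}" for i
  proof -
    interpret Vi: vectorspace K "V i" by (rule spaces[OF i])
    have U: "U' i <+>\<^bsub>V i\<^esub> W' i = carrier (V i)" "subspace K (U' i) (V i)" using spl i by (auto simp: splitting_def)
    have "carrier (V i) \<subseteq> U' i"
    proof
      fix x assume "x \<in> carrier (V i)"
      then obtain u where "u \<in> U' i" "x = u \<oplus>\<^bsub>V i\<^esub> \<zero>\<^bsub>V i\<^esub>" using U(1) Wz[OF i] by (auto simp: set_add_def')
      then show "x \<in> U' i" using subspaceD(1)[OF U(2)] by auto
    qed
    then show ?thesis using subspaceD(1)[OF U(2)] by blast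
  qed
  have Uk: "U i = carrier (V i)" if "i \<in> {1..k}" for i using full[of i] that k by (simp add: U'_def)
  have dk: "dm k = 1"
  proof (rule antisym)
    show "dm k \<le> 1" using N(3) Uk[of k] UW(2) k by simp
    show "1 \<le> dm k"
    proof (rule ccontr)
      assume "\<not> 1 \<le> dm k"
      then have "dm k = 0" by simp
      moreover have "Vk.lin_indpt {v}"
        using Vk.lin_dep_iff_in_span[of "{}" v] v Vk.span_empty Vk.finite_lin_indpt2[OF finite.emptyI empty_subsetI] by auto
      ultimately show False using Vk.li_le_dim(2)[of "{v}"] findim[of k] v k by simp
    qed
  qed
  show ?thesis
  proof (rule that[of k])
    show "k \<in> {1..l}" using k by simp
    show "dm k = 1" by (rule dk)
    show "dm i = 0" if "i \<in> {k<..l}" for i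
      using dim_zero_space[OF spaces above[OF that]] that by simp
    show "map_rank i = dm i \<and> dm i \<le> dm (Suc i)" if i: "i \<in> {1..<k}" for i
    proof -
      have il: "i \<in> {1..<l}" "i \<in> {1..l}" "Suc i \<in> {1..l}" "i \<in> {1..k}" "Suc i \<in> {1..k}" using i k by auto
      have p: "persistent i U" using UW(4) i by blast
      show ?thesis
      proof (cases "fwd i")
        case True
        note f = forward[OF il(1) True]
        have "map_rank i = dm i"
          using rank_inj[OF f _ findim[OF il(2)]] p Uk il True by (simp add: persistent_def map_rank_def)
        then show ?thesis using rank_le_codim[OF f findim[OF il(3)]] True by (simp add: map_rank_def)
      next
        case False
        note f = backward[OF il(1) False]
        have "g i ` carrier (V (Suc i)) = carrier (V i)"
          using p Uk il False linear_mapD(1)[OF f] by (auto simp: persistent_def)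
        then have "map_rank i = dm i" using False by (simp add: map_rank_def rank_surj)
        then show ?thesis using rank_le_dim[OF f findim[OF il(3)]] False by (simp add: map_rank_def)
      qed
    qed
    show "map_rank i = 0" if i: "i \<in> {k..<l}" for i
    proof -
      have il: "i \<in> {1..<l}" "Suc i \<in> {k<..l}" using i k by auto
      show ?thesis
      proof (cases "fwd i")
        case True
        then show ?thesis using rank_zero[OF forward[OF il(1) True]] mapzero[OF il(1) True, of "carrier (V i)"] i
          by (auto simp: map_rank_def)
      next
        case False
        then show ?thesis using rank_zero[OF backward[OF il(1) False]] mapzero'[OF il(1) False] above[OF il(2)]
          by (auto simp: map_rank_def)
      qed
    qed
  qed
qed

lemma indecomposable_numbers:
  assumes nonzero: "\<exists>i\<in>{1..l}. carrier (V i) \<noteq> {\<zero>\<^bsub>V i\<^esub>}"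
    and indec: "\<And>U W. splitting l U W \<Longrightarrow> (\<forall>i\<in>{1..l}. U i = {\<zero>\<^bsub>V i\<^esub>}) \<or> (\<forall>i\<in>{1..l}. W i = {\<zero>\<^bsub>V i\<^esub>})"
  shows "\<And>i. i \<in> {1..l} \<Longrightarrow> dm i \<le> 1"
    and "\<And>i. i \<in> {1..<l} \<Longrightarrow> map_rank i = dm i * dm (Suc i)"
    and "(\<Sum>i\<in>{1..l}. dm i) = Suc (\<Sum>i\<in>{1..<l}. map_rank i)"
proof -
  obtain k where k: "k \<in> {1..l}" "dm k = 1" and above: "\<And>i. i \<in> {k<..l} \<Longrightarrow> dm i = 0"
    and below: "\<And>i. i \<in> {1..<k} \<Longrightarrow> map_rank i = dm i \<and> dm i \<le> dm (Suc i)" and zero: "\<And>i. i \<in> {k..<l} \<Longrightarrow> map_rank i = 0"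
    using indecomposable_thin[OF assms] by metis
  have le: "dm i \<le> 1" if "i \<le> k" "1 \<le> i" for i
    using that
  proof (induction rule: inc_induct)
    case base then show ?case using k by simp
  next
    case (step i) then show ?case using below[of i] by fastforce
  qed
  show le1: "dm i \<le> 1" if "i \<in> {1..l}" for i using le[of i] above[of i] that by (cases "i \<le> k") auto
  show "map_rank i = dm i * dm (Suc i)" if i: "i \<in> {1..<l}" for i
  proof (cases "i < k")
    case True
    then have "dm i \<le> dm (Suc i)" "dm (Suc i) \<le> 1" "map_rank i = dm i" using below[of i] le1[of "Suc i"] i by auto
    then show ?thesis by (cases "dm i = 0") auto
  next
    case False
    then show ?thesis using zero[of i] above[of "Suc i"] i by simp
  qed
  have "(\<Sum>i\<in>{1..l}. dm i) = (\<Sum>i\<in>{1..k}. dm i)"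
    by (rule sum.mono_neutral_right) (use k above in auto)
  also have "{1..k} = insert k {1..<k}" using k by auto
  also have "(\<Sum>i\<in>insert k {1..<k}. dm i) = Suc (\<Sum>i\<in>{1..<k}. dm i)" using k by simp
  also have "(\<Sum>i\<in>{1..<k}. dm i) = (\<Sum>i\<in>{1..<k}. map_rank i)" by (rule sum.cong[OF refl]) (use below in auto)
  also have "\<dots> = (\<Sum>i\<in>{1..<l}. map_rank i)"
    by (rule sum.mono_neutral_left) (use k zero in auto)
  finally show "(\<Sum>i\<in>{1..l}. dm i) = Suc (\<Sum>i\<in>{1..<l}. map_rank i)" .
qed

end

section \<open>Dimension minus rank\<close>

text \<open>
  The part of the axioms of a digraph that makes source and target spaces of all maps available.
\<close>

definition incident :: "('q, 'e) pre_digraph \<Rightarrow> bool" where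
  "incident Q \<longleftrightarrow> (\<forall>\<alpha>\<in>arcs Q. tail Q \<alpha> \<in> verts Q \<and> head Q \<alpha> \<in> verts Q)"

definition arrow_rank where
  "arrow_rank K Q N \<alpha> = rank K (space_at N (tail Q \<alpha>)) (space_at N (head Q \<alpha>)) (map_at N \<alpha>)"

text \<open>
  The number \<open>\<chi>(N)\<close> of the introduction.
\<close>

definition dim_minus_rank where
  "dim_minus_rank K Q N = (\<Sum>i\<in>verts Q. int (vectorspace.dim K (space_at N i))) - (\<Sum>\<alpha>\<in>arcs Q. int (arrow_rank K Q N \<alpha>))"

lemma is_repD:
  assumes "is_rep K Q N"
  shows "i \<in> verts Q \<Longrightarrow> vectorspace K (space_at N i)"
    and "i \<in> verts Q \<Longrightarrow> vectorspace.fin_dim K (space_at N i)"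
    and "\<alpha> \<in> arcs Q \<Longrightarrow> linear_map K (space_at N (tail Q \<alpha>)) (space_at N (head Q \<alpha>)) (map_at N \<alpha>)"
  using assms by (auto simp: is_rep_def)

lemma rep_isoE:
  assumes "rep_iso K Q M N"
  obtains \<phi> where "\<And>i. i \<in> verts Q \<Longrightarrow> linear_iso K (space_at M i) (space_at N i) (\<phi> i)"
    "\<And>\<alpha> x. \<alpha> \<in> arcs Q \<Longrightarrow> x \<in> carrier (space_at M (tail Q \<alpha>)) \<Longrightarrow> \<phi> (head Q \<alpha>) (map_at M \<alpha> x) = map_at N \<alpha> (\<phi> (tail Q \<alpha>) x)"
  using assms unfolding rep_iso_def linear_iso_def by blast

lemma rep_isoI:
  assumes "\<And>i. i \<in> verts Q \<Longrightarrow> linear_iso K (space_at M i) (space_at N i) (\<phi> i)"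
    "\<And>\<alpha> x. \<alpha> \<in> arcs Q \<Longrightarrow> x \<in> carrier (space_at M (tail Q \<alpha>)) \<Longrightarrow> \<phi> (head Q \<alpha>) (map_at M \<alpha> x) = map_at N \<alpha> (\<phi> (tail Q \<alpha>) x)"
  shows "rep_iso K Q M N"
  unfolding rep_iso_def using assms unfolding linear_iso_def by blast

lemma rep_iso_dim_rank:
  assumes Q: "incident Q" and M: "is_rep K Q M" and N: "is_rep K Q N" and iso: "rep_iso K Q M N"
  shows "i \<in> verts Q \<Longrightarrow> vectorspace.dim K (space_at N i) = vectorspace.dim K (space_at M i)"
    and "\<alpha> \<in> arcs Q \<Longrightarrow> arrow_rank K Q N \<alpha> = arrow_rank K Q M \<alpha>"
proof -
  obtain \<phi> where \<phi>: "\<And>i. i \<in> verts Q \<Longrightarrow> linear_iso K (space_at M i) (space_at N i) (\<phi> i)"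
    "\<And>\<alpha> x. \<alpha> \<in> arcs Q \<Longrightarrow> x \<in> carrier (space_at M (tail Q \<alpha>)) \<Longrightarrow> \<phi> (head Q \<alpha>) (map_at M \<alpha> x) = map_at N \<alpha> (\<phi> (tail Q \<alpha>) x)"
    using rep_isoE[OF iso] by metis
  show "vectorspace.dim K (space_at N i) = vectorspace.dim K (space_at M i)" if "i \<in> verts Q"
    by (rule linear_iso_dim(1)[OF \<phi>(1)[OF that] is_repD(2)[OF M that]])
  show "arrow_rank K Q N \<alpha> = arrow_rank K Q M \<alpha>" if \<alpha>: "\<alpha> \<in> arcs Q"
  proof -
    have t: "tail Q \<alpha> \<in> verts Q" "head Q \<alpha> \<in> verts Q" using Q \<alpha> by (auto simp: incident_def)
    show ?thesis unfolding arrow_rank_def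
      by (rule rank_iso[OF is_repD(3)[OF M \<alpha>] is_repD(3)[OF N \<alpha>] \<phi>(1)[OF t(1)] \<phi>(1)[OF t(2)] _ is_repD(2)[OF M t(1)]])
        (rule \<phi>(2)[OF \<alpha>])
  qed
qed

lemma dim_minus_rank_iso:
  assumes "incident Q" "is_rep K Q M" "is_rep K Q N" "rep_iso K Q M N"
  shows "dim_minus_rank K Q N = dim_minus_rank K Q M"
  unfolding dim_minus_rank_def using rep_iso_dim_rank[OF assms] by simp

lemma dsum_rep_is_rep:
  assumes K: "field K" and Q: "incident Q" and I: "finite I" and N: "\<And>j. j \<in> I \<Longrightarrow> is_rep K Q (N j)"
  shows "is_rep K Q (dsum_rep I N)"
  unfolding is_rep_def dsum_rep_def qrep.simps
proof (intro conjI ballI)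
  fix i assume "i \<in> verts Q"
  note vs = is_repD(1)[OF N this] and fd = is_repD(2)[OF N this]
  show "vectorspace K (dsum_space I (\<lambda>j. space_at (N j) i))" by (rule dsum_space_vectorspace[OF K vs])
  show "vectorspace.fin_dim K (dsum_space I (\<lambda>j. space_at (N j) i))" by (rule dsum_space_dim(2)[OF K I]) (use vs fd in auto)
next
  fix \<alpha> assume "\<alpha> \<in> arcs Q"
  note l = is_repD(3)[OF N this]
  show "linear_map K (dsum_space I (\<lambda>j. space_at (N j) (tail Q \<alpha>))) (dsum_space I (\<lambda>j. space_at (N j) (head Q \<alpha>)))
    (\<lambda>f. \<lambda>j\<in>I. map_at (N j) \<alpha> (f j))" by (rule dsum_space_map[OF K l])
qed

lemma dsum_rep_dim_rank:
  assumes K: "field K" and Q: "incident Q" and I: "finite I" and N: "\<And>j. j \<in> I \<Longrightarrow> is_rep K Q (N j)"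
  shows "i \<in> verts Q \<Longrightarrow> vectorspace.dim K (space_at (dsum_rep I N) i) = (\<Sum>j\<in>I. vectorspace.dim K (space_at (N j) i))"
    and "\<alpha> \<in> arcs Q \<Longrightarrow> arrow_rank K Q (dsum_rep I N) \<alpha> = (\<Sum>j\<in>I. arrow_rank K Q (N j) \<alpha>)"
proof -
  show "vectorspace.dim K (space_at (dsum_rep I N) i) = (\<Sum>j\<in>I. vectorspace.dim K (space_at (N j) i))" if "i \<in> verts Q"
    unfolding dsum_rep_def qrep.simps by (rule dsum_space_dim(1)[OF K I]) (use is_repD(1,2)[OF N that] in auto)
  show "arrow_rank K Q (dsum_rep I N) \<alpha> = (\<Sum>j\<in>I. arrow_rank K Q (N j) \<alpha>)" if \<alpha>: "\<alpha> \<in> arcs Q"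
  proof -
    have t: "tail Q \<alpha> \<in> verts Q" using Q \<alpha> by (auto simp: incident_def)
    show ?thesis unfolding arrow_rank_def dsum_rep_def qrep.simps
      by (rule dsum_space_rank[OF K I is_repD(3)[OF N \<alpha>] is_repD(2)[OF N t]])
  qed
qed

lemma dim_minus_rank_dsum:
  assumes K: "field K" and Q: "incident Q" and I: "finite I" and N: "\<And>j. j \<in> I \<Longrightarrow> is_rep K Q (N j)"
  shows "dim_minus_rank K Q (dsum_rep I N) = (\<Sum>j\<in>I. dim_minus_rank K Q (N j))"
proof -
  have "(\<Sum>i\<in>verts Q. int (vectorspace.dim K (space_at (dsum_rep I N) i))) = (\<Sum>j\<in>I. \<Sum>i\<in>verts Q. int (vectorspace.dim K (space_at (N j) i)))"
    by (subst sum.swap) (intro sum.cong, auto simp: dsum_rep_dim_rank(1)[OF assms])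
  moreover have "(\<Sum>\<alpha>\<in>arcs Q. int (arrow_rank K Q (dsum_rep I N) \<alpha>)) = (\<Sum>j\<in>I. \<Sum>\<alpha>\<in>arcs Q. int (arrow_rank K Q (N j) \<alpha>))"
    by (subst sum.swap) (intro sum.cong, auto simp: dsum_rep_dim_rank(2)[OF assms])
  ultimately show ?thesis unfolding dim_minus_rank_def by (simp add: sum_subtractf)
qed

lemma rep_iso_trans:
  assumes "rep_iso K Q L M" "rep_iso K Q M N" and Q: "incident Q"
  shows "rep_iso K Q L N"
proof -
  obtain \<phi> where \<phi>: "\<And>i. i \<in> verts Q \<Longrightarrow> linear_iso K (space_at L i) (space_at M i) (\<phi> i)"
    "\<And>\<alpha> x. \<alpha> \<in> arcs Q \<Longrightarrow> x \<in> carrier (space_at L (tail Q \<alpha>)) \<Longrightarrow> \<phi> (head Q \<alpha>) (map_at L \<alpha> x) = map_at M \<alpha> (\<phi> (tail Q \<alpha>) x)"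
    using rep_isoE[OF assms(1)] by metis
  obtain \<psi> where \<psi>: "\<And>i. i \<in> verts Q \<Longrightarrow> linear_iso K (space_at M i) (space_at N i) (\<psi> i)"
    "\<And>\<alpha> x. \<alpha> \<in> arcs Q \<Longrightarrow> x \<in> carrier (space_at M (tail Q \<alpha>)) \<Longrightarrow> \<psi> (head Q \<alpha>) (map_at M \<alpha> x) = map_at N \<alpha> (\<psi> (tail Q \<alpha>) x)"
    using rep_isoE[OF assms(2)] by metis
  show ?thesis
  proof (rule rep_isoI[where \<phi> = "\<lambda>i x. \<psi> i (\<phi> i x)"])
    show "linear_iso K (space_at L i) (space_at N i) (\<lambda>x. \<psi> i (\<phi> i x))" if "i \<in> verts Q" for i
      by (rule linear_iso_comp[OF \<phi>(1)[OF that] \<psi>(1)[OF that]])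
    fix \<alpha> x assume \<alpha>: "\<alpha> \<in> arcs Q" and x: "x \<in> carrier (space_at L (tail Q \<alpha>))"
    have "tail Q \<alpha> \<in> verts Q" using Q \<alpha> by (auto simp: incident_def)
    then have "\<phi> (tail Q \<alpha>) x \<in> carrier (space_at M (tail Q \<alpha>))"
      using \<phi>(1) linear_mapD(1)[of K _ _ "\<phi> (tail Q \<alpha>)" x] x unfolding linear_iso_def by blast
    then show "\<psi> (head Q \<alpha>) (\<phi> (head Q \<alpha>) (map_at L \<alpha> x)) = map_at N \<alpha> (\<psi> (tail Q \<alpha>) (\<phi> (tail Q \<alpha>) x))"
      using \<phi>(2)[OF \<alpha> x] \<psi>(2)[OF \<alpha>] by simp
  qed
qed

lemma rep_iso_sym:
  assumes iso: "rep_iso K Q M N" and Q: "incident Q" and M: "is_rep K Q M"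
  shows "rep_iso K Q N M"
proof -
  obtain \<phi> where \<phi>: "\<And>i. i \<in> verts Q \<Longrightarrow> linear_iso K (space_at M i) (space_at N i) (\<phi> i)"
    "\<And>\<alpha> x. \<alpha> \<in> arcs Q \<Longrightarrow> x \<in> carrier (space_at M (tail Q \<alpha>)) \<Longrightarrow> \<phi> (head Q \<alpha>) (map_at M \<alpha> x) = map_at N \<alpha> (\<phi> (tail Q \<alpha>) x)"
    using rep_isoE[OF iso] by metis
  show ?thesis
  proof (rule rep_isoI[where \<phi> = "\<lambda>i. inv_into (carrier (space_at M i)) (\<phi> i)"])
    show "linear_iso K (space_at N i) (space_at M i) (inv_into (carrier (space_at M i)) (\<phi> i))" if "i \<in> verts Q" for i
      by (rule linear_iso_inv[OF \<phi>(1)[OF that]])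
    fix \<alpha> y assume \<alpha>: "\<alpha> \<in> arcs Q" and y: "y \<in> carrier (space_at N (tail Q \<alpha>))"
    have t: "tail Q \<alpha> \<in> verts Q" "head Q \<alpha> \<in> verts Q" using Q \<alpha> by (auto simp: incident_def)
    have bt: "bij_betw (\<phi> (tail Q \<alpha>)) (carrier (space_at M (tail Q \<alpha>))) (carrier (space_at N (tail Q \<alpha>)))"
      and bh: "bij_betw (\<phi> (head Q \<alpha>)) (carrier (space_at M (head Q \<alpha>))) (carrier (space_at N (head Q \<alpha>)))"
      using \<phi>(1)[OF t(1)] \<phi>(1)[OF t(2)] by (auto simp: linear_iso_def)
    obtain x where x: "x \<in> carrier (space_at M (tail Q \<alpha>))" "y = \<phi> (tail Q \<alpha>) x"
      using bt y by (auto simp: bij_betw_def)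
    have "map_at M \<alpha> x \<in> carrier (space_at M (head Q \<alpha>))" by (rule linear_mapD(1)[OF is_repD(3)[OF M \<alpha>] x(1)])
    then show "inv_into (carrier (space_at M (head Q \<alpha>))) (\<phi> (head Q \<alpha>)) (map_at N \<alpha> y) =
      map_at M \<alpha> (inv_into (carrier (space_at M (tail Q \<alpha>))) (\<phi> (tail Q \<alpha>)) y)"
      using \<phi>(2)[OF \<alpha> x(1)] bij_betw_inv_into_left[OF bt x(1)] bij_betw_inv_into_left[OF bh] x(2) by metis
  qed
qed

lemma rep_iso_dsum:
  assumes K: "field K" and Q: "incident Q" and iso: "\<And>j. j \<in> I \<Longrightarrow> rep_iso K Q (M j) (N j)"
  shows "rep_iso K Q (dsum_rep I M) (dsum_rep I N)"
proof -
  have "\<forall>j\<in>I. \<exists>\<phi>. (\<forall>i\<in>verts Q. linear_iso K (space_at (M j) i) (space_at (N j) i) (\<phi> i)) \<and>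
    (\<forall>\<alpha>\<in>arcs Q. \<forall>x\<in>carrier (space_at (M j) (tail Q \<alpha>)). \<phi> (head Q \<alpha>) (map_at (M j) \<alpha> x) = map_at (N j) \<alpha> (\<phi> (tail Q \<alpha>) x))"
    using iso by (auto simp: rep_iso_def linear_iso_def)
  then obtain \<phi> where \<phi>: "\<And>j i. j \<in> I \<Longrightarrow> i \<in> verts Q \<Longrightarrow> linear_iso K (space_at (M j) i) (space_at (N j) i) (\<phi> j i)"
    and comm: "\<And>j \<alpha> x. j \<in> I \<Longrightarrow> \<alpha> \<in> arcs Q \<Longrightarrow> x \<in> carrier (space_at (M j) (tail Q \<alpha>)) \<Longrightarrow>
      \<phi> j (head Q \<alpha>) (map_at (M j) \<alpha> x) = map_at (N j) \<alpha> (\<phi> j (tail Q \<alpha>) x)"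
    by (simp only: bchoice_iff) blast
  show ?thesis
  proof (rule rep_isoI[where \<phi> = "\<lambda>i x. \<lambda>j\<in>I. \<phi> j i (x j)"])
    show "linear_iso K (space_at (dsum_rep I M) i) (space_at (dsum_rep I N) i) (\<lambda>x. \<lambda>j\<in>I. \<phi> j i (x j))" if "i \<in> verts Q" for i
      unfolding dsum_rep_def qrep.simps by (rule dsum_space_iso[OF K \<phi>[OF _ that]])
    fix \<alpha> x assume \<alpha>: "\<alpha> \<in> arcs Q" and x: "x \<in> carrier (space_at (dsum_rep I M) (tail Q \<alpha>))"
    have "x j \<in> carrier (space_at (M j) (tail Q \<alpha>))" if "j \<in> I" for j
      using x that unfolding dsum_rep_def qrep.simps by (rule dsum_space_component)
    then show "(\<lambda>j\<in>I. \<phi> j (head Q \<alpha>) (map_at (dsum_rep I M) \<alpha> x j)) = map_at (dsum_rep I N) \<alpha> (\<lambda>j\<in>I. \<phi> j (tail Q \<alpha>) (x j))"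
      unfolding dsum_rep_def qrep.simps by (intro restrict_ext) (simp add: comm \<alpha>)
  qed
qed

lemma dsum_space_reindex:
  assumes K: "field K" and h: "bij_betw h J I" and V: "\<And>j. j \<in> I \<Longrightarrow> vectorspace K (V j)"
  shows "linear_iso K (dsum_space I V) (dsum_space J (\<lambda>t. V (h t))) (\<lambda>x. \<lambda>t\<in>J. x (h t))"
proof (rule linear_isoI)
  have hI: "t \<in> J \<Longrightarrow> h t \<in> I" for t using h bij_betwE by blast
  let ?k = "inv_into J h"
  have k: "?k j \<in> J" "h (?k j) = j" if "j \<in> I" for j
    using h that bij_betw_inv_into_right[OF h] bij_betwE[OF bij_betw_inv_into[OF h]] by auto
  have kh: "?k (h t) = t" if "t \<in> J" for t by (rule bij_betw_inv_into_left[OF h that])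
  show "vectorspace K (dsum_space I V)" "vectorspace K (dsum_space J (\<lambda>t. V (h t)))"
    by (rule dsum_space_vectorspace[OF K]; simp add: V hI)+
  show "bij_betw (\<lambda>x. \<lambda>t\<in>J. x (h t)) (carrier (dsum_space I V)) (carrier (dsum_space J (\<lambda>t. V (h t))))"
    unfolding dsum_space_simps
  proof (rule bij_betw_byWitness[where f' = "\<lambda>y. \<lambda>j\<in>I. y (?k j)"])
    show "\<forall>x\<in>\<Pi>\<^sub>E j\<in>I. carrier (V j). (\<lambda>j\<in>I. (\<lambda>t\<in>J. x (h t)) (?k j)) = x"
    proof (intro ballI ext)
      fix x j assume x: "x \<in> (\<Pi>\<^sub>E j\<in>I. carrier (V j))"
      show "(\<lambda>j\<in>I. (\<lambda>t\<in>J. x (h t)) (?k j)) j = x j" using PiE_arb[OF x, of j] by (cases "j \<in> I") (simp_all add: k)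
    qed
    show "\<forall>y\<in>\<Pi>\<^sub>E t\<in>J. carrier (V (h t)). (\<lambda>t\<in>J. (\<lambda>j\<in>I. y (?k j)) (h t)) = y"
    proof (intro ballI ext)
      fix y t assume y: "y \<in> (\<Pi>\<^sub>E t\<in>J. carrier (V (h t)))"
      show "(\<lambda>t\<in>J. (\<lambda>j\<in>I. y (?k j)) (h t)) t = y t" using PiE_arb[OF y, of t] by (cases "t \<in> J") (simp_all add: kh hI)
    qed
    show "(\<lambda>x. \<lambda>t\<in>J. x (h t)) ` (\<Pi>\<^sub>E j\<in>I. carrier (V j)) \<subseteq> (\<Pi>\<^sub>E t\<in>J. carrier (V (h t)))" using hI by auto
    show "(\<lambda>y. \<lambda>j\<in>I. y (?k j)) ` (\<Pi>\<^sub>E t\<in>J. carrier (V (h t))) \<subseteq> (\<Pi>\<^sub>E j\<in>I. carrier (V j))"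
    proof
      fix z assume "z \<in> (\<lambda>y. \<lambda>j\<in>I. y (?k j)) ` (\<Pi>\<^sub>E t\<in>J. carrier (V (h t)))"
      then obtain y where y: "y \<in> (\<Pi>\<^sub>E t\<in>J. carrier (V (h t)))" "z = (\<lambda>j\<in>I. y (?k j))" by blast
      have "y (?k j) \<in> carrier (V j)" if "j \<in> I" for j using PiE_mem[OF y(1) k(1)[OF that]] k(2)[OF that] by simp
      then show "z \<in> (\<Pi>\<^sub>E j\<in>I. carrier (V j))" unfolding y(2) by simp
    qed
  qed
  show "(\<lambda>t\<in>J. (x \<oplus>\<^bsub>dsum_space I V\<^esub> y) (h t)) = (\<lambda>t\<in>J. x (h t)) \<oplus>\<^bsub>dsum_space J (\<lambda>t. V (h t))\<^esub> (\<lambda>t\<in>J. y (h t))" for x y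
    unfolding dsum_space_simps by (intro restrict_ext) (simp add: hI)
  show "(\<lambda>t\<in>J. (c \<odot>\<^bsub>dsum_space I V\<^esub> x) (h t)) = c \<odot>\<^bsub>dsum_space J (\<lambda>t. V (h t))\<^esub> (\<lambda>t\<in>J. x (h t))" for c x
    unfolding dsum_space_simps by (intro restrict_ext) (simp add: hI)
qed

lemma rep_iso_reindex:
  assumes K: "field K" and h: "bij_betw h J I" and Z: "\<And>j. j \<in> I \<Longrightarrow> is_rep K Q (Z j)"
  shows "rep_iso K Q (dsum_rep I Z) (dsum_rep J (\<lambda>t. Z (h t)))"
proof (rule rep_isoI[where \<phi> = "\<lambda>i x. \<lambda>t\<in>J. x (h t)"])
  have hI: "t \<in> J \<Longrightarrow> h t \<in> I" for t using h bij_betwE by blast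
  show "linear_iso K (space_at (dsum_rep I Z) i) (space_at (dsum_rep J (\<lambda>t. Z (h t))) i) (\<lambda>x. \<lambda>t\<in>J. x (h t))" if "i \<in> verts Q" for i
    unfolding dsum_rep_def qrep.simps by (rule dsum_space_reindex[OF K h is_repD(1)[OF Z that]])
  show "(\<lambda>t\<in>J. map_at (dsum_rep I Z) \<alpha> x (h t)) = map_at (dsum_rep J (\<lambda>t. Z (h t))) \<alpha> (\<lambda>t\<in>J. x (h t))" for \<alpha> x
    unfolding dsum_rep_def qrep.simps by (intro restrict_ext) (simp add: hI)
qed

lemma indecomposableD:
  assumes "indecomposable K Q M" "is_subrep K Q M U" "is_subrep K Q M W"
    and "\<And>i. i \<in> verts Q \<Longrightarrow> U i \<inter> W i = {\<zero>\<^bsub>space_at M i\<^esub>} \<and> U i <+>\<^bsub>space_at M i\<^esub> W i = carrier (space_at M i)"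
  shows "(\<forall>i\<in>verts Q. U i = {\<zero>\<^bsub>space_at M i\<^esub>}) \<or> (\<forall>i\<in>verts Q. W i = {\<zero>\<^bsub>space_at M i\<^esub>})"
proof -
  have "is_subrep K Q M U \<and> is_subrep K Q M W \<and> (\<forall>i\<in>verts Q. U i \<inter> W i = {\<zero>\<^bsub>space_at M i\<^esub>} \<and>
      U i <+>\<^bsub>space_at M i\<^esub> W i = carrier (space_at M i))" using assms(2-4) by simp
  from mp[OF spec[OF spec[OF conjunct2[OF assms(1)[unfolded indecomposable_def]]]] this] show ?thesis .
qed

text \<open>
  A decomposition of \<open>Y\<close> into subrepresentations is carried to one of \<open>Z\<close>.
\<close>

lemma indecomposable_iso:
  assumes Q: "incident Q" and Y: "is_rep K Q Y" and Z: "is_rep K Q Z" and iso: "rep_iso K Q Y Z" and ind: "indecomposable K Q Z"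
  shows "indecomposable K Q Y"
proof -
  obtain \<phi> where \<phi>: "\<And>i. i \<in> verts Q \<Longrightarrow> linear_iso K (space_at Y i) (space_at Z i) (\<phi> i)"
    "\<And>\<alpha> x. \<alpha> \<in> arcs Q \<Longrightarrow> x \<in> carrier (space_at Y (tail Q \<alpha>)) \<Longrightarrow> \<phi> (head Q \<alpha>) (map_at Y \<alpha> x) = map_at Z \<alpha> (\<phi> (tail Q \<alpha>) x)"
    using rep_isoE[OF iso] by metis
  have lin: "linear_map K (space_at Y i) (space_at Z i) (\<phi> i)" and inj: "inj_on (\<phi> i) (carrier (space_at Y i))"
    and surj: "\<phi> i ` carrier (space_at Y i) = carrier (space_at Z i)" if "i \<in> verts Q" for i
    using \<phi>(1)[OF that] by (auto simp: linear_iso_def bij_betw_def)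
  have reflect: "U = {\<zero>\<^bsub>space_at Y i\<^esub>}" if i: "i \<in> verts Q" and U: "subspace K U (space_at Y i)" and im: "\<phi> i ` U = {\<zero>\<^bsub>space_at Z i\<^esub>}" for i U
  proof -
    have "x = \<zero>\<^bsub>space_at Y i\<^esub>" if x: "x \<in> U" for x
    proof (rule inj_onD[OF inj[OF i]])
      show "\<phi> i x = \<phi> i \<zero>\<^bsub>space_at Y i\<^esub>" using im x linear_mapD(4)[OF lin[OF i]] by auto
      show "x \<in> carrier (space_at Y i)" "\<zero>\<^bsub>space_at Y i\<^esub> \<in> carrier (space_at Y i)" using subspaceD(1,2)[OF U] x by auto
    qed
    then show ?thesis using subspaceD(2)[OF U] by blast
  qed
  show ?thesis unfolding indecomposable_def
  proof (intro conjI allI impI)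
    from ind obtain i where i: "i \<in> verts Q" "carrier (space_at Z i) \<noteq> {\<zero>\<^bsub>space_at Z i\<^esub>}" by (auto simp: indecomposable_def)
    then have "carrier (space_at Y i) \<noteq> {\<zero>\<^bsub>space_at Y i\<^esub>}" using surj[OF i(1)] linear_mapD(4)[OF lin[OF i(1)]] by auto
    then show "\<exists>i\<in>verts Q. carrier (space_at Y i) \<noteq> {\<zero>\<^bsub>space_at Y i\<^esub>}" using i(1) by blast
  next
    fix U W assume "is_subrep K Q Y U \<and> is_subrep K Q Y W \<and>
       (\<forall>i\<in>verts Q. U i \<inter> W i = {\<zero>\<^bsub>space_at Y i\<^esub>} \<and> U i <+>\<^bsub>space_at Y i\<^esub> W i = carrier (space_at Y i))"
    then have U: "is_subrep K Q Y U" and W: "is_subrep K Q Y W"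
      and dis: "\<And>i. i \<in> verts Q \<Longrightarrow> U i \<inter> W i = {\<zero>\<^bsub>space_at Y i\<^esub>}"
      and sum: "\<And>i. i \<in> verts Q \<Longrightarrow> U i <+>\<^bsub>space_at Y i\<^esub> W i = carrier (space_at Y i)" by auto
    have sub: "is_subrep K Q Z (\<lambda>i. \<phi> i ` S i)" if S: "is_subrep K Q Y S" for S
      unfolding is_subrep_def
    proof (intro conjI ballI)
      have Ss: "subspace K (S i) (space_at Y i)" if "i \<in> verts Q" for i using S that by (auto simp: is_subrep_def)
      show "subspace K (\<phi> i ` S i) (space_at Z i)" if "i \<in> verts Q" for i by (rule subspace_image[OF lin[OF that] Ss[OF that]])
      fix \<alpha> assume \<alpha>: "\<alpha> \<in> arcs Q"
      then have t: "tail Q \<alpha> \<in> verts Q" using Q by (auto simp: incident_def)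
      show "map_at Z \<alpha> ` \<phi> (tail Q \<alpha>) ` S (tail Q \<alpha>) \<subseteq> \<phi> (head Q \<alpha>) ` S (head Q \<alpha>)"
      proof (clarify)
        fix x assume x: "x \<in> S (tail Q \<alpha>)"
        then have "x \<in> carrier (space_at Y (tail Q \<alpha>))" using subspaceD(1)[OF Ss[OF t]] by blast
        then have "map_at Z \<alpha> (\<phi> (tail Q \<alpha>) x) = \<phi> (head Q \<alpha>) (map_at Y \<alpha> x)" using \<phi>(2)[OF \<alpha>] by simp
        moreover have "map_at Y \<alpha> x \<in> S (head Q \<alpha>)" using S \<alpha> x by (auto simp: is_subrep_def)
        ultimately show "map_at Z \<alpha> (\<phi> (tail Q \<alpha>) x) \<in> \<phi> (head Q \<alpha>) ` S (head Q \<alpha>)" by simp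
      qed
    qed
    have "\<phi> i ` U i \<inter> \<phi> i ` W i = {\<zero>\<^bsub>space_at Z i\<^esub>} \<and> \<phi> i ` U i <+>\<^bsub>space_at Z i\<^esub> \<phi> i ` W i = carrier (space_at Z i)"
      if i: "i \<in> verts Q" for i
    proof
      have c: "U i \<subseteq> carrier (space_at Y i)" "W i \<subseteq> carrier (space_at Y i)"
        using U W i subspaceD(1)[of K "U i" "space_at Y i"] subspaceD(1)[of K "W i" "space_at Y i"] unfolding is_subrep_def by simp_all
      show "\<phi> i ` U i \<inter> \<phi> i ` W i = {\<zero>\<^bsub>space_at Z i\<^esub>}"
        using inj_on_image_Int[OF inj[OF i] c] dis[OF i] linear_mapD(4)[OF lin[OF i]] by simp
      have "\<phi> i ` U i <+>\<^bsub>space_at Z i\<^esub> \<phi> i ` W i = \<phi> i ` (U i <+>\<^bsub>space_at Y i\<^esub> W i)"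
      proof (intro equalityI subsetI)
        fix z assume "z \<in> \<phi> i ` U i <+>\<^bsub>space_at Z i\<^esub> \<phi> i ` W i"
        then obtain a b where ab: "a \<in> \<phi> i ` U i" "b \<in> \<phi> i ` W i" "z = a \<oplus>\<^bsub>space_at Z i\<^esub> b" by (rule set_addE)
        then obtain u w where uw: "u \<in> U i" "w \<in> W i" "a = \<phi> i u" "b = \<phi> i w" by blast
        then have "u \<in> carrier (space_at Y i)" "w \<in> carrier (space_at Y i)" using c by auto
        from linear_mapD(2)[OF lin[OF i] this] have "z = \<phi> i (u \<oplus>\<^bsub>space_at Y i\<^esub> w)" using ab(3) uw(3,4) by simp
        then show "z \<in> \<phi> i ` (U i <+>\<^bsub>space_at Y i\<^esub> W i)" using set_addI[OF uw(1,2)] by blast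
      next
        fix z assume "z \<in> \<phi> i ` (U i <+>\<^bsub>space_at Y i\<^esub> W i)"
        then obtain y where y: "y \<in> U i <+>\<^bsub>space_at Y i\<^esub> W i" "z = \<phi> i y" by blast
        from y(1) obtain u w where uw: "u \<in> U i" "w \<in> W i" "y = u \<oplus>\<^bsub>space_at Y i\<^esub> w" by (rule set_addE)
        then have "u \<in> carrier (space_at Y i)" "w \<in> carrier (space_at Y i)" using c by auto
        from linear_mapD(2)[OF lin[OF i] this] have "z = \<phi> i u \<oplus>\<^bsub>space_at Z i\<^esub> \<phi> i w" using y(2) uw(3) by simp
        then show "z \<in> \<phi> i ` U i <+>\<^bsub>space_at Z i\<^esub> \<phi> i ` W i" using set_addI[OF imageI[OF uw(1)] imageI[OF uw(2)]] by metis
      qed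
      then show "\<phi> i ` U i <+>\<^bsub>space_at Z i\<^esub> \<phi> i ` W i = carrier (space_at Z i)" using sum[OF i] surj[OF i] by simp
    qed
    then have "(\<forall>i\<in>verts Q. \<phi> i ` U i = {\<zero>\<^bsub>space_at Z i\<^esub>}) \<or> (\<forall>i\<in>verts Q. \<phi> i ` W i = {\<zero>\<^bsub>space_at Z i\<^esub>})"
      by (rule indecomposableD[OF ind sub[OF U] sub[OF W]])
    then show "(\<forall>i\<in>verts Q. U i = {\<zero>\<^bsub>space_at Y i\<^esub>}) \<or> (\<forall>i\<in>verts Q. W i = {\<zero>\<^bsub>space_at Y i\<^esub>})"
    proof (elim disjE)
      assume *: "\<forall>i\<in>verts Q. \<phi> i ` U i = {\<zero>\<^bsub>space_at Z i\<^esub>}"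
      have "U i = {\<zero>\<^bsub>space_at Y i\<^esub>}" if i: "i \<in> verts Q" for i
        by (rule reflect[OF i]) (use U * i in \<open>auto simp: is_subrep_def\<close>)
      then show ?thesis by blast
    next
      assume *: "\<forall>i\<in>verts Q. \<phi> i ` W i = {\<zero>\<^bsub>space_at Z i\<^esub>}"
      have "W i = {\<zero>\<^bsub>space_at Y i\<^esub>}" if i: "i \<in> verts Q" for i
        by (rule reflect[OF i]) (use W * i in \<open>auto simp: is_subrep_def\<close>)
      then show ?thesis by blast
    qed
  qed
qed

section \<open>Counting the summands over a quiver of type A\<close>

lemma dynkin_incident:
  assumes "dynkin_type_A l Q"
  shows "incident Q" "finite (arcs Q)" "verts Q = {1..l}"
proof -
  from assms obtain p e where verts: "verts Q = {1..l}" and p: "bij_betw p {1..l} {1..l}" and e: "bij_betw e {1..<l} (arcs Q)"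
    and pe: "\<And>i. i \<in> {1..<l} \<Longrightarrow> {tail Q (e i), head Q (e i)} = {p i, p (Suc i)}"
    unfolding dynkin_type_A_def by blast
  show "verts Q = {1..l}" by (rule verts)
  show "finite (arcs Q)" using bij_betw_finite[OF e] by simp
  show "incident Q"
    unfolding incident_def
  proof
    fix \<alpha> assume "\<alpha> \<in> arcs Q"
    then have "\<alpha> \<in> e ` {1..<l}" by (simp only: bij_betw_imp_surj_on[OF e])
    then obtain i where i: "i \<in> {1..<l}" "\<alpha> = e i" by blast
    have "p i \<in> {1..l}" "p (Suc i) \<in> {1..l}" using bij_betwE[OF p] i(1) by auto
    then have "{tail Q \<alpha>, head Q \<alpha>} \<subseteq> {1..l}" using pe[OF i(1)] i(2) by simp
    then show "tail Q \<alpha> \<in> verts Q \<and> head Q \<alpha> \<in> verts Q" using verts by simp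
  qed
qed

text \<open>
  The numbering of the vertices along the underlying path turns a representation of the quiver into one of
  the path, and decompositions into decompositions.
\<close>

lemma indecomposable_type_A:
  fixes Y :: "('k, 'v, nat, 'e) qrep"
  assumes Q: "dynkin_type_A l Q" and Y: "is_rep K Q Y" and ind: "indecomposable K Q Y"
  shows "\<And>i. i \<in> verts Q \<Longrightarrow> vectorspace.dim K (space_at Y i) \<le> 1"
    and "\<And>\<alpha>. \<alpha> \<in> arcs Q \<Longrightarrow> arrow_rank K Q Y \<alpha> =
      vectorspace.dim K (space_at Y (tail Q \<alpha>)) * vectorspace.dim K (space_at Y (head Q \<alpha>))"
    and "dim_minus_rank K Q Y = 1"
proof -
  from Q obtain p e where verts: "verts Q = {1..l}" and p: "bij_betw p {1..l} {1..l}" and e: "bij_betw e {1..<l} (arcs Q)"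
    and pe: "\<And>i. i \<in> {1..<l} \<Longrightarrow> {tail Q (e i), head Q (e i)} = {p i, p (Suc i)}"
    unfolding dynkin_type_A_def by blast
  have pv: "p i \<in> verts Q" if "i \<in> {1..l}" for i using bij_betwE[OF p] that verts by blast
  have ea: "e i \<in> arcs Q" if "i \<in> {1..<l}" for i using bij_betwE[OF e] that by blast
  define fwd where "fwd i \<longleftrightarrow> tail Q (e i) = p i" for i
  have pne: "p i \<noteq> p (Suc i)" if "i \<in> {1..<l}" for i
    using inj_onD[OF bij_betw_imp_inj_on[OF p], of i "Suc i"] that by auto
  have fw: "tail Q (e i) = p i" "head Q (e i) = p (Suc i)" if "i \<in> {1..<l}" "fwd i" for i
    using pe[OF that(1)] that(2) pne[OF that(1)] unfolding fwd_def doubleton_eq_iff by simp_all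
  have bw: "tail Q (e i) = p (Suc i)" "head Q (e i) = p i" if "i \<in> {1..<l}" "\<not> fwd i" for i
    using pe[OF that(1)] that(2) unfolding fwd_def doubleton_eq_iff by simp_all
  define V where "V i = space_at Y (p i)" for i
  interpret z: zigzag K l V fwd "\<lambda>i. map_at Y (e i)"
  proof (rule zigzag.intro)
    show "vectorspace K (V i)" "vectorspace.fin_dim K (V i)" if "i \<in> {1..l}" for i
      using is_repD(1,2)[OF Y pv[OF that]] by (simp_all add: V_def)
    show "linear_map K (V i) (V (Suc i)) (map_at Y (e i))" if "i \<in> {1..<l}" "fwd i" for i
      using is_repD(3)[OF Y ea[OF that(1)]] fw[OF that] by (simp add: V_def)
    show "linear_map K (V (Suc i)) (V i) (map_at Y (e i))" if "i \<in> {1..<l}" "\<not> fwd i" for i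
      using is_repD(3)[OF Y ea[OF that(1)]] bw[OF that] by (simp add: V_def)
  qed
  let ?q = "inv_into {1..l} p"
  have qp: "?q (p i) = i" if "i \<in> {1..l}" for i by (rule bij_betw_inv_into_left[OF p that])
  have vp: "\<exists>i\<in>{1..l}. v = p i" if "v \<in> verts Q" for v
    using that verts bij_betw_imp_surj_on[OF p] by blast
  have ae: "\<exists>i\<in>{1..<l}. \<alpha> = e i" if "\<alpha> \<in> arcs Q" for \<alpha>
    using that bij_betw_imp_surj_on[OF e] by blast
  have nz: "\<exists>i\<in>{1..l}. carrier (V i) \<noteq> {\<zero>\<^bsub>V i\<^esub>}"
  proof -
    from conjunct1[OF ind[unfolded indecomposable_def]]
    obtain v where v: "v \<in> verts Q" "carrier (space_at Y v) \<noteq> {\<zero>\<^bsub>space_at Y v\<^esub>}" by blast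
    from vp[OF v(1)] obtain i where "i \<in> {1..l}" "v = p i" by blast
    then show ?thesis using v(2) by (intro bexI[of _ i]) (simp_all add: V_def)
  qed
  have ind': "(\<forall>i\<in>{1..l}. U i = {\<zero>\<^bsub>V i\<^esub>}) \<or> (\<forall>i\<in>{1..l}. W i = {\<zero>\<^bsub>V i\<^esub>})" if spl: "z.splitting l U W" for U W
  proof -
    have sub: "is_subrep K Q Y (\<lambda>v. S (?q v))"
      if S: "\<And>i. i \<in> {1..l} \<Longrightarrow> subspace K (S i) (V i)" "\<And>i. i \<in> {1..<l} \<Longrightarrow> z.preserves i S" for S
      unfolding is_subrep_def
    proof (intro conjI ballI)
      fix v assume "v \<in> verts Q"
      then obtain i where i: "i \<in> {1..l}" "v = p i" using vp by blast
      show "subspace K (S (?q v)) (space_at Y v)" using S(1)[OF i(1)] qp[OF i(1)] i(2) by (simp add: V_def)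
    next
      fix \<alpha> assume "\<alpha> \<in> arcs Q"
      then obtain i where i: "i \<in> {1..<l}" "\<alpha> = e i" using ae by blast
      have q: "?q (p i) = i" "?q (p (Suc i)) = Suc i" using qp i(1) by auto
      show "map_at Y \<alpha> ` S (?q (tail Q \<alpha>)) \<subseteq> S (?q (head Q \<alpha>))"
        using S(2)[OF i(1)] fw[OF i(1)] bw[OF i(1)] q i(2) by (cases "fwd i") (simp_all add: z.preserves_def)
    qed
    have UW: "subspace K (U i) (V i)" "subspace K (W i) (V i)" "U i \<inter> W i = {\<zero>\<^bsub>V i\<^esub>}" "U i <+>\<^bsub>V i\<^esub> W i = carrier (V i)"
      if "i \<in> {1..l}" for i using spl that by (auto simp: z.splitting_def)
    have pr: "z.preserves i U" "z.preserves i W" if "i \<in> {1..<l}" for i using spl that by (auto simp: z.splitting_def)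
    have suU: "is_subrep K Q Y (\<lambda>v. U (?q v))" by (rule sub) (use UW pr in auto)
    have suW: "is_subrep K Q Y (\<lambda>v. W (?q v))" by (rule sub) (use UW pr in auto)
    have "U (?q v) \<inter> W (?q v) = {\<zero>\<^bsub>space_at Y v\<^esub>} \<and> U (?q v) <+>\<^bsub>space_at Y v\<^esub> W (?q v) = carrier (space_at Y v)"
      if v: "v \<in> verts Q" for v
    proof -
      from vp[OF v] obtain i where i: "i \<in> {1..l}" "v = p i" by blast
      then show ?thesis using UW(3,4)[OF i(1)] qp[OF i(1)] by (simp add: V_def)
    qed
    then have "(\<forall>v\<in>verts Q. U (?q v) = {\<zero>\<^bsub>space_at Y v\<^esub>}) \<or> (\<forall>v\<in>verts Q. W (?q v) = {\<zero>\<^bsub>space_at Y v\<^esub>})"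
      by (rule indecomposableD[OF ind suU suW])
    moreover have "S i = {\<zero>\<^bsub>V i\<^esub>}" if "\<forall>v\<in>verts Q. S (?q v) = {\<zero>\<^bsub>space_at Y v\<^esub>}" "i \<in> {1..l}" for S i
      using bspec[OF that(1) pv[OF that(2)]] qp[OF that(2)] by (simp add: V_def)
    ultimately show ?thesis by blast
  qed
  have nums1: "z.dm i \<le> 1" if "i \<in> {1..l}" for i
    by (rule z.indecomposable_numbers(1)[OF nz _ that]) (rule ind')
  have nums2: "z.map_rank i = z.dm i * z.dm (Suc i)" if "i \<in> {1..<l}" for i
    by (rule z.indecomposable_numbers(2)[OF nz _ that]) (rule ind')
  have nums3: "(\<Sum>i\<in>{1..l}. z.dm i) = Suc (\<Sum>i\<in>{1..<l}. z.map_rank i)"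
    by (rule z.indecomposable_numbers(3)[OF nz]) (rule ind')
  have ar: "arrow_rank K Q Y (e i) = z.map_rank i" if "i \<in> {1..<l}" for i
    using fw[OF that] bw[OF that] by (cases "fwd i") (simp_all add: arrow_rank_def z.map_rank_def V_def)
  show "vectorspace.dim K (space_at Y i) \<le> 1" if "i \<in> verts Q" for i
    using nums1 vp[OF that] by (auto simp: V_def)
  show "arrow_rank K Q Y \<alpha> = vectorspace.dim K (space_at Y (tail Q \<alpha>)) * vectorspace.dim K (space_at Y (head Q \<alpha>))"
    if \<alpha>: "\<alpha> \<in> arcs Q" for \<alpha>
  proof -
    from ae[OF \<alpha>] obtain i where i: "i \<in> {1..<l}" "\<alpha> = e i" by blast
    then show ?thesis using nums2[OF i(1)] ar[OF i(1)] fw[OF i(1)] bw[OF i(1)]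
      by (cases "fwd i") (simp_all add: V_def)
  qed
  have "(\<Sum>v\<in>verts Q. int (vectorspace.dim K (space_at Y v))) = (\<Sum>i\<in>{1..l}. int (vectorspace.dim K (V i)))"
    unfolding verts V_def by (rule sum.reindex_bij_betw[OF p, symmetric])
  moreover have "(\<Sum>\<alpha>\<in>arcs Q. int (arrow_rank K Q Y \<alpha>)) = (\<Sum>i\<in>{1..<l}. int (arrow_rank K Q Y (e i)))"
    by (rule sum.reindex_bij_betw[OF e, symmetric])
  moreover have "\<dots> = (\<Sum>i\<in>{1..<l}. int (z.map_rank i))" by (rule sum.cong[OF refl]) (simp add: ar)
  ultimately show "dim_minus_rank K Q Y = 1"
    unfolding dim_minus_rank_def using nums3 by (simp flip: of_nat_sum)
qed

text \<open>
  The \<open>j\<close>-th summand of \<open>N\<close> with respect to an isomorphism \<open>\<phi>\<close> of \<open>N\<close> with a direct sum, realised inside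
  \<open>N\<close> so that its carrier type is that of \<open>N\<close>.
\<close>

definition summand where
  "summand N \<phi> I Z j = \<lparr>space_at = (\<lambda>i. (space_at N i)\<lparr>carrier :=
       {x \<in> carrier (space_at N i). \<forall>s\<in>I. s \<noteq> j \<longrightarrow> \<phi> i x s = \<zero>\<^bsub>space_at (Z s) i\<^esub>}\<rparr>),
     map_at = map_at N\<rparr>"

lemma summand_iso:
  fixes N :: "('k, 'w, 'q, 'e) qrep" and Z :: "'j \<Rightarrow> ('k, 'u, 'q, 'e) qrep"
  assumes K: "field K" and Q: "incident Q" and N: "is_rep K Q N" and Z: "\<And>j. j \<in> I \<Longrightarrow> is_rep K Q (Z j)"
    and \<phi>: "\<And>i. i \<in> verts Q \<Longrightarrow> linear_iso K (space_at N i) (space_at (dsum_rep I Z) i) (\<phi> i)"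
      "\<And>\<alpha> x. \<alpha> \<in> arcs Q \<Longrightarrow> x \<in> carrier (space_at N (tail Q \<alpha>)) \<Longrightarrow>
        \<phi> (head Q \<alpha>) (map_at N \<alpha> x) = map_at (dsum_rep I Z) \<alpha> (\<phi> (tail Q \<alpha>) x)"
    and j: "j \<in> I"
  shows "is_rep K Q (summand N \<phi> I Z j)" "rep_iso K Q (summand N \<phi> I Z j) (Z j)"
proof -
  let ?Y = "summand N \<phi> I Z j"
  define C where "C i = {x \<in> carrier (space_at N i). \<forall>s\<in>I. s \<noteq> j \<longrightarrow> \<phi> i x s = \<zero>\<^bsub>space_at (Z s) i\<^esub>}" for i
  have Ys: "space_at ?Y i = (space_at N i)\<lparr>carrier := C i\<rparr>" "map_at ?Y = map_at N" for i by (simp_all add: summand_def C_def)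
  have ds: "space_at (dsum_rep I Z) i = dsum_space I (\<lambda>s. space_at (Z s) i)" for i by (simp add: dsum_rep_def)
  have lin: "linear_map K (space_at N i) (dsum_space I (\<lambda>s. space_at (Z s) i)) (\<phi> i)"
    and bij: "bij_betw (\<phi> i) (carrier (space_at N i)) (\<Pi>\<^sub>E s\<in>I. carrier (space_at (Z s) i))" if "i \<in> verts Q" for i
    using \<phi>(1)[OF that] by (simp_all add: linear_iso_def ds dsum_space_simps)
  note L = linear_mapD[OF lin]
  have comp_mem: "\<phi> i x s \<in> carrier (space_at (Z s) i)" if "i \<in> verts Q" "x \<in> carrier (space_at N i)" "s \<in> I" for i x s
    by (rule dsum_space_component[OF L(1)[OF that(1,2)] that(3)])
  have comp_add: "\<phi> i (x \<oplus>\<^bsub>space_at N i\<^esub> y) s = \<phi> i x s \<oplus>\<^bsub>space_at (Z s) i\<^esub> \<phi> i y s"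
    if "i \<in> verts Q" "x \<in> carrier (space_at N i)" "y \<in> carrier (space_at N i)" "s \<in> I" for i x y s
    using L(2)[OF that(1-3)] that(4) by (simp add: dsum_space_simps)
  have comp_smult: "\<phi> i (c \<odot>\<^bsub>space_at N i\<^esub> x) s = c \<odot>\<^bsub>space_at (Z s) i\<^esub> \<phi> i x s"
    if "i \<in> verts Q" "c \<in> carrier K" "x \<in> carrier (space_at N i)" "s \<in> I" for i c x s
    using L(3)[OF that(1-3)] that(4) by (simp add: dsum_space_simps)
  have C: "subspace K (C i) (space_at N i)" if i: "i \<in> verts Q" for i
  proof (rule subspaceI)
    interpret Ni: vectorspace K "space_at N i" by (rule is_repD(1)[OF N i])
    show "vectorspace K (space_at N i)" ..
    show "C i \<subseteq> carrier (space_at N i)" by (auto simp: C_def)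
    show "\<zero>\<^bsub>space_at N i\<^esub> \<in> C i" using L(4)[OF i] by (simp add: C_def dsum_space_simps)
    have z: "vectorspace K (space_at (Z s) i)" if "s \<in> I" for s by (rule is_repD(1)[OF Z[OF that] i])
    show "x \<oplus>\<^bsub>space_at N i\<^esub> y \<in> C i" if "x \<in> C i" "y \<in> C i" for x y
      using that subspaceD(3)[OF subspace_zero[OF z]] by (simp add: C_def comp_add[OF i])
    show "c \<odot>\<^bsub>space_at N i\<^esub> x \<in> C i" if "c \<in> carrier K" "x \<in> C i" for c x
      using that subspaceD(4)[OF subspace_zero[OF z]] by (simp add: C_def comp_smult[OF i])
  qed
  have Cc: "x \<in> carrier (space_at N i)" if "x \<in> C i" for i x using that by (simp add: C_def)
  have maps: "map_at N \<alpha> x \<in> C (head Q \<alpha>) \<and> \<phi> (head Q \<alpha>) (map_at N \<alpha> x) j = map_at (Z j) \<alpha> (\<phi> (tail Q \<alpha>) x j)"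
    if \<alpha>: "\<alpha> \<in> arcs Q" and x: "x \<in> C (tail Q \<alpha>)" for \<alpha> x
  proof -
    have eq: "\<phi> (head Q \<alpha>) (map_at N \<alpha> x) s = map_at (Z s) \<alpha> (\<phi> (tail Q \<alpha>) x s)" if "s \<in> I" for s
      using \<phi>(2)[OF \<alpha> Cc[OF x]] that by (simp add: dsum_rep_def)
    have "map_at N \<alpha> x \<in> carrier (space_at N (head Q \<alpha>))" by (rule linear_mapD(1)[OF is_repD(3)[OF N \<alpha>] Cc[OF x]])
    then show ?thesis using eq x j linear_mapD(4)[OF is_repD(3)[OF Z \<alpha>]] by (simp add: C_def)
  qed
  show rep: "is_rep K Q ?Y"
    unfolding is_rep_def Ys
  proof (intro conjI ballI)
    show "vectorspace K ((space_at N i)\<lparr>carrier := C i\<rparr>)" "vectorspace.fin_dim K ((space_at N i)\<lparr>carrier := C i\<rparr>)" if i: "i \<in> verts Q" for i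
      by (rule subspaceD(8)[OF C[OF i]], rule subspace_fin_dim[OF C[OF i] is_repD(2)[OF N i]])
    fix \<alpha> assume \<alpha>: "\<alpha> \<in> arcs Q"
    have t: "tail Q \<alpha> \<in> verts Q" "head Q \<alpha> \<in> verts Q" using Q \<alpha> by (auto simp: incident_def)
    note l = linear_mapD[OF is_repD(3)[OF N \<alpha>]]
    show "linear_map K ((space_at N (tail Q \<alpha>))\<lparr>carrier := C (tail Q \<alpha>)\<rparr>) ((space_at N (head Q \<alpha>))\<lparr>carrier := C (head Q \<alpha>)\<rparr>) (map_at N \<alpha>)"
      by (rule linear_mapI[OF subspaceD(8)[OF C[OF t(1)]] subspaceD(8)[OF C[OF t(2)]]]) (use maps[OF \<alpha>] Cc l in auto)
  qed
  show "rep_iso K Q ?Y (Z j)"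
  proof (rule rep_isoI[where \<phi> = "\<lambda>i x. \<phi> i x j"])
    fix i assume i: "i \<in> verts Q"
    show "linear_iso K (space_at ?Y i) (space_at (Z j) i) (\<lambda>x. \<phi> i x j)"
    proof (rule linear_isoI)
      show "vectorspace K (space_at ?Y i)" by (rule is_repD(1)[OF rep i])
      show "vectorspace K (space_at (Z j) i)" by (rule is_repD(1)[OF Z[OF j] i])
      show "bij_betw (\<lambda>x. \<phi> i x j) (carrier (space_at ?Y i)) (carrier (space_at (Z j) i))"
        unfolding Ys
      proof (rule bij_betwI')
        fix x y assume xy: "x \<in> carrier ((space_at N i)\<lparr>carrier := C i\<rparr>)" "y \<in> carrier ((space_at N i)\<lparr>carrier := C i\<rparr>)"
        then have c: "x \<in> C i" "y \<in> C i" by auto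
        show "\<phi> i x j = \<phi> i y j \<longleftrightarrow> x = y"
        proof
          assume eq: "\<phi> i x j = \<phi> i y j"
          have "\<phi> i x = \<phi> i y"
          proof (rule PiE_ext)
            show "\<phi> i x \<in> (\<Pi>\<^sub>E s\<in>I. carrier (space_at (Z s) i))" "\<phi> i y \<in> (\<Pi>\<^sub>E s\<in>I. carrier (space_at (Z s) i))"
              using bij_betwE[OF bij[OF i]] Cc c by auto
            show "\<phi> i x s = \<phi> i y s" if "s \<in> I" for s using c eq that by (cases "s = j") (auto simp: C_def)
          qed
          then show "x = y" using bij[OF i] Cc c by (auto simp: bij_betw_def dest: inj_onD)
        qed simp
      next
        fix x assume "x \<in> carrier ((space_at N i)\<lparr>carrier := C i\<rparr>)"
        then show "\<phi> i x j \<in> carrier (space_at (Z j) i)" using comp_mem[OF i Cc j] by simp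
      next
        fix y assume y: "y \<in> carrier (space_at (Z j) i)"
        let ?f = "\<lambda>s\<in>I. if s = j then y else \<zero>\<^bsub>space_at (Z s) i\<^esub>"
        have "?f \<in> (\<Pi>\<^sub>E s\<in>I. carrier (space_at (Z s) i))"
          using y subspaceD(2)[OF subspace_carrier[OF is_repD(1)[OF Z i]]] by auto
        then have "?f \<in> \<phi> i ` carrier (space_at N i)" by (simp only: bij_betw_imp_surj_on[OF bij[OF i]])
        then obtain x where "?f = \<phi> i x" "x \<in> carrier (space_at N i)" by (rule imageE)
        then have x: "x \<in> carrier (space_at N i)" "\<phi> i x = ?f" by (simp_all only:)
        then have "x \<in> C i" "\<phi> i x j = y" using j by (auto simp: C_def)
        then show "\<exists>x\<in>carrier ((space_at N i)\<lparr>carrier := C i\<rparr>). y = \<phi> i x j" by auto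
      qed
    qed (use comp_add[OF i Cc Cc j] comp_smult[OF i _ Cc j] in \<open>auto simp: Ys\<close>)
  next
    fix \<alpha> x assume "\<alpha> \<in> arcs Q" "x \<in> carrier (space_at ?Y (tail Q \<alpha>))"
    then show "\<phi> (head Q \<alpha>) (map_at ?Y \<alpha> x) j = map_at (Z j) \<alpha> (\<phi> (tail Q \<alpha>) x j)" using maps by (simp add: Ys)
  qed
qed

text \<open>
  Additivity of \<open>\<chi>\<close> forces the number of summands in any decomposition. A decomposition on the carrier
  type of \<open>N\<close> is obtained from the given one, whose summands may live on another type, by passing to the
  corresponding summands inside \<open>N\<close>.
\<close>

lemma num_indec_summands_eq_dim_minus_rank:
  fixes N :: "('k, 'w, nat, 'e) qrep" and Z :: "'j \<Rightarrow> ('k, 'u, nat, 'e) qrep"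
  assumes K: "field K" and Q: "dynkin_type_A l Q" and N: "is_rep K Q N" and I: "finite I"
    and Z: "\<And>j. j \<in> I \<Longrightarrow> is_rep K Q (Z j) \<and> indecomposable K Q (Z j)"
    and iso: "rep_iso K Q N (dsum_rep I Z)"
  shows "int (num_indec_summands K Q N) = dim_minus_rank K Q N"
proof -
  note inc = dynkin_incident(1)[OF Q]
  define good where "good m \<longleftrightarrow> (\<exists>Y :: nat \<Rightarrow> ('k, 'w, nat, 'e) qrep.
    (\<forall>j<m. is_rep K Q (Y j) \<and> indecomposable K Q (Y j)) \<and> rep_iso K Q N (dsum_rep {..<m} Y))" for m
  have count: "int m = dim_minus_rank K Q N" if "good m" for m
  proof -
    from that obtain Y :: "nat \<Rightarrow> ('k, 'w, nat, 'e) qrep" where Y: "\<And>j. j \<in> {..<m} \<Longrightarrow> is_rep K Q (Y j)"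
      "\<And>j. j \<in> {..<m} \<Longrightarrow> indecomposable K Q (Y j)" and isoY: "rep_iso K Q N (dsum_rep {..<m} Y)"
      unfolding good_def by auto
    have "dim_minus_rank K Q N = dim_minus_rank K Q (dsum_rep {..<m} Y)"
      by (rule dim_minus_rank_iso[OF inc N dsum_rep_is_rep[OF K inc _ Y(1)] isoY, symmetric]) simp_all
    also have "\<dots> = (\<Sum>j\<in>{..<m}. dim_minus_rank K Q (Y j))" by (rule dim_minus_rank_dsum[OF K inc _ Y(1)]) simp_all
    also have "\<dots> = int m" using indecomposable_type_A(3)[OF Q Y] by simp
    finally show ?thesis by simp
  qed
  obtain \<phi> where \<phi>: "\<And>i. i \<in> verts Q \<Longrightarrow> linear_iso K (space_at N i) (space_at (dsum_rep I Z) i) (\<phi> i)"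
    "\<And>\<alpha> x. \<alpha> \<in> arcs Q \<Longrightarrow> x \<in> carrier (space_at N (tail Q \<alpha>)) \<Longrightarrow> \<phi> (head Q \<alpha>) (map_at N \<alpha> x) = map_at (dsum_rep I Z) \<alpha> (\<phi> (tail Q \<alpha>) x)"
    using rep_isoE[OF iso] by metis
  have Zr: "\<And>j. j \<in> I \<Longrightarrow> is_rep K Q (Z j)" using Z by blast
  have S: "is_rep K Q (summand N \<phi> I Z j)" "rep_iso K Q (summand N \<phi> I Z j) (Z j)" if "j \<in> I" for j
    by (rule summand_iso[OF K inc N _ _ _ that]; (rule Zr \<phi>; assumption))+
  obtain h where h: "bij_betw h {..<card I} I" using ex_bij_betw_nat_finite[OF I] by (auto simp: atLeast0LessThan)
  have hI: "h t \<in> I" if "t \<in> {..<card I}" for t using bij_betwE[OF h] that by blast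
  let ?Y = "\<lambda>t. summand N \<phi> I Z (h t)"
  have "good (card I)"
    unfolding good_def
  proof (intro exI[of _ ?Y] conjI allI impI)
    fix t assume "t < card I"
    then have t: "h t \<in> I" using hI by simp
    show "is_rep K Q (?Y t)" by (rule S(1)[OF t])
    show "indecomposable K Q (?Y t)" by (rule indecomposable_iso[OF inc S(1)[OF t] Zr[OF t] S(2)[OF t]]) (use Z t in auto)
  next
    have "rep_iso K Q (dsum_rep {..<card I} (\<lambda>t. Z (h t))) (dsum_rep {..<card I} ?Y)"
      by (rule rep_iso_dsum[OF K inc], rule rep_iso_sym[OF S(2) inc S(1)]) (use hI in auto)
    then show "rep_iso K Q N (dsum_rep {..<card I} ?Y)"
      using rep_iso_trans[OF rep_iso_trans[OF iso rep_iso_reindex[OF K h Zr] inc] _ inc] by blast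
  qed
  then have "num_indec_summands K Q N = card I"
    unfolding num_indec_summands_def good_def[symmetric] using count by (intro the_equality) (auto, metis of_nat_eq_iff)
  then show ?thesis using count[OF \<open>good (card I)\<close>] by simp
qed

section \<open>Tensor powers of representations\<close>

lemma tensor_power_rep_simps:
  "space_at (tensor_power_rep K Q n M) i = tensor_space K (replicate n (space_at M i))"
  "map_at (tensor_power_rep K Q n M) \<alpha> = tensor_map K (replicate n (space_at M (head Q \<alpha>))) (replicate n (map_at M \<alpha>))"
  by (simp_all add: tensor_power_rep_def tensor_rep_def)

lemma tensor_power_is_rep:
  assumes Q: "incident Q" and M: "is_rep K Q M"
  shows "is_rep K Q (tensor_power_rep K Q n M)"
  unfolding is_rep_def tensor_power_rep_simps
proof (intro conjI ballI)
  fix i assume "i \<in> verts Q"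
  note d = tensor_power_dim[OF is_repD(1,2)[OF M this]]
  show "vectorspace K (tensor_space K (replicate n (space_at M i)))"
    "vectorspace.fin_dim K (tensor_space K (replicate n (space_at M i)))" by (rule d)+
next
  fix \<alpha> assume \<alpha>: "\<alpha> \<in> arcs Q"
  then have t: "tail Q \<alpha> \<in> verts Q" "head Q \<alpha> \<in> verts Q" using Q by (auto simp: incident_def)
  show "linear_map K (tensor_space K (replicate n (space_at M (tail Q \<alpha>)))) (tensor_space K (replicate n (space_at M (head Q \<alpha>))))
     (tensor_map K (replicate n (space_at M (head Q \<alpha>))) (replicate n (map_at M \<alpha>)))"
    by (rule tensor_map_linear_rank(1)[OF is_repD(3)[OF M \<alpha>] is_repD(2)[OF M t(1)] is_repD(2)[OF M t(2)]])
qed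

lemma dim_minus_rank_tensor_power:
  assumes Q: "incident Q" and M: "is_rep K Q M"
  shows "dim_minus_rank K Q (tensor_power_rep K Q n M) =
    (\<Sum>i\<in>verts Q. int (vectorspace.dim K (space_at M i)) ^ n) - (\<Sum>\<alpha>\<in>arcs Q. int (arrow_rank K Q M \<alpha>) ^ n)"
proof -
  have "vectorspace.dim K (space_at (tensor_power_rep K Q n M) i) = vectorspace.dim K (space_at M i) ^ n" if "i \<in> verts Q" for i
    unfolding tensor_power_rep_simps by (rule tensor_power_dim(1)[OF is_repD(1,2)[OF M that]])
  moreover have "arrow_rank K Q (tensor_power_rep K Q n M) \<alpha> = arrow_rank K Q M \<alpha> ^ n" if \<alpha>: "\<alpha> \<in> arcs Q" for \<alpha>
  proof -
    have t: "tail Q \<alpha> \<in> verts Q" "head Q \<alpha> \<in> verts Q" using Q \<alpha> by (auto simp: incident_def)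
    show ?thesis unfolding arrow_rank_def tensor_power_rep_simps
      by (rule tensor_map_linear_rank(2)[OF is_repD(3)[OF M \<alpha>] is_repD(2)[OF M t(1)] is_repD(2)[OF M t(2)]])
  qed
  ultimately show ?thesis unfolding dim_minus_rank_def by simp
qed

section \<open>Arrows and roots of length two\<close>

definition edge_root :: "('q, 'e) pre_digraph \<Rightarrow> 'e \<Rightarrow> 'q \<Rightarrow> nat" where
  "edge_root Q \<alpha> = (\<lambda>i. if i \<in> {tail Q \<alpha>, head Q \<alpha>} then 1 else 0)"

lemma dynkin_arcs:
  assumes "dynkin_type_A l Q"
  shows "\<alpha> \<in> arcs Q \<Longrightarrow> tail Q \<alpha> \<noteq> head Q \<alpha>"
    and "\<alpha> \<in> arcs Q \<Longrightarrow> \<beta> \<in> arcs Q \<Longrightarrow> {tail Q \<alpha>, head Q \<alpha>} = {tail Q \<beta>, head Q \<beta>} \<Longrightarrow> \<alpha> = \<beta>"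
proof -
  from assms obtain p e where p: "bij_betw p {1..l} {1..l}" and e: "bij_betw e {1..<l} (arcs Q)"
    and pe: "\<And>i. i \<in> {1..<l} \<Longrightarrow> {tail Q (e i), head Q (e i)} = {p i, p (Suc i)}"
    unfolding dynkin_type_A_def by blast
  have ae: "\<exists>i\<in>{1..<l}. \<alpha> = e i" if "\<alpha> \<in> arcs Q" for \<alpha>
    using that bij_betw_imp_surj_on[OF e] by blast
  have pinj: "i = j" if "p i = p j" "i \<in> {1..l}" "j \<in> {1..l}" for i j
    by (rule inj_onD[OF bij_betw_imp_inj_on[OF p] that])
  show "tail Q \<alpha> \<noteq> head Q \<alpha>" if \<alpha>: "\<alpha> \<in> arcs Q"
  proof
    assume eq: "tail Q \<alpha> = head Q \<alpha>"
    from ae[OF \<alpha>] obtain i where i: "i \<in> {1..<l}" "\<alpha> = e i" by blast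
    have s: "{head Q \<alpha>} = {p i, p (Suc i)}" using pe[OF i(1)] eq i(2) by simp
    have "p i \<in> {head Q \<alpha>}" "p (Suc i) \<in> {head Q \<alpha>}" unfolding s by simp_all
    then have "p i = p (Suc i)" by simp
    then show False using pinj[of i "Suc i"] i(1) by auto
  qed
  show "\<alpha> = \<beta>" if \<alpha>: "\<alpha> \<in> arcs Q" and \<beta>: "\<beta> \<in> arcs Q" and eq: "{tail Q \<alpha>, head Q \<alpha>} = {tail Q \<beta>, head Q \<beta>}"
  proof -
    from ae[OF \<alpha>] obtain i where i: "i \<in> {1..<l}" "\<alpha> = e i" by blast
    from ae[OF \<beta>] obtain j where j: "j \<in> {1..<l}" "\<beta> = e j" by blast
    have "{p i, p (Suc i)} = {p j, p (Suc j)}"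
      using pe[OF i(1)] pe[OF j(1)] eq unfolding i(2) j(2) by (simp only:)
    then have "i = j \<or> (i = Suc j \<and> Suc i = j)"
      unfolding doubleton_eq_iff using pinj[of i j] pinj[of i "Suc j"] pinj[of "Suc i" j] i(1) j(1) by auto
    then show ?thesis using i j by auto
  qed
qed

lemma tits_form_edge_root:
  assumes Q: "dynkin_type_A l Q" and \<alpha>: "\<alpha> \<in> arcs Q"
  shows "edge_root Q \<alpha> \<in> pos_roots Q" "dimvec_length Q (edge_root Q \<alpha>) = 2"
proof -
  note inc = dynkin_incident[OF Q]
  have t: "tail Q \<alpha> \<in> verts Q" "head Q \<alpha> \<in> verts Q" using inc(1) \<alpha> by (auto simp: incident_def)
  have fin: "finite (verts Q)" using inc(3) by simp
  note ne = dynkin_arcs(1)[OF Q \<alpha>]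
  have sub: "{tail Q \<alpha>, head Q \<alpha>} \<subseteq> verts Q" using t by simp
  have "(\<Sum>i\<in>verts Q. edge_root Q \<alpha> i) = (\<Sum>i\<in>{tail Q \<alpha>, head Q \<alpha>}. 1)"
    by (rule sum.mono_neutral_cong_right[OF fin sub]) (auto simp: edge_root_def)
  then show "dimvec_length Q (edge_root Q \<alpha>) = 2" using ne by (simp add: dimvec_length_def)
  have "(\<Sum>i\<in>verts Q. (int (edge_root Q \<alpha> i))\<^sup>2) = (\<Sum>i\<in>{tail Q \<alpha>, head Q \<alpha>}. 1)"
    by (rule sum.mono_neutral_cong_right[OF fin sub]) (auto simp: edge_root_def)
  moreover have "(\<Sum>\<beta>\<in>arcs Q. int (edge_root Q \<alpha> (tail Q \<beta>)) * int (edge_root Q \<alpha> (head Q \<beta>))) = (\<Sum>\<beta>\<in>{\<alpha>}. 1)"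
  proof (rule sum.mono_neutral_cong_right[OF inc(2)])
    show "\<forall>\<beta>\<in>arcs Q - {\<alpha>}. int (edge_root Q \<alpha> (tail Q \<beta>)) * int (edge_root Q \<alpha> (head Q \<beta>)) = 0"
    proof
      fix \<beta> assume \<beta>: "\<beta> \<in> arcs Q - {\<alpha>}"
      then have "{tail Q \<beta>, head Q \<beta>} \<noteq> {tail Q \<alpha>, head Q \<alpha>}" using dynkin_arcs(2)[OF Q] \<alpha> by blast
      moreover have "tail Q \<beta> \<noteq> head Q \<beta>" using dynkin_arcs(1)[OF Q] \<beta> by blast
      ultimately show "int (edge_root Q \<alpha> (tail Q \<beta>)) * int (edge_root Q \<alpha> (head Q \<beta>)) = 0"
        by (auto simp: edge_root_def)
    qed
  qed (use \<alpha> in \<open>auto simp: edge_root_def\<close>)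
  ultimately have "tits_form Q (edge_root Q \<alpha>) = 1" using ne by (simp add: tits_form_def)
  then show "edge_root Q \<alpha> \<in> pos_roots Q" using t by (auto simp: pos_roots_def edge_root_def)
qed

text \<open>
  If no arrow had both ends in the support of \<open>d\<close>, the Tits form would be the sum of the squares of the
  entries. This sum is at least the length 2, but the form is 1 at a root. So some arrow has both ends in
  the support, and the length leaves no room for anything else.
\<close>

lemma roots_of_length_two:
  assumes Q: "dynkin_type_A l Q"
  shows "bij_betw (edge_root Q) (arcs Q) {d. d \<in> pos_roots Q \<and> dimvec_length Q d = 2}"
proof (rule bij_betwI')
  note inc = dynkin_incident[OF Q]
  have fin: "finite (verts Q)" using inc(3) by simp
  fix \<alpha> \<beta> assume \<alpha>: "\<alpha> \<in> arcs Q" and \<beta>: "\<beta> \<in> arcs Q"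
  show "edge_root Q \<alpha> = edge_root Q \<beta> \<longleftrightarrow> \<alpha> = \<beta>"
  proof
    assume eq: "edge_root Q \<alpha> = edge_root Q \<beta>"
    have "{tail Q \<gamma>, head Q \<gamma>} = {i. edge_root Q \<gamma> i = 1}" for \<gamma> by (auto simp: edge_root_def)
    then show "\<alpha> = \<beta>" using dynkin_arcs(2)[OF Q \<alpha> \<beta>] eq by simp
  qed simp
next
  fix \<alpha> assume "\<alpha> \<in> arcs Q"
  then show "edge_root Q \<alpha> \<in> {d. d \<in> pos_roots Q \<and> dimvec_length Q d = 2}" using tits_form_edge_root[OF Q] by simp
next
  note inc = dynkin_incident[OF Q]
  have fin: "finite (verts Q)" using inc(3) by simp
  fix d assume "d \<in> {d. d \<in> pos_roots Q \<and> dimvec_length Q d = 2}"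
  then have off: "\<And>i. i \<notin> verts Q \<Longrightarrow> d i = 0" and tits: "tits_form Q d = 1" and len: "(\<Sum>i\<in>verts Q. d i) = 2"
    by (auto simp: pos_roots_def dimvec_length_def)
  have "\<exists>\<alpha>\<in>arcs Q. d (tail Q \<alpha>) \<noteq> 0 \<and> d (head Q \<alpha>) \<noteq> 0"
  proof (rule ccontr)
    assume "\<not> ?thesis"
    then have "(\<Sum>\<alpha>\<in>arcs Q. int (d (tail Q \<alpha>)) * int (d (head Q \<alpha>))) = 0" by (intro sum.neutral) auto
    then have "(\<Sum>i\<in>verts Q. (int (d i))\<^sup>2) = 1" using tits by (simp add: tits_form_def)
    moreover have "(\<Sum>i\<in>verts Q. int (d i)) \<le> (\<Sum>i\<in>verts Q. (int (d i))\<^sup>2)"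
    proof (rule sum_mono)
      show "int (d i) \<le> (int (d i))\<^sup>2" for i by (cases "d i = 0") (auto simp: power2_eq_square)
    qed
    moreover have "(\<Sum>i\<in>verts Q. int (d i)) = 2" using len by (simp flip: of_nat_sum)
    ultimately show False by simp
  qed
  then obtain \<alpha> where \<alpha>: "\<alpha> \<in> arcs Q" "d (tail Q \<alpha>) \<noteq> 0" "d (head Q \<alpha>) \<noteq> 0" by blast
  have t: "{tail Q \<alpha>, head Q \<alpha>} \<subseteq> verts Q" using inc(1) \<alpha>(1) by (auto simp: incident_def)
  note ne = dynkin_arcs(1)[OF Q \<alpha>(1)]
  have "(\<Sum>i\<in>verts Q. d i) = (\<Sum>i\<in>verts Q - {tail Q \<alpha>, head Q \<alpha>}. d i) + (\<Sum>i\<in>{tail Q \<alpha>, head Q \<alpha>}. d i)"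
    by (rule sum.subset_diff[OF t fin])
  then have s: "(\<Sum>i\<in>verts Q - {tail Q \<alpha>, head Q \<alpha>}. d i) + d (tail Q \<alpha>) + d (head Q \<alpha>) = 2" using ne len by simp
  then have one: "d (tail Q \<alpha>) = 1" "d (head Q \<alpha>) = 1" "(\<Sum>i\<in>verts Q - {tail Q \<alpha>, head Q \<alpha>}. d i) = 0" using \<alpha>(2,3) by linarith+
  then have "d i = 0" if "i \<notin> {tail Q \<alpha>, head Q \<alpha>}" for i
    using that off[of i] fin by (cases "i \<in> verts Q") auto
  then have "d = edge_root Q \<alpha>" using one by (auto simp: edge_root_def)
  then show "\<exists>\<alpha>\<in>arcs Q. d = edge_root Q \<alpha>" using \<alpha>(1) by blast
qed

lemma arrow_rank_dsum_mult:
  fixes Ind :: "(nat \<Rightarrow> nat) \<Rightarrow> ('k, 'u, nat, 'e) qrep"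
  assumes K: "field K" and Q: "dynkin_type_A l Q" and D: "finite D"
    and Ind: "\<And>d. d \<in> D \<Longrightarrow> is_rep K Q (Ind d) \<and> indecomposable K Q (Ind d) \<and> dimvec K Q (Ind d) = d"
    and \<alpha>: "\<alpha> \<in> arcs Q"
  shows "arrow_rank K Q (dsum_mult D a Ind) \<alpha> = (\<Sum>d | d \<in> D \<and> dimvec_le Q (edge_root Q \<alpha>) d. a d)"
proof -
  note inc = dynkin_incident[OF Q]
  have t: "tail Q \<alpha> \<in> verts Q" "head Q \<alpha> \<in> verts Q" using inc(1) \<alpha> by (auto simp: incident_def)
  let ?S = "SIGMA d:D. {..<a d}"
  have rank: "arrow_rank K Q (Ind d) \<alpha> = (if dimvec_le Q (edge_root Q \<alpha>) d then 1 else 0)" if d: "d \<in> D" for d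
  proof -
    have dim: "vectorspace.dim K (space_at (Ind d) i) = d i" if "i \<in> verts Q" for i
    proof -
      have "dimvec K Q (Ind d) i = d i" using Ind[OF d] by simp
      then show ?thesis using that by (simp add: dimvec_def)
    qed
    have rI: "is_rep K Q (Ind d)" "indecomposable K Q (Ind d)" using Ind[OF d] by auto
    have "d (tail Q \<alpha>) \<le> 1" "d (head Q \<alpha>) \<le> 1"
      using indecomposable_type_A(1)[OF Q rI t(1)] indecomposable_type_A(1)[OF Q rI t(2)] dim t by simp_all
    moreover have "arrow_rank K Q (Ind d) \<alpha> = d (tail Q \<alpha>) * d (head Q \<alpha>)"
      using indecomposable_type_A(2)[OF Q rI \<alpha>] dim t by simp
    moreover have "dimvec_le Q (edge_root Q \<alpha>) d \<longleftrightarrow> 1 \<le> d (tail Q \<alpha>) \<and> 1 \<le> d (head Q \<alpha>)"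
      using t by (auto simp: dimvec_le_def edge_root_def)
    ultimately show ?thesis by (auto simp: le_Suc_eq)
  qed
  have "arrow_rank K Q (dsum_mult D a Ind) \<alpha> = (\<Sum>(d, k)\<in>?S. arrow_rank K Q (Ind d) \<alpha>)"
    unfolding dsum_mult_def
    by (subst dsum_rep_dim_rank(2)[OF K inc(1) _ _ \<alpha>]) (use D Ind in \<open>auto intro: sum.cong\<close>)
  also have "\<dots> = (\<Sum>d\<in>D. \<Sum>k<a d. arrow_rank K Q (Ind d) \<alpha>)"
    by (rule sum.Sigma[symmetric]) (use D in auto)
  also have "\<dots> = (\<Sum>d\<in>D. if dimvec_le Q (edge_root Q \<alpha>) d then a d else 0)"
    by (rule sum.cong[OF refl]) (simp add: rank)
  also have "\<dots> = (\<Sum>d | d \<in> D \<and> dimvec_le Q (edge_root Q \<alpha>) d. a d)"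
    by (rule sum.inter_filter[OF D, symmetric])
  finally show ?thesis .
qed

lemma finite_thin_dimvecs:
  assumes "finite A" "\<And>d i. d \<in> D \<Longrightarrow> i \<in> A \<Longrightarrow> d i \<le> (1 :: nat)" "\<And>d i. d \<in> D \<Longrightarrow> i \<notin> A \<Longrightarrow> d i = 0"
  shows "finite D"
proof (rule finite_subset)
  show "D \<subseteq> (\<lambda>S i. if i \<in> S then 1 else 0) ` Pow A"
  proof
    fix d assume d: "d \<in> D"
    have "d i = (if i \<in> {i \<in> A. d i = 1} then 1 else 0)" for i
      using assms(2)[OF d, of i] assms(3)[OF d, of i] by (cases "i \<in> A") auto
    then show "d \<in> (\<lambda>S i. if i \<in> S then 1 else 0) ` Pow A" by (intro image_eqI[of _ _ "{i \<in> A. d i = 1}"]) auto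
  qed
  show "finite ((\<lambda>S i. if i \<in> S then 1 else (0 :: nat)) ` Pow A)" using assms(1) by simp
qed

theorem theorem5p13:
  fixes K :: "('k, 'z) ring_scheme"
    and Q :: "(nat, 'e) pre_digraph"
    and l n :: nat
    and M :: "('k, 'v, nat, 'e) qrep"
    and Ind :: "(nat \<Rightarrow> nat) \<Rightarrow> ('k, 'u, nat, 'e) qrep"
    and a an :: "(nat \<Rightarrow> nat) \<Rightarrow> nat"
  assumes "algebraically_closed K"
    and "dynkin_type_A l Q"
    and "n > 0"
    and "is_rep K Q M"
    and "\<forall>d\<in>pos_roots Q. is_rep K Q (Ind d) \<and> indecomposable K Q (Ind d) \<and> dimvec K Q (Ind d) = d"
    and "rep_iso K Q M (dsum_mult (pos_roots Q) a Ind)"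
    and "rep_iso K Q (tensor_power_rep K Q n M) (dsum_mult (pos_roots Q) an Ind)"
  shows "int (b_num K Q n M) =
           (\<Sum>i=1..l. int (vectorspace.dim K (space_at M i)) ^ n)
           - (\<Sum>d | d \<in> pos_roots Q \<and> dimvec_length Q d = 2.
                (\<Sum>d' | d' \<in> pos_roots Q \<and> dimvec_le Q d d'. int (a d')) ^ n)"
proof -
  have K: "field K" using assms(1) by (simp add: algebraically_closed_def)
  note Q = assms(2) and M = assms(4)
  note inc = dynkin_incident[OF Q]
  have Ind: "is_rep K Q (Ind d)" "indecomposable K Q (Ind d)" "dimvec K Q (Ind d) = d" if "d \<in> pos_roots Q" for d
    using assms(5) that by auto
  have fin: "finite (pos_roots Q)"
  proof (rule finite_thin_dimvecs)
    show "finite (verts Q)" using inc(3) by simp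
    fix d i assume d: "d \<in> pos_roots Q"
    show "d i = 0" if "i \<notin> verts Q" using d that by (simp add: pos_roots_def)
    show "d i \<le> 1" if "i \<in> verts Q"
      using indecomposable_type_A(1)[OF Q Ind(1,2)[OF d] that] fun_cong[OF Ind(3)[OF d], of i] that by (simp add: dimvec_def)
  qed
  have sum_rep: "is_rep K Q (dsum_mult (pos_roots Q) c Ind)" for c
    unfolding dsum_mult_def by (rule dsum_rep_is_rep[OF K inc(1)]) (use fin Ind in auto)
  have "int (b_num K Q n M) = dim_minus_rank K Q (tensor_power_rep K Q n M)"
    unfolding b_num_def
    by (rule num_indec_summands_eq_dim_minus_rank[OF K Q tensor_power_is_rep[OF inc(1) M] _ _ assms(7)[unfolded dsum_mult_def]])
      (use fin Ind in auto)
  also have "\<dots> = (\<Sum>i\<in>verts Q. int (vectorspace.dim K (space_at M i)) ^ n) - (\<Sum>\<alpha>\<in>arcs Q. int (arrow_rank K Q M \<alpha>) ^ n)"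
    by (rule dim_minus_rank_tensor_power[OF inc(1) M])
  also have "(\<Sum>\<alpha>\<in>arcs Q. int (arrow_rank K Q M \<alpha>) ^ n) =
    (\<Sum>\<alpha>\<in>arcs Q. (\<Sum>d' | d' \<in> pos_roots Q \<and> dimvec_le Q (edge_root Q \<alpha>) d'. int (a d')) ^ n)"
  proof (rule sum.cong[OF refl])
    fix \<alpha> assume \<alpha>: "\<alpha> \<in> arcs Q"
    have "arrow_rank K Q M \<alpha> = arrow_rank K Q (dsum_mult (pos_roots Q) a Ind) \<alpha>"
      by (rule rep_iso_dim_rank(2)[OF inc(1) M sum_rep assms(6) \<alpha>, symmetric])
    also have "\<dots> = (\<Sum>d' | d' \<in> pos_roots Q \<and> dimvec_le Q (edge_root Q \<alpha>) d'. a d')"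
      by (rule arrow_rank_dsum_mult[OF K Q fin _ \<alpha>]) (use Ind in auto)
    finally show "int (arrow_rank K Q M \<alpha>) ^ n = (\<Sum>d' | d' \<in> pos_roots Q \<and> dimvec_le Q (edge_root Q \<alpha>) d'. int (a d')) ^ n" by simp
  qed
  also have "\<dots> = (\<Sum>d | d \<in> pos_roots Q \<and> dimvec_length Q d = 2.
      (\<Sum>d' | d' \<in> pos_roots Q \<and> dimvec_le Q d d'. int (a d')) ^ n)"
    by (rule sum.reindex_bij_betw[OF roots_of_length_two[OF Q]])
  finally show ?thesis by (simp add: inc(3))
qed

end
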